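(* If $\mathcal P=(\Delta,\mathcal F)$ is a simple lattice multi-polytope, then $$\mathcal T(\partial/\partial h)\,\mathrm{vol}(\mathcal P_h)\big|_{h=0}=\sharp(\mathcal P).$$
   Context: **Multi-fans.** Let $N$ be a lattice of rank $n$ and $N_{\mathbb R}=N\otimes\mathbb R$. A cone in $N$ is a strongly convex rational polyhedral cone in $N_{\mathbb R}$ (the set of nonnegative real combinations of finitely many vectors of $N$, containing no line). $\mathrm{Cone}(N)$ is the set of all cones, partially ordered by $\tau\prec\sigma$ iff $\tau$ is a proper face of $\sigma$. A multi-fan of dimension $n$ in $N$ is a triple $\Delta=(\Sigma,C,w^{\pm})$ where $\Sigma$ is a finite partially ordered set with a unique minimum element $*$; $C:\Sigma\to\mathrm{Cone}(N)$ is a map with (1) $C( * )=\{0\}$, (2) $I<J$ implies $C(I)\prec C(J)$, (3) for each $J\in\Sigma$, $C$ restricts to an isomorphism of ordered sets from $\{I\in\Sigma: I\le J\}$ onto $\{\kappa\in\mathrm{Cone}(N):\kappa\preceq C(J)\}$; and, with $\Sigma^{(m)}=\{I\in\Sigma:\dim C(I)=m\}$ (write $|I|=m$ for $I\in\Sigma^{(m)}$), $w^+,w^-:\Sigma^{(n)}\to\mathbb Z_{\ge0}$ are functions such that $w^+(I)>0$ or $w^-(I)>0$ for each $I$. Put $w=w^+-w^-$. A vector $v\in N_{\mathbb R}$ is generic if it lies on no linear subspace spanned by a cone $C(I)$ of dimension $<n$. $\Delta$ is pre-complete if $\Sigma^{(n)}\ne\emptyset$ and $d_v=\sum_{v\in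 C(I),\,I\in\Sigma^{(n)}}w(I)$ is independent of the generic vector $v$. For $K\in\Sigma$ the projected multi-fan $\Delta_K=(\Sigma_K,C_K,w_K^\pm)$ has $\Sigma_K=\{J\in\Sigma:K\le J\}$, $C_K(J)$ = the image of $C(J)$ in the quotient of $N_{\mathbb R}$ by the span of $C(K)$ (with lattice the quotient of $N$ by the subgroup generated by $C(K)\cap N$), and $w_K^\pm$ the restrictions of $w^\pm$. $\Delta$ is complete if $\Delta$ and all $\Delta_K$, $K\in\Sigma$, are pre-complete. $\Delta$ is simplicial if every $C(I)$ is generated by linearly independent vectors; then $\Sigma$ is identified with an augmented simplicial set (abstract simplicial complex including the empty set as minimum) of subsets of $\{1,\dots,d\}$ with $\Sigma^{(1)}=\{\{1\},\dots,\{d\}\}$, and $|I|$ is the cardinality of $I$. **Multi-polytopes.** Put $V=N_{\mathbb R}$, $V^*=\mathrm{Hom}(V,\mathbb R)$, $N^*=\mathrm{Hom}(N,\mathbb Z)\subset V^*$. A multi-polytope is a pair $\mathcal P=(\Delta,\mathcal F)$ where $\Delta$ is a complete multi-fan and $\mathcal F$ assigns to each $I\in\Sigma^{(1)}$ an affine hyperplane $\mathcal F(I)\subset V^*$ on which the elements of $C(I)$ are constant. It is simple if $\Delta$ is simplicial. For simple $\mathcal P$ let $v_i$ be the primitive vector of $N$ in $C(\{i\})$ and write $F_i=\mathcal F(\{i\})=\{u\in V^*:\langle u,v_i\rangle=c_i\}$, $c_i\in\mathbb R$. For $I\in\Sigma^{(n)}$, $\bigcap_{i\in I}F_i$ is a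 point $u_I$ (a vertex); $\{u_i^I\}_{i\in I}\subset V^*$ is the basis dual to $\{v_i\}_{i\in I}$. $\mathcal P$ is a lattice multi-polytope if every vertex $u_I$ lies in $N^*$. **Duistermaat-Heckman function, volume and $\sharp(\mathcal P)$.** Fix a generic $v\in V$. For $I\in\Sigma^{(n)}$ put $(-1)^I=(-1)^{\sharp\{i\in I:\langle u_i^I,v\rangle>0\}}$, $(u_i^I)^+=u_i^I$ if $\langle u_i^I,v\rangle>0$ and $-u_i^I$ if $\langle u_i^I,v\rangle<0$; let $\phi_I$ be the characteristic function of the cone with apex $u_I$ spanned by the $(u_i^I)^+$, $i\in I$. Then $\mathrm{DH}_{\mathcal P}=\sum_{I\in\Sigma^{(n)}}(-1)^Iw(I)\phi_I$ on $V^*\setminus\bigcup_iF_i$ (it is independent of $v$ and has bounded support). $\mathrm{vol}(\mathcal P)=\int_{V^*}\mathrm{DH}_{\mathcal P}\,dV^*$, where $dV^*$ gives the unit cube of a basis of $N^*$ volume $1$. $\mathcal P_+$ is obtained from $\mathcal P$ by replacing each $c_i$ by $c_i+\varepsilon$ for sufficiently small $\varepsilon>0$ (the moved hyperplanes miss $N^*$), and $\sharp(\mathcal P)=\sum_{u\in N^*}\mathrm{DH}_{\mathcal P_+}(u)$. **Todd operator.** For $h=(h_1,\dots,h_d)\in\mathbb R^d$, $\mathcal P_h$ is the multi-polytope on $\Delta$ with hyperplanes $\{u\in V^*:\langle u,v_i\rangle=c_i+h_i\}$; $\mathrm{vol}(\mathcal P_h)$ is a polynomial in $h_1,\dots,h_d$.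 For $I\in\Sigma^{(n)}$ let $G_I\subset\mathbb R^d/\mathbb Z^d$ be the (finite) image of $\{a\in\mathbb R^d:\sum_ia_iv_i\in N,\ a_j=0\text{ for }j\notin I\}$; put $G_\Delta=\bigcup_{I\in\Sigma^{(n)}}G_I$ and $\rho_i([a])=\exp(2\pi\sqrt{-1}a_i)$. The Todd operator is $\mathcal T(\partial/\partial h)=\sum_{g\in G_\Delta}\prod_{i=1}^d\frac{\partial/\partial h_i}{1-\rho_i(g)e^{-\partial/\partial h_i}}$, understood via Maclaurin expansion; it is of infinite order but acts on polynomials. *)

theory Defs
  imports "HOL-Analysis.Analysis" "HOL-Computational_Algebra.Formal_Power_Series"
begin

section \<open>Lattices and cones\<close>

text \<open>
  A lattice \<open>N\<close> of rank \<open>n\<close> is realised as the integer span of \<open>n\<close> linearly independent vectors of a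
  Euclidean space, and \<open>N\<^sub>\<real>\<close> as the real span of \<open>N\<close>.  The span need not be the whole space: the
  rank is arbitrary (also \<open>0\<close>), and quotient lattices live in the same type (see \<open>quot_map\<close>).
\<close>

definition int_span :: "'a::real_vector set \<Rightarrow> 'a set" where
  "int_span B = {\<Sum>b\<in>B. of_int (z b) *\<^sub>R b | z. True}"

definition lattice_basis :: "'a::euclidean_space set \<Rightarrow> 'a set \<Rightarrow> bool" where
  "lattice_basis N B \<longleftrightarrow> finite B \<and> independent B \<and> N = int_span B"

definition is_lattice :: "'a::euclidean_space set \<Rightarrow> bool" where
  "is_lattice N \<longleftrightarrow> (\<exists>B. lattice_basis N B)"

text \<open>The hull of a finite \<open>S\<close> is the set of its nonnegative combinations; that of \<open>{}\<close> is \<open>{0}\<close>.\<close>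

definition cones_in :: "'a::euclidean_space set \<Rightarrow> 'a set set" where
  "cones_in N = {\<sigma>. (\<exists>S. finite S \<and> S \<subseteq> N \<and> \<sigma> = convex_cone hull S) \<and>
                    \<not> (\<exists>x y. y \<noteq> 0 \<and> range (\<lambda>t. x + t *\<^sub>R y) \<subseteq> \<sigma>)}"

text \<open>
  The quotient of a space by a subspace \<open>W\<close> is realised as the orthogonal complement of \<open>W\<close>, the
  quotient map being the orthogonal projection.
\<close>

definition quot_map :: "'a::euclidean_space set \<Rightarrow> 'a \<Rightarrow> 'a" where
  "quot_map W x = (THE y. x - y \<in> W \<and> (\<forall>w\<in>W. orthogonal y w))"


section \<open>Multi-fans\<close>

text \<open>
  \<open>\<Sigma>\<close> is a finite subset of a partially ordered type, with the induced order.  The functions \<open>C\<close> and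
  \<open>w\<^sup>\<plusminus>\<close> are relevant only on \<open>\<Sigma>\<close> and \<open>\<Sigma>\<^sup>(\<^sup>n\<^sup>)\<close> respectively.
\<close>

record ('s, 'a) multi_fan =
  lat :: "'a set"
  simps_of :: "'s set"
  cone_of :: "'s \<Rightarrow> 'a set"
  wpos :: "'s \<Rightarrow> nat"
  wneg :: "'s \<Rightarrow> nat"

definition rank :: "('s, 'a::euclidean_space) multi_fan \<Rightarrow> nat" where
  "rank \<Delta> = dim (lat \<Delta>)"

definition skel :: "('s, 'a::euclidean_space) multi_fan \<Rightarrow> nat \<Rightarrow> 's set" where
  "skel \<Delta> m = {I \<in> simps_of \<Delta>. dim (cone_of \<Delta> I) = m}"

definition weight :: "('s, 'a) multi_fan \<Rightarrow> 's \<Rightarrow> int" where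
  "weight \<Delta> I = int (wpos \<Delta> I) - int (wneg \<Delta> I)"

text \<open>
  On cones \<open>\<preceq>\<close> is \<open>face_of\<close>, \<open>\<prec>\<close> is \<open>face_of\<close> together with \<open>\<noteq>\<close>.  The empty set, a face in the sense
  of \<open>face_of\<close>, is excluded because it is not in \<open>cones_in\<close>.
\<close>

definition multi_fan :: "('s::order, 'a::euclidean_space) multi_fan \<Rightarrow> bool" where
  "multi_fan \<Delta> \<longleftrightarrow>
     is_lattice (lat \<Delta>) \<and>
     finite (simps_of \<Delta>) \<and>
     (\<forall>I\<in>simps_of \<Delta>. cone_of \<Delta> I \<in> cones_in (lat \<Delta>)) \<and>
     (\<exists>m\<in>simps_of \<Delta>. (\<forall>I\<in>simps_of \<Delta>. m \<le> I) \<and> cone_of \<Delta> m = {0}) \<and>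
     (\<forall>I\<in>simps_of \<Delta>. \<forall>J\<in>simps_of \<Delta>. I < J \<longrightarrow>
        cone_of \<Delta> I face_of cone_of \<Delta> J \<and> cone_of \<Delta> I \<noteq> cone_of \<Delta> J) \<and>
     (\<forall>J\<in>simps_of \<Delta>.
        bij_betw (cone_of \<Delta>) {I \<in> simps_of \<Delta>. I \<le> J}
                 {\<kappa> \<in> cones_in (lat \<Delta>). \<kappa> face_of cone_of \<Delta> J} \<and>
        (\<forall>I\<in>simps_of \<Delta>. \<forall>I'\<in>simps_of \<Delta>. I \<le> J \<and> I' \<le> J \<longrightarrow>
           (I \<le> I' \<longleftrightarrow> cone_of \<Delta> I face_of cone_of \<Delta> I'))) \<and>
     (\<forall>I\<in>skel \<Delta> (rank \<Delta>). wpos \<Delta> I > 0 \<or> wneg \<Delta> I > 0)"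

definition generic_vec :: "('s, 'a::euclidean_space) multi_fan \<Rightarrow> 'a \<Rightarrow> bool" where
  "generic_vec \<Delta> v \<longleftrightarrow>
     v \<in> span (lat \<Delta>) \<and>
     (\<forall>I\<in>simps_of \<Delta>. dim (cone_of \<Delta> I) < rank \<Delta> \<longrightarrow> v \<notin> span (cone_of \<Delta> I))"

definition deg_at :: "('s, 'a::euclidean_space) multi_fan \<Rightarrow> 'a \<Rightarrow> int" where
  "deg_at \<Delta> v = (\<Sum>I | I \<in> skel \<Delta> (rank \<Delta>) \<and> v \<in> cone_of \<Delta> I. weight \<Delta> I)"

definition pre_complete :: "('s, 'a::euclidean_space) multi_fan \<Rightarrow> bool" where
  "pre_complete \<Delta> \<longleftrightarrow>
     skel \<Delta> (rank \<Delta>) \<noteq> {} \<and>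
     (\<forall>v v'. generic_vec \<Delta> v \<and> generic_vec \<Delta> v' \<longrightarrow> deg_at \<Delta> v = deg_at \<Delta> v')"

text \<open>
  The quotient of \<open>N\<close> by the subgroup generated by \<open>C(K) \<inter> N\<close> is the image of \<open>N\<close> in the quotient
  of \<open>N\<^sub>\<real>\<close> by the span of \<open>C(K)\<close>, since \<open>C(K)\<close> is rational.
\<close>

definition proj_fan :: "('s::order, 'a::euclidean_space) multi_fan \<Rightarrow> 's \<Rightarrow> ('s, 'a) multi_fan" where
  "proj_fan \<Delta> K =
     \<Delta>\<lparr>lat := quot_map (span (cone_of \<Delta> K)) ` lat \<Delta>,
       simps_of := {J \<in> simps_of \<Delta>. K \<le> J},
       cone_of := (\<lambda>J. quot_map (span (cone_of \<Delta> K)) ` cone_of \<Delta> J)\<rparr>"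

definition complete_fan :: "('s::order, 'a::euclidean_space) multi_fan \<Rightarrow> bool" where
  "complete_fan \<Delta> \<longleftrightarrow>
     pre_complete \<Delta> \<and> (\<forall>K\<in>simps_of \<Delta>. pre_complete (proj_fan \<Delta> K))"

definition simplicial :: "('s, 'a::euclidean_space) multi_fan \<Rightarrow> bool" where
  "simplicial \<Delta> \<longleftrightarrow>
     (\<forall>I\<in>simps_of \<Delta>. \<exists>B. independent B \<and> cone_of \<Delta> I = convex_cone hull B)"

text \<open>
  The index set \<open>{1,\<dots>,d}\<close> is \<open>\<Sigma>\<^sup>(\<^sup>1\<^sup>)\<close> itself, and \<open>i \<in> I\<close> means \<open>i \<le> I\<close>.
\<close>

abbreviation rays :: "('s, 'a::euclidean_space) multi_fan \<Rightarrow> 's set" where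
  "rays \<Delta> \<equiv> skel \<Delta> 1"

definition vertices_of :: "('s::order, 'a::euclidean_space) multi_fan \<Rightarrow> 's \<Rightarrow> 's set" where
  "vertices_of \<Delta> I = {i \<in> rays \<Delta>. i \<le> I}"

definition primitive_in :: "'a::real_vector set \<Rightarrow> 'a \<Rightarrow> bool" where
  "primitive_in N x \<longleftrightarrow>
     x \<in> N \<and> x \<noteq> 0 \<and> (\<forall>y\<in>N. \<forall>k::nat. x = of_nat k *\<^sub>R y \<longrightarrow> k = 1)"

definition ray_vec :: "('s, 'a::euclidean_space) multi_fan \<Rightarrow> 's \<Rightarrow> 'a" where
  "ray_vec \<Delta> i = (THE x. x \<in> cone_of \<Delta> i \<and> primitive_in (lat \<Delta>) x)"


section \<open>Multi-polytopes\<close>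

text \<open>
  \<open>V\<^sup>* = Hom(N\<^sub>\<real>, \<real>)\<close> is identified with \<open>N\<^sub>\<real> = span N\<close> through the inner product of the ambient
  space: \<open>u\<close> stands for the functional \<open>x \<mapsto> u \<bullet> x\<close>.
\<close>

definition dual_lattice :: "'a::euclidean_space set \<Rightarrow> 'a set" where
  "dual_lattice N = {u \<in> span N. \<forall>x\<in>N. u \<bullet> x \<in> \<int>}"

text \<open>The Lebesgue measure on \<open>V\<^sup>*\<close> for which the unit cube of a basis of \<open>N\<^sup>*\<close> has volume \<open>1\<close>.\<close>

definition dual_measure :: "'a::euclidean_space set \<Rightarrow> 'a measure" where
  "dual_measure N =
     (let B = (SOME B. lattice_basis (dual_lattice N) B)
      in distr (\<Pi>\<^sub>M b\<in>B. (lborel :: real measure)) borel (\<lambda>x. \<Sum>b\<in>B. x b *\<^sub>R b))"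

record ('s, 'a) multi_polytope =
  fan :: "('s, 'a) multi_fan"
  hyp :: "'s \<Rightarrow> 'a set"

definition multi_polytope :: "('s::order, 'a::euclidean_space) multi_polytope \<Rightarrow> bool" where
  "multi_polytope P \<longleftrightarrow>
     multi_fan (fan P) \<and> complete_fan (fan P) \<and>
     (\<forall>i\<in>rays (fan P).
        affine (hyp P i) \<and> hyp P i \<subseteq> span (lat (fan P)) \<and>
        aff_dim (hyp P i) = int (rank (fan P)) - 1 \<and>
        (\<forall>x\<in>cone_of (fan P) i. \<exists>c. \<forall>u\<in>hyp P i. u \<bullet> x = c))"

definition simple_polytope :: "('s::order, 'a::euclidean_space) multi_polytope \<Rightarrow> bool" where
  "simple_polytope P \<longleftrightarrow> multi_polytope P \<and> simplicial (fan P)"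

definition hyp_const :: "('s, 'a::euclidean_space) multi_polytope \<Rightarrow> 's \<Rightarrow> real" where
  "hyp_const P i =
     (THE c. hyp P i = {u \<in> span (lat (fan P)). u \<bullet> ray_vec (fan P) i = c})"

definition vertex :: "('s::order, 'a::euclidean_space) multi_polytope \<Rightarrow> 's \<Rightarrow> 'a" where
  "vertex P I =
     the_elem (span (lat (fan P)) \<inter> (\<Inter>i\<in>vertices_of (fan P) I. hyp P i))"

definition dual_vec :: "('s::order, 'a::euclidean_space) multi_fan \<Rightarrow> 's \<Rightarrow> 's \<Rightarrow> 'a" where
  "dual_vec \<Delta> I i =
     (THE u. u \<in> span (lat \<Delta>) \<and>
             (\<forall>j\<in>vertices_of \<Delta> I. u \<bullet> ray_vec \<Delta> j = (if j = i then 1 else 0)))"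

definition lattice_polytope :: "('s::order, 'a::euclidean_space) multi_polytope \<Rightarrow> bool" where
  "lattice_polytope P \<longleftrightarrow>
     multi_polytope P \<and>
     (\<forall>I\<in>skel (fan P) (rank (fan P)). vertex P I \<in> dual_lattice (lat (fan P)))"

definition shift :: "('s, 'a::euclidean_space) multi_polytope \<Rightarrow> ('s \<Rightarrow> real) \<Rightarrow>
    ('s, 'a) multi_polytope" where
  "shift P h =
     P\<lparr>hyp := (\<lambda>i. {u \<in> span (lat (fan P)). u \<bullet> ray_vec (fan P) i = hyp_const P i + h i})\<rparr>"


section \<open>Duistermaat-Heckman function, volume, number of lattice points\<close>

definition dual_sign :: "('s::order, 'a::euclidean_space) multi_fan \<Rightarrow> 'a \<Rightarrow> 's \<Rightarrow> real" where
  "dual_sign \<Delta> v I = (-1) ^ card {i \<in> vertices_of \<Delta> I. dual_vec \<Delta> I i \<bullet> v > 0}"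

definition dual_vec_pos :: "('s::order, 'a::euclidean_space) multi_fan \<Rightarrow> 'a \<Rightarrow> 's \<Rightarrow> 's \<Rightarrow> 'a" where
  "dual_vec_pos \<Delta> v I i =
     (if dual_vec \<Delta> I i \<bullet> v > 0 then dual_vec \<Delta> I i else - dual_vec \<Delta> I i)"

definition vertex_cone :: "('s::order, 'a::euclidean_space) multi_polytope \<Rightarrow> 'a \<Rightarrow> 's \<Rightarrow> 'a set" where
  "vertex_cone P v I =
     (+) (vertex P I) ` (convex_cone hull (dual_vec_pos (fan P) v I ` vertices_of (fan P) I))"

text \<open>
  The formula is meaningful on all of \<open>V\<^sup>*\<close>.  It is independent of the generic vector \<open>v\<close> only off the
  hyperplanes \<open>F\<^sub>i\<close>; these are null sets, and after the small shift below they contain no lattice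
  points, so the values on them do not matter.
\<close>

definition DH :: "'a \<Rightarrow> ('s::order, 'a::euclidean_space) multi_polytope \<Rightarrow> 'a \<Rightarrow> real" where
  "DH v P u =
     (\<Sum>I\<in>skel (fan P) (rank (fan P)).
        dual_sign (fan P) v I * of_int (weight (fan P) I) * indicator (vertex_cone P v I) u)"

definition vol :: "'a \<Rightarrow> ('s::order, 'a::euclidean_space) multi_polytope \<Rightarrow> real" where
  "vol v P = (\<integral>u. DH v P u \<partial>dual_measure (lat (fan P)))"

text \<open>
  The sum over lattice points has finite support.  \<open>\<sharp>(P)\<close> is the value it takes for all sufficiently
  small \<open>\<epsilon> > 0\<close>.
\<close>

definition sharp :: "'a \<Rightarrow> ('s::order, 'a::euclidean_space) multi_polytope \<Rightarrow> real" where
  "sharp v P =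
     (THE s. \<forall>\<^sub>F \<epsilon> in at_right 0.
        (\<Sum>\<^sub>\<infinity>u\<in>dual_lattice (lat (fan P)). DH v (shift P (\<lambda>_. \<epsilon>)) u) = s)"


section \<open>Todd operator\<close>

text \<open>
  \<open>\<real>\<^sup>d\<close> is the set of functions on \<open>'s\<close> vanishing outside \<open>\<Sigma>\<^sup>(\<^sup>1\<^sup>)\<close>, and \<open>\<real>\<^sup>d/\<int>\<^sup>d\<close> the set of its
  \<open>\<int>\<^sup>d\<close>-cosets.
\<close>

definition torus_class :: "('s, 'a::euclidean_space) multi_fan \<Rightarrow> ('s \<Rightarrow> real) \<Rightarrow> ('s \<Rightarrow> real) set" where
  "torus_class \<Delta> a =
     {b. (\<forall>i\<in>rays \<Delta>. b i - a i \<in> \<int>) \<and> (\<forall>i. i \<notin> rays \<Delta> \<longrightarrow> b i = 0)}"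

definition G_at :: "('s::order, 'a::euclidean_space) multi_fan \<Rightarrow> 's \<Rightarrow> ('s \<Rightarrow> real) set set" where
  "G_at \<Delta> I =
     torus_class \<Delta> ` {a. (\<Sum>i\<in>rays \<Delta>. a i *\<^sub>R ray_vec \<Delta> i) \<in> lat \<Delta> \<and>
                         (\<forall>j. j \<notin> vertices_of \<Delta> I \<longrightarrow> a j = 0)}"

definition G_fan :: "('s::order, 'a::euclidean_space) multi_fan \<Rightarrow> ('s \<Rightarrow> real) set set" where
  "G_fan \<Delta> = (\<Union>I\<in>skel \<Delta> (rank \<Delta>). G_at \<Delta> I)"

definition rho :: "'s \<Rightarrow> ('s \<Rightarrow> real) set \<Rightarrow> complex" where
  "rho i g = the_elem ((\<lambda>a. exp (2 * of_real pi * \<i> * of_real (a i))) ` g)"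

text \<open>
  Maclaurin series of \<open>x / (1 - \<rho> e\<^sup>-\<^sup>x)\<close>.  For \<open>\<rho> = 1\<close>, division of formal power series cancels the
  common factor \<open>x\<close>.
\<close>

definition todd_series :: "complex \<Rightarrow> complex fps" where
  "todd_series \<rho> = fps_X / (1 - fps_const \<rho> * fps_exp (-1))"

definition partial_deriv :: "'s \<Rightarrow> (('s \<Rightarrow> real) \<Rightarrow> real) \<Rightarrow> ('s \<Rightarrow> real) \<Rightarrow> real" where
  "partial_deriv i f h = deriv (\<lambda>t. f (h(i := t))) (h i)"

text \<open>
  \<open>multi_deriv R k f\<close> is \<open>(\<Prod>i\<in>R. (\<partial>/\<partial>h\<^sub>i)\<^bsup>k i\<^esup>) f\<close>.  The derivatives are taken in some order, which
  is immaterial for polynomials.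
\<close>

definition multi_deriv ::
    "'s set \<Rightarrow> ('s \<Rightarrow> nat) \<Rightarrow> (('s \<Rightarrow> real) \<Rightarrow> real) \<Rightarrow> ('s \<Rightarrow> real) \<Rightarrow> real" where
  "multi_deriv R k f =
     foldr (\<lambda>i. partial_deriv i ^^ k i) (SOME is. distinct is \<and> set is = R) f"

text \<open>For polynomial \<open>f\<close> only finitely many multi-indices \<open>k\<close> contribute.\<close>

definition todd_op ::
    "('s::order, 'a::euclidean_space) multi_fan \<Rightarrow> (('s \<Rightarrow> real) \<Rightarrow> real) \<Rightarrow> ('s \<Rightarrow> real) \<Rightarrow> complex" where
  "todd_op \<Delta> f h =
     (\<Sum>g\<in>G_fan \<Delta>.
        \<Sum>\<^sub>\<infinity>k\<in>(rays \<Delta> \<rightarrow>\<^sub>E UNIV).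
          (\<Prod>i\<in>rays \<Delta>. fps_nth (todd_series (rho i g)) (k i)) *
          of_real (multi_deriv (rays \<Delta>) k f h))"

end

theory Submission
  imports Defs
begin

text \<open>
  Fix a generic \<open>v\<close>, let \<open>y\<^sub>i = \<langle>u\<^sub>i\<^sup>I, v\<rangle>\<close> and let \<open>s < 0\<close>.  The integral of \<open>DH(u) exp(s \<langle>u, v\<rangle>)\<close> is a sum over the
  vertices of products of one-dimensional integrals, namely
  \<open>\<Sum>\<^sub>I w(I) / |G\<^sub>I| exp(s \<langle>u\<^sub>I, v\<rangle>) \<Prod>\<^sub>i 1 / (s y\<^sub>i)\<close>; the sum over the lattice points of the slightly
  enlarged multi-polytope is likewise
  \<open>\<Sum>\<^sub>I w(I) / |G\<^sub>I| \<Sum>\<^sub>g exp(s \<langle>u\<^sub>I, v\<rangle>) \<Prod>\<^sub>i 1 / (1 - \<rho>\<^sub>i(g) exp(- s y\<^sub>i))\<close>, a product of geometric series once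
  the characters of \<open>G\<^sub>I\<close> are used to detect \<open>N\<^sup>*\<close> inside the lattice spanned by the \<open>u\<^sub>i\<^sup>I\<close>.  Since DH has
  bounded support, both sides converge as \<open>s\<close> tends to \<open>0\<close>, and the limits are the coefficients of \<open>s\<^sup>n\<close> in
  \<open>s\<^sup>n\<close> times the right hand sides.  So \<open>vol(P\<^sub>h)\<close> is a combination of \<open>n\<close>-th powers of affine forms in
  \<open>h\<close>; on the form of \<open>I\<close> the Todd operator acts coefficientwise, the elements outside \<open>G\<^sub>I\<close> contributing
  \<open>0\<close>, and the result is the coefficient found for the number of lattice points.

  The support is bounded because DH does not depend on \<open>v\<close>: for \<open>v\<close> it lies in a half-space \<open>\<langle>u, v\<rangle> \<ge> - M\<close>,
  for \<open>- v\<close> in \<open>\<langle>u, v\<rangle> \<le> M\<close>.  Independence needs no wall crossing: off the hyperplanes, DH is the degree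
  of the multi-fan with some rays reversed, and replacing the condition \<open>y\<^sub>i < 0\<close> on the reversed rays by
  \<open>1 - [y\<^sub>i > 0]\<close> turns this degree into an alternating sum of degrees of projected multi-fans.
\<close>


section \<open>Dual bases and lattices\<close>

text \<open>Taken separately, the vertex terms of both transforms may have a pole at s = 0; only
  their sum is known to converge. So no limit is taken vertex by vertex: the comparison goes through
  the coefficient of s^n of a convergent power series, which is the limit of f(s) / s^n along a null
  sequence as soon as that limit exists. The sequence is s = - 1 / (k + 1): negative, so that the
  exponential decays on cones whose generators pair positively with v, and bounded by 1, so that one
  constant dominates all exponentials. The limit needs only a bound for \<bar>u \<bullet> v\<bar>
  where DH is nonzero; integrability of DH is then inherited from the transform at s = - 1.

  Integrality of the vertices enters through two facts: the constants \<open>c i\<close> are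
  integers, which makes a shift by \<epsilon> between 0 and 1 disappear from the geometric series,
  and the characters of the group of I are trivial on the vertex of I.

  The factor 1 / |G_I| in the volume is found without determinants: it is the density of the dual
  lattice in the lattice spanned by the dual vectors of I, computed by the character sum that also
  serves the lattice count.\<close>

locale dual_bases =
  fixes I :: "'s set" and b d :: "'s \<Rightarrow> 'a::euclidean_space" and V :: "'a set"
  assumes fin: "finite I"
    and span_b: "span (b ` I) = V"
    and d_in: "\<And>i. i \<in> I \<Longrightarrow> d i \<in> V"
    and dual: "\<And>i j. i \<in> I \<Longrightarrow> j \<in> I \<Longrightarrow> d i \<bullet> b j = (if i = j then 1 else 0)"
begin

lemma subspace_V: "subspace V"
  using span_b by (metis subspace_span)

lemma b_in: "i \<in> I \<Longrightarrow> b i \<in> V"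
  using span_b by (metis imageI span_base)

lemma sum_b_in: "(\<Sum>i\<in>I. c i *\<^sub>R b i) \<in> V"
  by (intro subspace_sum[OF subspace_V] subspace_scale[OF subspace_V] b_in)

lemma sum_d_in: "(\<Sum>i\<in>I. c i *\<^sub>R d i) \<in> V"
  by (intro subspace_sum[OF subspace_V] subspace_scale[OF subspace_V] d_in)

lemma comb_inner_d:
  assumes "i \<in> I"
  shows "(\<Sum>j\<in>I. c j *\<^sub>R b j) \<bullet> d i = c i"
proof -
  have "(\<Sum>j\<in>I. c j *\<^sub>R b j) \<bullet> d i = (\<Sum>j\<in>I. c j * (d i \<bullet> b j))"
    by (simp add: inner_sum_left inner_commute[of "d i"])
  also have "\<dots> = (\<Sum>j\<in>I. if i = j then c j else 0)"
    by (intro sum.cong) (auto simp: dual assms)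
  finally show ?thesis using fin assms by simp
qed

lemma comb_inner_b:
  assumes "i \<in> I"
  shows "(\<Sum>j\<in>I. c j *\<^sub>R d j) \<bullet> b i = c i"
proof -
  have "(\<Sum>j\<in>I. c j *\<^sub>R d j) \<bullet> b i = (\<Sum>j\<in>I. c j * (d j \<bullet> b i))"
    by (simp add: inner_sum_left)
  also have "\<dots> = (\<Sum>j\<in>I. if j = i then c j else 0)"
    by (intro sum.cong) (auto simp: dual assms)
  finally show ?thesis using fin assms by simp
qed

lemma expand_b:
  assumes "x \<in> V"
  shows "(\<Sum>i\<in>I. (x \<bullet> d i) *\<^sub>R b i) = x"
proof -
  have "x \<in> span (b ` I)" using assms span_b by simp
  then show ?thesis
  proof (induction rule: span_induct)
    case base
    show ?case
      by (auto simp: subspace_def inner_add_left scaleR_left_distrib sum.distrib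
          simp flip: scaleR_scaleR scaleR_sum_right)
  next
    case (step x)
    then obtain j where j: "j \<in> I" "x = b j" by auto
    have "(\<Sum>i\<in>I. (b j \<bullet> d i) *\<^sub>R b i) = (\<Sum>i\<in>I. if i = j then b i else 0)"
      by (intro sum.cong) (auto simp: inner_commute[of "b j"] dual j)
    then show ?case using j fin by simp
  qed
qed

lemma eq_if_inner_b:
  assumes "x \<in> V" "y \<in> V" "\<And>i. i \<in> I \<Longrightarrow> x \<bullet> b i = y \<bullet> b i"
  shows "x = y"
proof -
  have "(x - y) \<in> V" using assms subspace_V subspace_diff by blast
  then have "(x - y) \<bullet> (x - y) = (x - y) \<bullet> (\<Sum>i\<in>I. ((x - y) \<bullet> d i) *\<^sub>R b i)"
    using expand_b by simp
  also have "\<dots> = 0"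
    unfolding inner_sum_right
    by (intro sum.neutral) (auto simp: assms inner_diff_left)
  finally show ?thesis by simp
qed

lemma expand_d:
  assumes "x \<in> V"
  shows "(\<Sum>i\<in>I. (x \<bullet> b i) *\<^sub>R d i) = x"
  by (rule eq_if_inner_b[OF sum_d_in assms]) (simp add: comb_inner_b)

lemma span_d: "span (d ` I) = V"
proof (intro equalityI)
  show "span (d ` I) \<subseteq> V" by (rule span_minimal) (auto simp: d_in subspace_V)
  show "V \<subseteq> span (d ` I)"
  proof
    fix x assume "x \<in> V"
    then have "x = (\<Sum>i\<in>I. (x \<bullet> b i) *\<^sub>R d i)" by (simp add: expand_d)
    also have "\<dots> \<in> span (d ` I)" by (intro span_sum span_scale span_base) auto
    finally show "x \<in> span (d ` I)" .
  qed
qed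

lemma dual_bases_sym: "dual_bases I d b V"
  by unfold_locales (auto simp: fin span_d b_in dual inner_commute[of "b _"])

lemma inj_b: "inj_on b I"
proof (rule inj_onI)
  fix i j assume "i \<in> I" "j \<in> I" "b i = b j"
  then show "i = j" using dual[of i i] dual[of i j] by (auto split: if_splits)
qed

lemma comb_eq_iff:
  "(\<Sum>i\<in>I. c i *\<^sub>R b i) = (\<Sum>i\<in>I. c' i *\<^sub>R b i) \<longleftrightarrow> (\<forall>i\<in>I. c i = c' i)"
  by (metis (no_types, lifting) comb_inner_d sum.cong)

lemma inner_d_eq_0_if_span:
  assumes "x \<in> span (b ` J)" "J \<subseteq> I" "i \<in> I - J"
  shows "x \<bullet> d i = 0"
  using assms(1)
proof (induction rule: span_induct)
  case base
  show ?case by (auto simp: subspace_def inner_add_left)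
next
  case (step x)
  then show ?case using assms dual by (auto simp: inner_commute[of _ "d i"] split: if_splits)
qed

lemma span_sub_iff:
  assumes "x \<in> V" "J \<subseteq> I"
  shows "x \<in> span (b ` J) \<longleftrightarrow> (\<forall>i\<in>I - J. x \<bullet> d i = 0)"
proof
  assume 0: "\<forall>i\<in>I - J. x \<bullet> d i = 0"
  have "x = (\<Sum>i\<in>I. (x \<bullet> d i) *\<^sub>R b i)" using expand_b assms by simp
  also have "\<dots> = (\<Sum>i\<in>J. (x \<bullet> d i) *\<^sub>R b i)"
    using 0 assms fin by (intro sum.mono_neutral_right) auto
  also have "\<dots> \<in> span (b ` J)" by (intro span_sum span_scale span_base) auto
  finally show "x \<in> span (b ` J)" .
qed (use inner_d_eq_0_if_span assms in auto)

lemma independent_b: "independent (b ` I)"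
  unfolding dependent_def
proof clarify
  fix i assume i: "i \<in> I" "b i \<in> span (b ` I - {b i})"
  moreover have "b ` I - {b i} \<subseteq> b ` (I - {i})" by auto
  ultimately have "b i \<in> span (b ` (I - {i}))" using span_mono by blast
  then have "b i \<bullet> d i = 0" using inner_d_eq_0_if_span[of "b i" "I - {i}" i] i by auto
  then show False using dual[OF i(1) i(1)] by (simp add: inner_commute)
qed

lemma dim_V: "dim V = card I"
  using independent_b inj_b span_b by (metis card_image dim_span_eq_card_independent)

text \<open>\<open>int_span\<close> attaches its coefficients to the vectors themselves. Integrality
  of the pairings with \<open>d\<close> is the form in which lattices are used below; closure under
  the group operations is then immediate.\<close>

lemma mem_int_span_iff: "x \<in> int_span (b ` I) \<longleftrightarrow> x \<in> V \<and> (\<forall>i\<in>I. x \<bullet> d i \<in> \<int>)"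
proof
  assume "x \<in> int_span (b ` I)"
  then obtain z where "x = (\<Sum>y\<in>b ` I. of_int (z y) *\<^sub>R y)" by (auto simp: int_span_def)
  then have x: "x = (\<Sum>i\<in>I. of_int (z (b i)) *\<^sub>R b i)" by (simp add: sum.reindex inj_b)
  show "x \<in> V \<and> (\<forall>i\<in>I. x \<bullet> d i \<in> \<int>)"
    unfolding x using sum_b_in[of "\<lambda>i. of_int (z (b i))"] by (simp add: comb_inner_d)
next
  assume r: "x \<in> V \<and> (\<forall>i\<in>I. x \<bullet> d i \<in> \<int>)"
  have "x = (\<Sum>i\<in>I. (x \<bullet> d i) *\<^sub>R b i)" using r expand_b by simp
  also have "\<dots> = (\<Sum>i\<in>I. of_int \<lfloor>x \<bullet> d (inv_into I b (b i))\<rfloor> *\<^sub>R b i)"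
    using r by (intro sum.cong) (auto simp: inj_b)
  also have "\<dots> = (\<Sum>y\<in>b ` I. of_int \<lfloor>x \<bullet> d (inv_into I b y)\<rfloor> *\<^sub>R y)"
    by (simp add: sum.reindex inj_b)
  finally show "x \<in> int_span (b ` I)" unfolding int_span_def by (intro CollectI exI conjI TrueI)
qed

end

text \<open>The vector dual to \<open>b i\<close> is the component of \<open>b i\<close> orthogonal
  to the span of the other vectors, divided by its squared norm; independence makes this component
  nonzero.\<close>

lemma dual_bases_exists:
  fixes b :: "'s \<Rightarrow> 'a::euclidean_space"
  assumes "finite I" "inj_on b I" "independent (b ` I)"
  shows "\<exists>d. dual_bases I b d (span (b ` I))"
proof -
  have "\<exists>e. e \<in> span (b ` I) \<and> (\<forall>j\<in>I. e \<bullet> b j = (if i = j then 1 else 0))" if i: "i \<in> I" for i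
  proof -
    let ?W = "span (b ` (I - {i}))"
    have ni: "b i \<notin> ?W"
      using assms(3) i inj_on_image_set_diff[OF assms(2), of I "{i}"] unfolding dependent_def by auto
    obtain w z where wz: "w \<in> ?W" "\<And>x. x \<in> ?W \<Longrightarrow> orthogonal z x" "b i = w + z"
      using orthogonal_subspace_decomp_exists[of "b ` (I - {i})" "b i"] by metis
    have z0: "z \<noteq> 0" using ni wz by auto
    have zb: "z \<bullet> b i = z \<bullet> z" using wz by (simp add: inner_add_right orthogonal_def)
    have zV: "z \<in> span (b ` I)"
    proof -
      have "z = b i - w" using wz by simp
      moreover have "w \<in> span (b ` I)" using wz(1) span_mono[of "b ` (I - {i})" "b ` I"] by auto
      ultimately show ?thesis using i by (simp add: span_base span_diff)
    qed
    have "(inverse (z \<bullet> z) *\<^sub>R z) \<bullet> b j = (if i = j then 1 else 0)" if "j \<in> I" for j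
    proof (cases "i = j")
      case True
      then show ?thesis using zb z0 by auto
    next
      case False
      then have "b j \<in> ?W" using that by (intro span_base) auto
      then show ?thesis using False wz(2)[of "b j"] by (simp add: orthogonal_def)
    qed
    then show ?thesis using zV by (intro exI[of _ "inverse (z \<bullet> z) *\<^sub>R z"]) (auto intro: span_scale)
  qed
  then obtain d where "\<And>i. i \<in> I \<Longrightarrow> d i \<in> span (b ` I) \<and> (\<forall>j\<in>I. d i \<bullet> b j = (if i = j then 1 else 0))"
    by metis
  then show ?thesis using assms(1) by (intro exI[of _ d]) (unfold_locales, auto)
qed

section \<open>Lattices, their duals, and lattice points on a ray\<close>

lemma lattice_basis_dual_bases:
  assumes "lattice_basis N B"
  obtains d where "dual_bases B (\<lambda>x. x) d (span N)"
    and "\<And>x. x \<in> N \<longleftrightarrow> x \<in> span N \<and> (\<forall>i\<in>B. x \<bullet> d i \<in> \<int>)"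
proof -
  have B: "finite B" "independent B" "N = int_span B" using assms by (auto simp: lattice_basis_def)
  then obtain d where d: "dual_bases B (\<lambda>x. x) d (span B)"
    using dual_bases_exists[of B "\<lambda>x. x"] by auto
  interpret dual_bases B "\<lambda>x. x" d "span B" by (rule d)
  have mem: "x \<in> N \<longleftrightarrow> x \<in> span B \<and> (\<forall>i\<in>B. x \<bullet> d i \<in> \<int>)" for x
    using mem_int_span_iff B by simp
  have "B \<subseteq> N"
  proof
    fix x assume "x \<in> B"
    then show "x \<in> N" unfolding mem using dual by (auto simp: span_base inner_commute[of x])
  qed
  then have "span N = span B"
    using mem by (metis (no_types, lifting) antisym span_minimal span_mono subsetI subspace_span)
  then show thesis using that d mem by simp
qed

lemma is_latticeE:
  assumes "is_lattice N"
  obtains B d where "dual_bases B (\<lambda>x. x) d (span N)"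
    and "\<And>x. x \<in> N \<longleftrightarrow> x \<in> span N \<and> (\<forall>i\<in>B. x \<bullet> d i \<in> \<int>)"
  using assms lattice_basis_dual_bases unfolding is_lattice_def by metis

lemma lattice_add: "is_lattice N \<Longrightarrow> x \<in> N \<Longrightarrow> y \<in> N \<Longrightarrow> x + y \<in> N"
  by (elim is_latticeE) (auto simp: inner_add_left span_add)

lemma lattice_scale: "is_lattice N \<Longrightarrow> x \<in> N \<Longrightarrow> r \<in> \<int> \<Longrightarrow> r *\<^sub>R x \<in> N"
  by (elim is_latticeE) (auto simp: span_scale)

lemma lattice_zero: "is_lattice N \<Longrightarrow> 0 \<in> N"
  by (elim is_latticeE) (auto simp: span_zero)

lemma lattice_diff: "is_lattice N \<Longrightarrow> x \<in> N \<Longrightarrow> y \<in> N \<Longrightarrow> x - y \<in> N"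
  by (elim is_latticeE) (auto simp: inner_diff_left span_diff)

lemma lattice_sum: "is_lattice N \<Longrightarrow> (\<And>i. i \<in> A \<Longrightarrow> f i \<in> N) \<Longrightarrow> sum f A \<in> N"
  by (induction A rule: infinite_finite_induct) (auto simp: lattice_zero lattice_add)

lemma (in dual_bases) mem_dual_lattice_iff:
  assumes "is_lattice N" "span N = V" "b ` I \<subseteq> N"
    and "\<And>x. x \<in> N \<longleftrightarrow> x \<in> span N \<and> (\<forall>i\<in>I. x \<bullet> d i \<in> \<int>)"
  shows "u \<in> dual_lattice N \<longleftrightarrow> u \<in> V \<and> (\<forall>i\<in>I. u \<bullet> b i \<in> \<int>)"
proof
  assume "u \<in> dual_lattice N"
  then show "u \<in> V \<and> (\<forall>i\<in>I. u \<bullet> b i \<in> \<int>)" using assms by (auto simp: dual_lattice_def)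
next
  assume u: "u \<in> V \<and> (\<forall>i\<in>I. u \<bullet> b i \<in> \<int>)"
  have "u \<bullet> x \<in> \<int>" if "x \<in> N" for x
  proof -
    have "x \<in> V" "\<And>i. i \<in> I \<Longrightarrow> x \<bullet> d i \<in> \<int>" using that assms by auto
    have "u \<bullet> x = u \<bullet> (\<Sum>i\<in>I. (x \<bullet> d i) *\<^sub>R b i)" using \<open>x \<in> V\<close> expand_b by simp
    also have "\<dots> \<in> \<int>" unfolding inner_sum_right
      using u \<open>\<And>i. i \<in> I \<Longrightarrow> x \<bullet> d i \<in> \<int>\<close> by (auto intro!: Ints_sum)
    finally show ?thesis .
  qed
  then show "u \<in> dual_lattice N" using u assms by (auto simp: dual_lattice_def)
qed

text \<open>The basis dual to a basis of N works. Its existence is what gives the choice in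
  \<open>dual_measure\<close> a meaning.\<close>

lemma dual_lattice_basis:
  assumes "is_lattice N"
  obtains B where "lattice_basis (dual_lattice N) B"
proof -
  obtain B d where d: "dual_bases B (\<lambda>x. x) d (span N)"
    and mem: "\<And>x. x \<in> N \<longleftrightarrow> x \<in> span N \<and> (\<forall>i\<in>B. x \<bullet> d i \<in> \<int>)"
    by (rule is_latticeE[OF assms]) (rule that)
  interpret dual_bases B "\<lambda>x. x" d "span N" by (rule d)
  interpret s: dual_bases B d "\<lambda>x. x" "span N" by (rule dual_bases_sym)
  have "B \<subseteq> N"
    using b_in dual by (auto simp: mem inner_commute[of _ "d _"])
  then have "u \<in> dual_lattice N \<longleftrightarrow> u \<in> int_span (d ` B)" for u
    using mem_dual_lattice_iff[OF assms refl _ mem] s.mem_int_span_iff by auto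
  then have "dual_lattice N = int_span (d ` B)" by blast
  then have "lattice_basis (dual_lattice N) (d ` B)"
    using fin s.independent_b by (auto simp: lattice_basis_def)
  then show thesis by (rule that)
qed

lemma span_dual_lattice:
  assumes "is_lattice N"
  shows "span (dual_lattice N) = span N"
proof -
  obtain B d where d: "dual_bases B (\<lambda>x. x) d (span N)"
    and mem: "\<And>x. x \<in> N \<longleftrightarrow> x \<in> span N \<and> (\<forall>i\<in>B. x \<bullet> d i \<in> \<int>)"
    by (rule is_latticeE[OF assms]) (rule that)
  interpret dual_bases B "\<lambda>x. x" d "span N" by (rule d)
  have B: "B \<subseteq> N" using b_in dual by (auto simp: mem inner_commute[of _ "d _"])
  have "d ` B \<subseteq> dual_lattice N"
    using d_in dual mem_dual_lattice_iff[OF assms refl _ mem] B by auto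
  moreover have "dual_lattice N \<subseteq> span N" by (auto simp: dual_lattice_def)
  ultimately show ?thesis using span_d by (metis span_mono span_minimal subspace_span antisym)
qed

text \<open>The lattice points of a ray through a lattice point form a copy of \<open>\<nat>\<close>: take a point whose
  (integral) coordinate along some fixed basis vector is least.\<close>

lemma lattice_ray:
  assumes N: "is_lattice N" and x: "x \<in> N" "x \<noteq> 0"
  obtains p where "p \<in> N" "p \<noteq> 0" "\<exists>r>0. p = r *\<^sub>R x"
    and "\<And>r. r \<ge> 0 \<Longrightarrow> r *\<^sub>R x \<in> N \<Longrightarrow> \<exists>k::nat. r *\<^sub>R x = of_nat k *\<^sub>R p"
proof -
  obtain B d where d: "dual_bases B (\<lambda>x. x) d (span N)"
    and mem: "\<And>x. x \<in> N \<longleftrightarrow> x \<in> span N \<and> (\<forall>i\<in>B. x \<bullet> d i \<in> \<int>)"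
    by (rule is_latticeE[OF N]) (rule that)
  interpret dual_bases B "\<lambda>x. x" d "span N" by (rule d)
  obtain i where i: "i \<in> B" "x \<bullet> d i \<noteq> 0"
    using expand_b[of x] x by (metis (no_types, lifting) mem scale_zero_left sum.neutral)
  let ?P = "\<lambda>k::nat. \<exists>r>0. r *\<^sub>R x \<in> N \<and> real k = r * \<bar>x \<bullet> d i\<bar>"
  have nat: "\<exists>k::nat. real k = r * \<bar>x \<bullet> d i\<bar>" if "r \<ge> 0" "r *\<^sub>R x \<in> N" for r
  proof -
    have "(r *\<^sub>R x) \<bullet> d i \<in> \<int>" using that(2) i mem by blast
    then have "\<bar>r * (x \<bullet> d i)\<bar> \<in> \<nat>" by (auto simp: Nats_altdef2 Ints_abs)
    then show ?thesis using that by (auto simp: abs_mult Nats_def)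
  qed
  have "\<exists>k. ?P k" using nat[of 1] x by (auto intro!: exI[of _ "1::real"])
  then obtain k where k: "?P k" "\<And>k'. ?P k' \<Longrightarrow> k \<le> k'"
    using exists_least_iff[of ?P] by (metis not_le)
  obtain r where r: "r > 0" "r *\<^sub>R x \<in> N" "real k = r * \<bar>x \<bullet> d i\<bar>" using k by auto
  have "\<exists>m::nat. t *\<^sub>R x = of_nat m *\<^sub>R (r *\<^sub>R x)" if t: "t \<ge> 0" "t *\<^sub>R x \<in> N" for t
  proof -
    define m where "m = nat \<lfloor>t / r\<rfloor>"
    define e where "e = t - real m * r"
    have m: "real m \<le> t / r" "t / r < real m + 1"
      using t r by (auto simp: m_def of_nat_nat)
    then have e: "e \<ge> 0" "e < r" using r by (auto simp: e_def field_simps)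
    have "e *\<^sub>R x = t *\<^sub>R x - real m *\<^sub>R (r *\<^sub>R x)" by (simp add: e_def algebra_simps)
    also have "\<dots> \<in> N" using lattice_diff[OF N t(2) lattice_scale[OF N r(2), of "real m"]] by simp
    finally have eN: "e *\<^sub>R x \<in> N" .
    have "e = 0"
    proof (rule ccontr)
      assume "e \<noteq> 0"
      then have "e > 0" using e by simp
      then obtain k' where k': "real k' = e * \<bar>x \<bullet> d i\<bar>" using nat[of e] eN by auto
      then have "k \<le> k'" using k(2) \<open>e > 0\<close> eN by blast
      then have "real k \<le> real k'" by simp
      then show False using k' r(3) e(2) i by auto
    qed
    then show ?thesis by (auto simp: e_def)
  qed
  then show thesis using that[of "r *\<^sub>R x"] r x by auto
qed


section \<open>Simplicial cones\<close>

lemma span_convex_cone_hull: "span (convex_cone hull S) = span S"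
proof (rule antisym)
  have "convex_cone hull S \<subseteq> span S"
    by (rule hull_minimal) (auto simp: span_base convex_cone_span)
  then show "span (convex_cone hull S) \<subseteq> span S" by (rule span_minimal) simp
  show "span S \<subseteq> span (convex_cone hull S)" by (rule span_mono) (rule hull_subset)
qed

lemma dim_convex_cone_hull: "dim (convex_cone hull S) = dim S"
  by (metis dim_span span_convex_cone_hull)

lemma convex_cone_sum:
  assumes "convex_cone C" "\<And>i. i \<in> A \<Longrightarrow> f i \<in> C"
  shows "sum f A \<in> C"
  using assms(2)
  by (induction A rule: infinite_finite_induct)
    (auto intro: convex_cone_add[OF assms(1)] convex_cone_contains_0[OF assms(1)])

lemma convex_cone_hull_image:
  assumes "finite I"
  shows "convex_cone hull (b ` I) = {\<Sum>i\<in>I. c i *\<^sub>R b i | c. \<forall>i\<in>I. 0 \<le> c i}" (is "_ = ?R")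
proof (rule antisym)
  show "convex_cone hull (b ` I) \<subseteq> ?R"
  proof (rule hull_minimal)
    show "b ` I \<subseteq> ?R"
    proof clarify
      fix i assume "i \<in> I"
      then have "b i = (\<Sum>j\<in>I. (if j = i then 1 else 0) *\<^sub>R b j)"
        using assms by (simp add: if_distrib[of "\<lambda>x. x *\<^sub>R _"] cong: if_cong)
      then show "\<exists>c. b i = (\<Sum>i\<in>I. c i *\<^sub>R b i) \<and> (\<forall>i\<in>I. 0 \<le> c i)"
        by (intro exI[of _ "\<lambda>j. if j = i then 1 else 0"]) auto
    qed
    show "convex_cone ?R"
      unfolding convex_cone_iff
    proof (intro conjI ballI allI impI)
      show "0 \<in> ?R" by (auto intro!: exI[of _ "\<lambda>_. 0"])
    next
      fix x y assume "x \<in> ?R" "y \<in> ?R"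
      then obtain c c' where "x = (\<Sum>i\<in>I. c i *\<^sub>R b i)" "\<forall>i\<in>I. 0 \<le> c i"
        "y = (\<Sum>i\<in>I. c' i *\<^sub>R b i)" "\<forall>i\<in>I. 0 \<le> c' i" by auto
      then show "x + y \<in> ?R"
        by (auto intro!: exI[of _ "\<lambda>i. c i + c' i"] simp: sum.distrib scaleR_left_distrib)
    next
      fix x and r :: real assume "x \<in> ?R" "0 \<le> r"
      then obtain c where "x = (\<Sum>i\<in>I. c i *\<^sub>R b i)" "\<forall>i\<in>I. 0 \<le> c i" by auto
      then show "r *\<^sub>R x \<in> ?R"
        using \<open>0 \<le> r\<close> by (auto intro!: exI[of _ "\<lambda>i. r * c i"] simp: scaleR_sum_right)
    qed
  qed
  show "?R \<subseteq> convex_cone hull (b ` I)"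
    by (auto intro!: convex_cone_sum[OF convex_cone_convex_cone_hull] convex_cone_hull_mul[OF hull_inc])
qed

lemma convex_cone_hull_singleton: "convex_cone hull {x} = {r *\<^sub>R x | r. 0 \<le> r}"
  using convex_cone_hull_image[of "{x}" "\<lambda>x. x"] by auto

lemma (in dual_bases) mem_cone_hull_iff:
  assumes "J \<subseteq> I"
  shows "x \<in> convex_cone hull (b ` J) \<longleftrightarrow>
    x \<in> V \<and> (\<forall>i\<in>I. 0 \<le> x \<bullet> d i) \<and> (\<forall>i\<in>I - J. x \<bullet> d i = 0)"
proof
  have fJ: "finite J" using assms fin finite_subset by blast
  {
    assume "x \<in> convex_cone hull (b ` J)"
    then obtain c where c: "x = (\<Sum>i\<in>J. c i *\<^sub>R b i)" "\<forall>i\<in>J. 0 \<le> c i"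
      unfolding convex_cone_hull_image[OF fJ] by auto
    have x: "x = (\<Sum>i\<in>I. (if i \<in> J then c i else 0) *\<^sub>R b i)"
      unfolding c(1) using assms fin by (intro sum.mono_neutral_cong_left) auto
    have "x \<bullet> d i = (if i \<in> J then c i else 0)" if "i \<in> I" for i
      unfolding x by (rule comb_inner_d[OF that])
    moreover have "x \<in> V" unfolding x by (rule sum_b_in)
    ultimately show "x \<in> V \<and> (\<forall>i\<in>I. 0 \<le> x \<bullet> d i) \<and> (\<forall>i\<in>I - J. x \<bullet> d i = 0)"
      using c(2) by auto
  next
    assume r: "x \<in> V \<and> (\<forall>i\<in>I. 0 \<le> x \<bullet> d i) \<and> (\<forall>i\<in>I - J. x \<bullet> d i = 0)"
    then have "x = (\<Sum>i\<in>I. (x \<bullet> d i) *\<^sub>R b i)" using expand_b by simp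
    also have "\<dots> = (\<Sum>i\<in>J. (x \<bullet> d i) *\<^sub>R b i)"
      using r assms fin by (intro sum.mono_neutral_right) auto
    finally show "x \<in> convex_cone hull (b ` J)"
      unfolding convex_cone_hull_image[OF fJ] using r assms
      by (intro CollectI exI[of _ "\<lambda>i. x \<bullet> d i"]) auto
  }
qed

text \<open>A face contains every generator that occurs with positive coefficient in one of its
  points x: such an x is the midpoint of twice that summand and twice the rest, so the face contains
  the former, and being a cone it contains the generator. That F is a cone also rules out the empty
  face.\<close>

lemma face_of_convex_cone_hull:
  assumes "finite S" "F face_of convex_cone hull S" "convex_cone F"
  shows "F = convex_cone hull (S \<inter> F)"
proof
  show "convex_cone hull (S \<inter> F) \<subseteq> F" using assms(3) by (intro hull_minimal) auto
  show "F \<subseteq> convex_cone hull (S \<inter> F)"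
  proof
    fix x assume x: "x \<in> F"
    then have xS: "x \<in> convex_cone hull S" using assms(2) face_of_imp_subset by blast
    then obtain c where c: "x = (\<Sum>s\<in>S. c s *\<^sub>R s)" "\<forall>s\<in>S. 0 \<le> c s"
      using convex_cone_hull_image[OF assms(1), of "\<lambda>x. x"] by auto
    have sF: "s \<in> F" if s: "s \<in> S" "c s > 0" for s
    proof -
      define p where "p = (2 * c s) *\<^sub>R s"
      define q where "q = 2 *\<^sub>R (\<Sum>t\<in>S - {s}. c t *\<^sub>R t)"
      have p: "p \<in> convex_cone hull S"
        using s unfolding p_def by (intro convex_cone_hull_mul[OF hull_inc]) auto
      have q: "q \<in> convex_cone hull S"
        using c unfolding q_def
        by (intro convex_cone_hull_mul convex_cone_sum[OF convex_cone_convex_cone_hull] hull_inc) auto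
      have "x = c s *\<^sub>R s + (\<Sum>t\<in>S - {s}. c t *\<^sub>R t)"
        unfolding c(1) using assms(1) s by (subst sum.remove[of _ s]) auto
      then have "midpoint p q = x" by (simp add: midpoint_def p_def q_def algebra_simps)
      then have "p \<in> F"
        using assms(2) p q x unfolding face_of_def
        by (cases "p = q") (simp add: midpoint_idem, metis midpoint_in_open_segment)
      then have "(1 / (2 * c s)) *\<^sub>R p \<in> F" using s by (intro convex_cone_scaleR[OF assms(3)]) auto
      then show ?thesis using s by (simp add: p_def)
    qed
    have "x = (\<Sum>s\<in>S \<inter> F. c s *\<^sub>R s)"
      unfolding c(1) using assms(1) sF c(2)
      by (intro sum.mono_neutral_right) (auto simp: less_le)
    also have "\<dots> \<in> convex_cone hull (S \<inter> F)"
      using c(2) by (auto intro!: convex_cone_sum[OF convex_cone_convex_cone_hull]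
          convex_cone_hull_mul[OF hull_inc])
    finally show "x \<in> convex_cone hull (S \<inter> F)" .
  qed
qed

text \<open>If a proper convex combination of vectors with nonnegative coordinates has coordinate 0
  at i, then so have both vectors.\<close>

lemma (in dual_bases) sub_cone_face:
  assumes "J \<subseteq> I"
  shows "convex_cone hull (b ` J) face_of convex_cone hull (b ` I)"
  unfolding face_of_def
proof (intro conjI ballI impI)
  show "convex_cone hull (b ` J) \<subseteq> convex_cone hull (b ` I)" using assms by (intro hull_mono) auto
  show "convex (convex_cone hull (b ` J))" by (rule convex_convex_cone_hull)
  fix p q x assume p: "p \<in> convex_cone hull (b ` I)" and q: "q \<in> convex_cone hull (b ` I)"
    and x: "x \<in> convex_cone hull (b ` J)" "x \<in> open_segment p q"
  obtain u where u: "0 < u" "u < 1" "x = (1 - u) *\<^sub>R p + u *\<^sub>R q"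
    using x(2) by (auto simp: in_segment)
  have pq: "p \<in> V" "q \<in> V" "\<And>i. i \<in> I \<Longrightarrow> 0 \<le> p \<bullet> d i" "\<And>i. i \<in> I \<Longrightarrow> 0 \<le> q \<bullet> d i"
    using p q mem_cone_hull_iff[of I] by auto
  have "p \<bullet> d i = 0 \<and> q \<bullet> d i = 0" if i: "i \<in> I - J" for i
  proof -
    have "0 = (1 - u) * (p \<bullet> d i) + u * (q \<bullet> d i)"
      using x(1) i mem_cone_hull_iff[OF assms] u(3) by (auto simp: inner_add_left)
    moreover have "0 \<le> (1 - u) * (p \<bullet> d i)" "0 \<le> u * (q \<bullet> d i)" using u pq i by auto
    ultimately have "(1 - u) * (p \<bullet> d i) = 0" "u * (q \<bullet> d i) = 0" by linarith+
    then show ?thesis using u by auto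
  qed
  then show "p \<in> convex_cone hull (b ` J)" "q \<in> convex_cone hull (b ` J)"
    using mem_cone_hull_iff[OF assms] pq by auto
qed

lemma face_in_cones_in:
  assumes "C \<in> cones_in N" "F face_of C" "convex_cone F"
  shows "F \<in> cones_in N"
proof -
  obtain S where S: "finite S" "S \<subseteq> N" "C = convex_cone hull S"
    and nl: "\<not> (\<exists>x y. y \<noteq> 0 \<and> range (\<lambda>t. x + t *\<^sub>R y) \<subseteq> C)"
    using assms(1) by (auto simp: cones_in_def)
  have "F = convex_cone hull (S \<inter> F)" using face_of_convex_cone_hull S assms by auto
  moreover have "F \<subseteq> C" using assms(2) by (rule face_of_imp_subset)
  ultimately show ?thesis
    unfolding cones_in_def using S(1,2) nl
    by (intro CollectI conjI exI[of _ "S \<inter> F"]) (auto, meson order_trans)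
qed

lemma cones_in_convex_cone: "C \<in> cones_in N \<Longrightarrow> convex_cone C"
  by (auto simp: cones_in_def convex_cone_convex_cone_hull)

lemma cones_in_sub_span: "C \<in> cones_in N \<Longrightarrow> C \<subseteq> span N"
  unfolding cones_in_def
  by clarify (metis (no_types, lifting) span_base span_convex_cone_hull span_mono subsetD)

section \<open>Rays, faces and maximal cones of a simplicial multi-fan\<close>

locale simple_fan =
  fixes \<Delta> :: "('s::order, 'a::euclidean_space) multi_fan"
  assumes mfan: "multi_fan \<Delta>" and simpl: "simplicial \<Delta>"
begin

abbreviation "N \<equiv> lat \<Delta>"
abbreviation "\<Sigma> \<equiv> simps_of \<Delta>"
abbreviation "verts \<equiv> vertices_of \<Delta>"
abbreviation "\<nu> \<equiv> ray_vec \<Delta>"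
abbreviation "tops \<equiv> skel \<Delta> (rank \<Delta>)"
abbreviation "C \<equiv> cone_of \<Delta>"
abbreviation "\<delta> \<equiv> dual_vec \<Delta>"
abbreviation "coord v I i \<equiv> v \<bullet> \<delta> I i"

lemma N: "is_lattice N" and finite_\<Sigma>: "finite \<Sigma>"
  using mfan by (auto simp: multi_fan_def)

lemma cone_in: "J \<in> \<Sigma> \<Longrightarrow> C J \<in> cones_in N"
  using mfan by (auto simp: multi_fan_def)

lemma cone_bij:
  "J \<in> \<Sigma> \<Longrightarrow> bij_betw (C) {I \<in> \<Sigma>. I \<le> J} {\<kappa> \<in> cones_in N. \<kappa> face_of C J}"
  using mfan by (auto simp: multi_fan_def)

lemma le_iff_face:
  "J \<in> \<Sigma> \<Longrightarrow> I \<in> \<Sigma> \<Longrightarrow> I' \<in> \<Sigma> \<Longrightarrow> I \<le> J \<Longrightarrow> I' \<le> J \<Longrightarrow>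
    I \<le> I' \<longleftrightarrow> C I face_of C I'"
  using mfan unfolding multi_fan_def by blast

lemma face_le: "J \<in> \<Sigma> \<Longrightarrow> I \<in> \<Sigma> \<Longrightarrow> I \<le> J \<Longrightarrow> C I face_of C J"
  using le_iff_face by blast

lemma cone_inj:
  "J \<in> \<Sigma> \<Longrightarrow> I \<in> \<Sigma> \<Longrightarrow> I' \<in> \<Sigma> \<Longrightarrow> I \<le> J \<Longrightarrow> I' \<le> J \<Longrightarrow> C I = C I' \<Longrightarrow> I = I'"
  using cone_bij[of J] unfolding bij_betw_def inj_on_def by blast

lemma face_ex:
  assumes "J \<in> \<Sigma>" "F face_of C J" "convex_cone F"
  obtains K where "K \<in> \<Sigma>" "K \<le> J" "C K = F"
proof -
  have "F \<in> cones_in N" using face_in_cones_in cone_in assms by blast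
  then have "F \<in> C ` {I \<in> \<Sigma>. I \<le> J}" using cone_bij[OF assms(1)] assms by (auto simp: bij_betw_def)
  then show thesis using that by auto
qed

lemma cone_basis:
  assumes "J \<in> \<Sigma>"
  obtains B d where "C J = convex_cone hull B" "dual_bases B (\<lambda>x. x) d (span B)"
proof -
  obtain B where B: "independent B" "C J = convex_cone hull B"
    using simpl assms by (auto simp: simplicial_def)
  have "finite B" using B(1) independent_bound by blast
  then show thesis using dual_bases_exists[of B "\<lambda>x. x"] B that by auto
qed

text \<open>The generator of the lattice points on the ray, supplied by \<open>lattice_ray\<close>,
  is the only primitive vector there; this resolves the definite description in
  \<open>ray_vec\<close>.\<close>

lemma ray_vec_props:
  assumes "i \<in> rays \<Delta>"
  shows "\<nu> i \<in> N" "\<nu> i \<noteq> 0" "C i = convex_cone hull {\<nu> i}"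
proof -
  have i: "i \<in> \<Sigma>" "dim (C i) = 1" using assms by (auto simp: skel_def)
  obtain B d where B: "C i = convex_cone hull B" "dual_bases B (\<lambda>x. x) d (span B)"
    using cone_basis i by blast
  interpret dual_bases B "\<lambda>x. x" d "span B" by (rule B(2))
  have "card B = 1" using i B(1) dim_V by (simp add: dim_convex_cone_hull)
  then obtain b where b: "B = {b}" by (auto simp: card_1_singleton_iff)
  have C: "C i = {r *\<^sub>R b | r. 0 \<le> r}" using B(1) b convex_cone_hull_singleton by simp
  \<comment> \<open>The independent generator \<open>b\<close> need not be a lattice vector. The
    rational generators \<open>S\<close> need not be independent, but any nonzero one of them is a
    lattice point on the ray.\<close>
  obtain S where S: "finite S" "S \<subseteq> N" "C i = convex_cone hull S"
    using cone_in[OF i(1)] by (auto simp: cones_in_def)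
  have "\<not> S \<subseteq> {0}"
  proof
    assume "S \<subseteq> {0}"
    then have "dim S = 0" by (simp add: dim_eq_0)
    then show False using S(3) i(2) by (metis dim_convex_cone_hull zero_neq_one)
  qed
  then obtain s where s: "s \<in> S" "s \<noteq> 0" by auto
  have "s \<in> C i" using S(3) s(1) by (simp add: hull_inc)
  then obtain r where r: "s = r *\<^sub>R b" "r > 0" using C s(2) by (auto simp: less_le)
  have "C i = {r *\<^sub>R s | r. 0 \<le> r}"
  proof -
    have "x *\<^sub>R b = (x / r) *\<^sub>R s" for x using r by simp
    then show ?thesis unfolding C using r
      by (auto intro: exI[of _ "x / r" for x])
  qed
  note Cs = this
  obtain p where p: "p \<in> N" "p \<noteq> 0" "\<exists>r>0. p = r *\<^sub>R s"
    and pk: "\<And>r. r \<ge> 0 \<Longrightarrow> r *\<^sub>R s \<in> N \<Longrightarrow> \<exists>k::nat. r *\<^sub>R s = of_nat k *\<^sub>R p"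
    using lattice_ray[OF N, of s] s S(2) by blast
  obtain t where t: "t > 0" "p = t *\<^sub>R s" using p by auto
  have Cp: "C i = convex_cone hull {p}"
  proof -
    have "x *\<^sub>R s = (x / t) *\<^sub>R p" for x using t by simp
    then show ?thesis unfolding Cs convex_cone_hull_singleton using t
      by (auto intro: exI[of _ "x / t" for x])
  qed
  have prim: "primitive_in N p"
    unfolding primitive_in_def
  proof (intro conjI ballI allI impI p(1,2))
    fix y and k :: nat assume y: "y \<in> N" "p = of_nat k *\<^sub>R y"
    then have k: "k \<noteq> 0" using p(2) by auto
    then have "y = (t / of_nat k) *\<^sub>R s" using y(2) t(2) by (metis divideR_right of_nat_eq_0_iff scaleR_scaleR divide_inverse_commute)
    then obtain k' :: nat where "y = of_nat k' *\<^sub>R p" using pk[of "t / of_nat k"] y(1) t by auto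
    then have "p = (of_nat (k * k')) *\<^sub>R p" using y(2) by (metis of_nat_mult scaleR_scaleR)
    then have "(of_nat (k * k') - 1) *\<^sub>R p = 0" by (simp add: scaleR_diff_left)
    then have "real (k * k') = 1" using p(2) by simp
    then show "k = 1" by (metis nat_mult_eq_1_iff of_nat_eq_1_iff)
  qed
  have "\<nu> i = p"
    unfolding ray_vec_def
  proof (rule the_equality)
    show "p \<in> C i \<and> primitive_in N p" using prim Cp by (simp add: hull_inc)
  next
    fix x assume x: "x \<in> C i \<and> primitive_in N x"
    then obtain r where "x = r *\<^sub>R s" "r \<ge> 0" using Cs by auto
    moreover have "x \<in> N" using x by (simp add: primitive_in_def)
    ultimately obtain k :: nat where k: "x = of_nat k *\<^sub>R p" using pk by blast
    then have "k = 1" using x p(1) unfolding primitive_in_def by blast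
    then show "x = p" using k by simp
  qed
  then show "\<nu> i \<in> N" "\<nu> i \<noteq> 0" "C i = convex_cone hull {\<nu> i}" using p Cp by auto
qed

lemma verts_in: "i \<in> verts J \<Longrightarrow> i \<in> rays \<Delta>" "i \<in> verts J \<Longrightarrow> i \<in> \<Sigma>" "i \<in> verts J \<Longrightarrow> i \<le> J"
  by (auto simp: vertices_of_def skel_def)

text \<open>An independent generating set \<open>B\<close> and the primitive vectors of the rays
  below J agree up to positive factors: every element of \<open>B\<close> spans a face, which is the
  cone of some ray below J, and conversely the face of a ray is generated by the elements of
  \<open>B\<close> in it. Injectivity of the cone map below J keeps the correspondence one-to-one,
  so the basis dual to \<open>B\<close> only has to be rescaled.\<close>

lemma cone_dual_bases:
  assumes J: "J \<in> \<Sigma>"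
  shows "C J = convex_cone hull (\<nu> ` verts J)"
    and "\<exists>d. dual_bases (verts J) \<nu> d (span (C J))"
proof -
  obtain B d where B: "C J = convex_cone hull B" "dual_bases B (\<lambda>x. x) d (span B)"
    using cone_basis J by blast
  interpret dual_bases B "\<lambda>x. x" d "span B" by (rule B(2))
  have "\<exists>b\<in>B. \<exists>r>0. \<nu> i = r *\<^sub>R b" if i: "i \<in> verts J" for i
  proof -
    have f: "C i face_of convex_cone hull B" using face_le[OF J] verts_in[OF i] B(1) by auto
    have C: "C i = convex_cone hull (B \<inter> C i)"
      using face_of_convex_cone_hull[OF fin f] cones_in_convex_cone cone_in verts_in[OF i] by blast
    have Ci: "C i = {r *\<^sub>R \<nu> i | r. 0 \<le> r}"
      using ray_vec_props(3)[OF verts_in(1)[OF i]] convex_cone_hull_singleton by simp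
    have "B \<inter> C i \<noteq> {}"
    proof
      assume "B \<inter> C i = {}"
      then have "C i = {0}" using C by simp
      moreover have "\<nu> i \<in> C i" unfolding Ci by (auto intro: exI[of _ 1])
      ultimately show False using ray_vec_props(2)[OF verts_in(1)[OF i]] by auto
    qed
    then obtain b where b: "b \<in> B" "b \<in> C i" by auto
    then obtain r where r: "b = r *\<^sub>R \<nu> i" "r \<ge> 0" using Ci by auto
    have "b \<noteq> 0" using dual[OF b(1) b(1)] by auto
    then have "r > 0" using r by (auto simp: less_le)
    then have "\<nu> i = (1 / r) *\<^sub>R b" "1 / r > 0" using r by auto
    then show ?thesis using b by blast
  qed
  then obtain \<beta> r where \<beta>r: "\<And>i. i \<in> verts J \<Longrightarrow> \<beta> i \<in> B \<and> r i > 0 \<and> \<nu> i = r i *\<^sub>R \<beta> i" by metis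
  have ex_i: "\<exists>i\<in>verts J. \<exists>r>0. b = r *\<^sub>R \<nu> i" if b: "b \<in> B" for b
  proof -
    have "convex_cone hull ((\<lambda>x. x) ` {b}) face_of convex_cone hull ((\<lambda>x. x) ` B)"
      by (rule sub_cone_face) (use b in auto)
    then have "convex_cone hull {b} face_of C J" using B(1) by simp
    then obtain i where i: "i \<in> \<Sigma>" "i \<le> J" "C i = convex_cone hull {b}"
      using face_ex[OF J] convex_cone_convex_cone_hull by metis
    have b0: "b \<noteq> 0" using dual[OF b b] by auto
    then have "dim {b} = 1" using dim_eq_card_independent[of "{b}"] by (simp add: dependent_single)
    then have "dim (C i) = 1" using i(3) by (simp add: dim_convex_cone_hull)
    then have ir: "i \<in> rays \<Delta>" using i by (simp add: skel_def)
    have "b \<in> convex_cone hull {\<nu> i}" using i(3) ray_vec_props(3)[OF ir] by (metis hull_inc insertI1)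
    then obtain r where "b = r *\<^sub>R \<nu> i" "r \<ge> 0" unfolding convex_cone_hull_singleton by auto
    moreover from this have "r > 0" using b0 by (auto simp: less_le)
    ultimately show ?thesis using ir i by (auto simp: vertices_of_def)
  qed
  have \<nu>B: "\<nu> ` verts J \<subseteq> convex_cone hull B"
    using \<beta>r by (auto intro!: convex_cone_hull_mul[OF hull_inc] simp: less_imp_le)
  have B\<nu>: "B \<subseteq> convex_cone hull (\<nu> ` verts J)"
  proof
    fix b assume "b \<in> B"
    then obtain i r where "i \<in> verts J" "r > 0" "b = r *\<^sub>R \<nu> i" using ex_i by blast
    then show "b \<in> convex_cone hull (\<nu> ` verts J)" by (auto intro!: convex_cone_hull_mul[OF hull_inc])
  qed
  show cone: "C J = convex_cone hull (\<nu> ` verts J)"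
    unfolding B(1) using \<nu>B B\<nu> by (intro antisym hull_minimal convex_cone_convex_cone_hull)
  have sp: "span (\<nu> ` verts J) = span B" "span (C J) = span B"
    using cone B(1) by (metis span_convex_cone_hull)+
  have \<beta>inj: "i = j" if "i \<in> verts J" "j \<in> verts J" "\<beta> i = \<beta> j" for i j
  proof -
    have *: "C k = convex_cone hull {\<beta> k}" if k: "k \<in> verts J" for k
    proof -
      have kk: "\<nu> k = r k *\<^sub>R \<beta> k" "r k > 0" using \<beta>r k by auto
      then have e: "\<beta> k = (1 / r k) *\<^sub>R \<nu> k" by simp
      have "\<nu> k \<in> convex_cone hull {\<beta> k}" "\<beta> k \<in> convex_cone hull {\<nu> k}"
        unfolding convex_cone_hull_singleton using kk e by (metis (mono_tags, lifting) less_imp_le mem_Collect_eq,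
            metis (mono_tags, lifting) less_imp_le mem_Collect_eq zero_less_divide_1_iff)
      then show ?thesis unfolding ray_vec_props(3)[OF verts_in(1)[OF k]]
        by (intro antisym hull_minimal convex_cone_convex_cone_hull) auto
    qed
    show ?thesis using *[OF that(1)] *[OF that(2)] that verts_in J cone_inj by metis
  qed
  have "dual_bases (verts J) \<nu> (\<lambda>i. (1 / r i) *\<^sub>R d (\<beta> i)) (span (C J))"
  proof
    show "finite (verts J)" using finite_\<Sigma> by (auto simp: vertices_of_def skel_def)
    show "span (\<nu> ` verts J) = span (C J)" using sp by simp
    show "(1 / r i) *\<^sub>R d (\<beta> i) \<in> span (C J)" if "i \<in> verts J" for i
      unfolding sp by (intro span_scale d_in) (use that \<beta>r in auto)
    show "(1 / r i) *\<^sub>R d (\<beta> i) \<bullet> \<nu> j = (if i = j then 1 else 0)"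
      if "i \<in> verts J" "j \<in> verts J" for i j
    proof -
      have "\<beta> i \<in> B" "\<beta> j \<in> B" "r i > 0" "r j > 0" "\<nu> j = r j *\<^sub>R \<beta> j" using \<beta>r that by auto
      then show ?thesis using \<beta>inj[OF that] dual by auto
    qed
  qed
  then show "\<exists>d. dual_bases (verts J) \<nu> d (span (C J))" by blast
qed

lemma finite_rays: "finite (rays \<Delta>)" and finite_verts: "finite (verts J)" and finite_tops: "finite tops"
  using finite_\<Sigma> by (auto simp: vertices_of_def skel_def)

lemma tops_in: "I \<in> tops \<Longrightarrow> I \<in> \<Sigma>"
  by (simp add: skel_def)

lemma dim_cone: "J \<in> \<Sigma> \<Longrightarrow> dim (C J) = card (verts J)"
  using cone_dual_bases(2)[of J] dual_bases.dim_V by (metis dim_span)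

lemma span_top: 
  assumes "I \<in> tops"
  shows "span (C I) = span N"
proof -
  have "C I \<subseteq> span N" using assms cones_in_sub_span cone_in tops_in by blast
  moreover have "dim (C I) = dim (span N)" using assms by (simp add: skel_def rank_def)
  ultimately show ?thesis using dim_eq_span[of "C I" "span N"] by simp
qed

text \<open>Uniqueness of the dual basis resolves the definite description in
  \<open>dual_vec\<close>; most computations at a maximal cone start from this instance.\<close>

lemma top_dual_bases:
  assumes "I \<in> tops"
  shows "dual_bases (verts I) \<nu> (\<delta> I) (span N)"
proof -
  obtain d where d: "dual_bases (verts I) \<nu> d (span N)"
    using cone_dual_bases(2)[OF tops_in[OF assms]] span_top[OF assms] by auto
  interpret dual_bases "verts I" \<nu> d "span N" by (rule d)
  have "\<delta> I i = d i" if i: "i \<in> verts I" for i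
    unfolding dual_vec_def
  proof (rule the_equality)
    show "d i \<in> span N \<and> (\<forall>j\<in>verts I. d i \<bullet> \<nu> j = (if j = i then 1 else 0))"
      using d_in dual i by auto
    fix u assume "u \<in> span N \<and> (\<forall>j\<in>verts I. u \<bullet> \<nu> j = (if j = i then 1 else 0))"
    then show "u = d i" using dual i d_in by (intro eq_if_inner_b) auto
  qed
  then show ?thesis using d unfolding dual_bases_def by simp
qed

lemma card_verts_top: "I \<in> tops \<Longrightarrow> card (verts I) = rank \<Delta>"
  using dim_cone[of I] by (simp add: skel_def)

lemma verts_mono: "K \<le> J \<Longrightarrow> verts K \<subseteq> verts J"
  by (auto simp: vertices_of_def)

text \<open>The combinatorial form of simpliciality. Injectivity is available only below a fixed J:
  elements of \<Sigma> without a common upper bound may have the same rays, so \<Sigma> is not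
  replaced by a family of sets.\<close>

lemma verts_bij:
  assumes J: "J \<in> \<Sigma>"
  shows "bij_betw verts {K \<in> \<Sigma>. K \<le> J} (Pow (verts J))"
proof -
  obtain d where d: "dual_bases (verts J) \<nu> d (span (C J))"
    using cone_dual_bases(2)[OF J] by auto
  interpret dual_bases "verts J" \<nu> d "span (C J)" by (rule d)
  have "inj_on verts {K \<in> \<Sigma>. K \<le> J}"
    using cone_inj[OF J] cone_dual_bases(1) by (intro inj_onI) (metis (no_types, lifting) mem_Collect_eq)
  moreover have "T \<in> verts ` {K \<in> \<Sigma>. K \<le> J}" if T: "T \<subseteq> verts J" for T
  proof -
    have "convex_cone hull (\<nu> ` T) face_of C J"
      using sub_cone_face[OF T] cone_dual_bases(1)[OF J] by simp
    then obtain K where K: "K \<in> \<Sigma>" "K \<le> J" "C K = convex_cone hull (\<nu> ` T)"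
      using face_ex[OF J] convex_cone_convex_cone_hull by metis
    have "verts K = T"
    proof (intro equalityI subsetI)
      fix i assume i: "i \<in> verts K"
      then have iJ: "i \<in> verts J" using verts_mono K by blast
      have "\<nu> i \<in> convex_cone hull (\<nu> ` T)"
        using K(3) cone_dual_bases(1)[OF K(1)] i by (metis hull_inc imageI)
      then have "\<nu> i \<bullet> d i = 0 \<or> i \<in> T" unfolding mem_cone_hull_iff[OF T] using iJ by auto
      then show "i \<in> T" using dual[OF iJ iJ] by (simp add: inner_commute)
    next
      fix i assume i: "i \<in> T"
      then have iJ: "i \<in> verts J" using T by auto
      obtain d' where d': "dual_bases T \<nu> d' (span (\<nu> ` T))"
        using dual_bases_exists[of T \<nu>] T fin inj_b independent_b
        by (metis finite_subset inj_on_subset independent_mono image_mono)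
      have "convex_cone hull (\<nu> ` {i}) face_of convex_cone hull (\<nu> ` T)"
        using dual_bases.sub_cone_face[OF d', of "{i}"] i by auto
      then have "C i face_of C K"
        using K(3) ray_vec_props(3)[OF verts_in(1)[OF iJ]] by simp
      then have "i \<le> K" using le_iff_face[OF J, of i K] verts_in[OF iJ] K by simp
      then show "i \<in> verts K" using verts_in[OF iJ] by (simp add: vertices_of_def)
    qed
    then show ?thesis using K by auto
  qed
  ultimately show ?thesis using verts_mono unfolding bij_betw_def by blast
qed

end


section \<open>Independence of the generic vector\<close>

lemma quot_map:
  assumes "subspace W"
  shows "x - quot_map W x \<in> W" "w \<in> W \<Longrightarrow> orthogonal (quot_map W x) w"
proof -
  obtain y z where yz: "y \<in> span W" "\<And>w. w \<in> span W \<Longrightarrow> orthogonal z w" "x = y + z"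
    using orthogonal_subspace_decomp_exists[of W x] by metis
  have sW: "span W = W" using assms by (rule span_eq_iff[THEN iffD2])
  have "\<exists>!q. x - q \<in> W \<and> (\<forall>w\<in>W. orthogonal q w)"
  proof (rule ex1I[of _ z])
    show "x - z \<in> W \<and> (\<forall>w\<in>W. orthogonal z w)" using yz sW by auto
    fix q assume q: "x - q \<in> W \<and> (\<forall>w\<in>W. orthogonal q w)"
    have "y + (z - q) \<in> W" using q yz by (simp add: algebra_simps)
    then have "(y + (z - q)) - y \<in> W" using assms yz sW subspace_diff by blast
    then have "z - q \<in> W" by simp
    then have "(z - q) \<bullet> (z - q) = 0" using q yz sW by (simp add: orthogonal_def inner_diff_left)
    then show "q = z" by simp
  qed
  from theI'[OF this] show "x - quot_map W x \<in> W" "w \<in> W \<Longrightarrow> orthogonal (quot_map W x) w"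
    unfolding quot_map_def by auto
qed

lemma quot_map_unique:
  assumes "subspace W" "x - q \<in> W" "\<And>w. w \<in> W \<Longrightarrow> orthogonal q w"
  shows "quot_map W x = q"
proof -
  have "(x - q) - (x - quot_map W x) \<in> W" using quot_map(1) assms subspace_diff by blast
  then have *: "quot_map W x - q \<in> W" by simp
  then have "(quot_map W x - q) \<bullet> (quot_map W x - q) = 0"
    using assms(3)[OF *] quot_map(2)[OF assms(1) *, of x] by (simp add: orthogonal_def inner_diff_left)
  then show ?thesis by simp
qed

lemma linear_quot_map:
  assumes "subspace W"
  shows "linear (quot_map W)"
proof (rule linearI)
  fix x y
  have "(x - quot_map W x) + (y - quot_map W y) \<in> W"
    using quot_map(1) assms subspace_add by blast
  then show "quot_map W (x + y) = quot_map W x + quot_map W y"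
    using quot_map(2)[OF assms]
    by (intro quot_map_unique[OF assms]) (auto simp: algebra_simps orthogonal_def inner_add_left)
next
  fix r x
  have "r *\<^sub>R (x - quot_map W x) \<in> W"
    using quot_map(1) assms subspace_scale by blast
  then show "quot_map W (r *\<^sub>R x) = r *\<^sub>R quot_map W x"
    using quot_map(2)[OF assms]
    by (intro quot_map_unique[OF assms]) (auto simp: algebra_simps orthogonal_def)
qed

lemma quot_map_eq_iff:
  assumes "subspace W"
  shows "quot_map W x = quot_map W y \<longleftrightarrow> x - y \<in> W"
proof
  assume "quot_map W x = quot_map W y"
  moreover have "(x - quot_map W x) - (y - quot_map W y) \<in> W"
    using quot_map(1) assms subspace_diff by blast
  ultimately show "x - y \<in> W" by simp
next
  assume "x - y \<in> W"
  then have "(x - y) + (y - quot_map W y) \<in> W" using quot_map(1) assms subspace_add by blast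
  then show "quot_map W x = quot_map W y"
    using quot_map(2)[OF assms] by (intro quot_map_unique[OF assms]) auto
qed

text \<open>The image of the span is the orthogonal complement of W inside it. Consequently all
  dimensions drop by the same amount under a projection, and maximal cones correspond to maximal
  cones.\<close>

lemma dim_quot_map:
  assumes "W \<subseteq> span S" "subspace W"
  shows "dim (quot_map W ` S) + dim W = dim S"
proof -
  have "quot_map W ` span S = {y \<in> span S. \<forall>x\<in>W. orthogonal x y}"
  proof (intro equalityI subsetI)
    fix q assume "q \<in> quot_map W ` span S"
    then obtain x where x: "x \<in> span S" "q = quot_map W x" by auto
    then have "x - (x - q) \<in> span S" using quot_map(1)[OF assms(2)] assms(1) by (metis span_diff subsetD)
    then show "q \<in> {y \<in> span S. \<forall>x\<in>W. orthogonal x y}"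
      using quot_map(2)[OF assms(2)] x by (auto simp: orthogonal_commute)
  next
    fix y assume y: "y \<in> {y \<in> span S. \<forall>x\<in>W. orthogonal x y}"
    then have "quot_map W y = y"
      using assms(2) by (intro quot_map_unique) (auto simp: subspace_0 orthogonal_commute)
    then show "y \<in> quot_map W ` span S" using y by (metis (no_types, lifting) imageI mem_Collect_eq)
  qed
  then have "dim (quot_map W ` span S) + dim W = dim (span S)"
    using dim_subspace_orthogonal_to_vectors[OF assms(2) subspace_span assms(1)] by simp
  then show ?thesis
    using span_linear_image[OF linear_quot_map[OF assms(2)], of S] by (metis dim_span)
qed

text \<open>The factor contributed by a coordinate to \<open>(-1)\<^sup>I \<phi>\<^sub>I\<close>: here \<open>y\<close> is the coordinate of \<open>v\<close> and \<open>t\<close> that of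
  the point relative to the vertex.\<close>

definition side :: "real \<Rightarrow> real \<Rightarrow> real" where
  "side y t = (if y > 0 then (if t \<ge> 0 then -1 else 0) else (if t \<le> 0 then 1 else 0))"

locale complete_simple_fan = simple_fan \<Delta>
  for \<Delta> :: "('s::order, 'a::euclidean_space) multi_fan" +
  assumes compl: "complete_fan \<Delta>"
begin

text \<open>A vanishing coordinate i would put v into the span of the face opposite to i, and by
  \<open>verts_bij\<close> this face is a cone of the multi-fan of smaller dimension.\<close>

lemma generic_coord:
  assumes "generic_vec \<Delta> v" "I \<in> tops" "i \<in> verts I"
  shows "coord v I i \<noteq> 0"
proof -
  interpret dual_bases "verts I" \<nu> "\<delta> I" "span N" by (rule top_dual_bases[OF assms(2)])
  have "verts I - {i} \<in> verts ` {K \<in> \<Sigma>. K \<le> I}"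
    using verts_bij[OF tops_in[OF assms(2)]] by (auto simp: bij_betw_def)
  then obtain K where K: "K \<in> \<Sigma>" "verts K = verts I - {i}" by auto
  have "card (verts K) < rank \<Delta>"
    using K assms(3) card_verts_top[OF assms(2)] finite_verts by (metis card_Diff1_less)
  then have "v \<notin> span (C K)" "v \<in> span N"
    using assms(1) K(1) dim_cone[OF K(1)] by (auto simp: generic_vec_def)
  then have "v \<notin> span (\<nu> ` (verts I - {i}))"
    using cone_dual_bases(1)[OF K(1)] K(2) span_convex_cone_hull by metis
  then show ?thesis using span_sub_iff[OF \<open>v \<in> span N\<close>, of "verts I - {i}"] by auto
qed

lemma generic_in_span: "generic_vec \<Delta> v \<Longrightarrow> v \<in> span N"
  by (simp add: generic_vec_def)

lemma generic_uminus: "generic_vec \<Delta> v \<Longrightarrow> generic_vec \<Delta> (- v)"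
  unfolding generic_vec_def by (metis add.inverse_inverse span_neg)

section \<open>Degrees of projected multi-fans, written in the original coordinates\<close>

definition pos_count :: "'s \<Rightarrow> 'a \<Rightarrow> int" where
  "pos_count K v = (\<Sum>I | I \<in> tops \<and> K \<le> I.
     weight \<Delta> I * (\<Prod>i\<in>verts I - verts K. if coord v I i > 0 then 1 else 0))"

lemma span_cone_sub:
  assumes "K \<in> \<Sigma>" "J \<in> \<Sigma>" "K \<le> J"
  shows "span (C K) \<subseteq> span (C J)"
  using face_of_imp_subset[OF face_le[OF assms(2,1,3)]] by (rule span_mono)

lemma rank_proj:
  assumes K: "K \<in> \<Sigma>"
  shows "rank (proj_fan \<Delta> K) + dim (C K) = rank \<Delta>"
proof -
  have "span (C K) \<subseteq> span N"
    using cones_in_sub_span[OF cone_in[OF K]] by (simp add: span_minimal)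
  from dim_quot_map[OF this subspace_span] show ?thesis
    by (simp add: rank_def proj_fan_def)
qed

lemma dim_proj_cone:
  assumes "K \<in> \<Sigma>" "J \<in> \<Sigma>" "K \<le> J"
  shows "dim (cone_of (proj_fan \<Delta> K) J) + dim (C K) = dim (C J)"
  using dim_quot_map[OF span_cone_sub[OF assms] subspace_span] by (simp add: proj_fan_def)

lemma skel_proj:
  assumes K: "K \<in> \<Sigma>"
  shows "skel (proj_fan \<Delta> K) (rank (proj_fan \<Delta> K)) = {I \<in> tops. K \<le> I}"
proof -
  have s: "simps_of (proj_fan \<Delta> K) = {J \<in> \<Sigma>. K \<le> J}" by (simp add: proj_fan_def)
  show ?thesis unfolding skel_def s using dim_proj_cone[OF K] rank_proj[OF K] by fastforce
qed

lemma generic_proj: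
  assumes K: "K \<in> \<Sigma>" and v: "generic_vec \<Delta> v"
  shows "generic_vec (proj_fan \<Delta> K) (quot_map (span (C K)) v)"
proof -
  let ?W = "span (C K)"
  let ?q = "quot_map ?W"
  have sp: "span (?q ` S) = ?q ` span S" for S
    using span_linear_image[OF linear_quot_map] subspace_span by blast
  have "?q v \<in> span (lat (proj_fan \<Delta> K))" using v by (simp add: proj_fan_def sp generic_vec_def)
  moreover have "?q v \<notin> span (cone_of (proj_fan \<Delta> K) J)"
    if J: "J \<in> \<Sigma>" "K \<le> J" "dim (cone_of (proj_fan \<Delta> K) J) < rank (proj_fan \<Delta> K)" for J
  proof
    assume "?q v \<in> span (cone_of (proj_fan \<Delta> K) J)"
    then obtain x where x: "x \<in> span (C J)" "?q v = ?q x" by (auto simp: proj_fan_def sp)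
    then have "v - x \<in> span (C J)"
      using span_cone_sub[OF K J(1,2)] quot_map_eq_iff[OF subspace_span] by blast
    then have "v \<in> span (C J)" using x(1) span_add[of "v - x" _ x] by simp
    moreover have "dim (C J) < rank \<Delta>"
      using J dim_proj_cone[OF K J(1,2)] rank_proj[OF K] by simp
    ultimately show False using v J(1) by (simp add: generic_vec_def)
  qed
  ultimately show ?thesis by (simp add: generic_vec_def) (simp add: proj_fan_def)
qed

text \<open>Modulo the span of C(K) a point may be changed by any combination of the rays of K. So
  the image of v lies in the image of C(I) iff the remaining coordinates of v are nonnegative, and
  genericity makes them positive.\<close>

lemma pos_count_eq_deg:
  assumes K: "K \<in> \<Sigma>" and v: "generic_vec \<Delta> v"
  shows "pos_count K v = deg_at (proj_fan \<Delta> K) (quot_map (span (C K)) v)"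
proof -
  let ?W = "span (C K)"
  let ?q = "quot_map ?W"
  have mem: "?q v \<in> cone_of (proj_fan \<Delta> K) I \<longleftrightarrow> (\<forall>i\<in>verts I - verts K. coord v I i > 0)"
    (is "?l \<longleftrightarrow> ?r") if I: "I \<in> tops" "K \<le> I" for I
  proof -
    interpret dual_bases "verts I" \<nu> "\<delta> I" "span N" by (rule top_dual_bases[OF I(1)])
    have vV: "v \<in> span N" using v by (rule generic_in_span)
    have sub: "verts K \<subseteq> verts I" using verts_mono I by auto
    have W: "?W = span (\<nu> ` verts K)" using cone_dual_bases(1)[OF K] span_convex_cone_hull by metis
    have C: "C I = convex_cone hull (\<nu> ` verts I)" using cone_dual_bases(1) tops_in I by blast
    have "?l \<longleftrightarrow> (\<exists>c\<in>C I. v - c \<in> ?W)"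
      using quot_map_eq_iff[OF subspace_span] by (auto simp: proj_fan_def image_iff)
    also have "\<dots> \<longleftrightarrow> (\<forall>i\<in>verts I - verts K. coord v I i \<ge> 0)"
    proof
      assume "\<exists>c\<in>C I. v - c \<in> ?W"
      then obtain c where c: "c \<in> C I" "v - c \<in> span (\<nu> ` verts K)" using W by auto
      show "\<forall>i\<in>verts I - verts K. coord v I i \<ge> 0"
      proof
        fix i assume i: "i \<in> verts I - verts K"
        have "(v - c) \<bullet> \<delta> I i = 0" using inner_d_eq_0_if_span[OF c(2) sub i] .
        moreover have "c \<bullet> \<delta> I i \<ge> 0" using c(1) i mem_cone_hull_iff[of "verts I"] C by auto
        ultimately show "coord v I i \<ge> 0" by (simp add: inner_diff_left)
      qed
    next
      assume r: "\<forall>i\<in>verts I - verts K. coord v I i \<ge> 0"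
      define c where "c = (\<Sum>i\<in>verts I - verts K. (coord v I i) *\<^sub>R \<nu> i)"
      have "c \<in> C I" unfolding c_def C
        using r by (auto intro!: convex_cone_sum[OF convex_cone_convex_cone_hull]
            convex_cone_hull_mul[OF hull_inc])
      moreover have "v - c = (\<Sum>i\<in>verts K. (coord v I i) *\<^sub>R \<nu> i)"
        using expand_b[OF vV] sum.subset_diff[OF sub fin, of "\<lambda>i. (coord v I i) *\<^sub>R \<nu> i"]
        unfolding c_def by (simp add: algebra_simps)
      moreover have "\<dots> \<in> ?W" unfolding W by (intro span_sum span_scale span_base) auto
      ultimately show "\<exists>c\<in>C I. v - c \<in> ?W" by metis
    qed
    also have "\<dots> \<longleftrightarrow> ?r" using generic_coord[OF v I(1)] by (auto simp: less_le)
    finally show ?thesis .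
  qed
  have fin: "finite {I \<in> tops. K \<le> I}" using finite_tops by simp
  have w: "weight (proj_fan \<Delta> K) = weight \<Delta>" by (auto simp: weight_def proj_fan_def)
  have "deg_at (proj_fan \<Delta> K) (?q v) =
      (\<Sum>I \<in> {I \<in> {I \<in> tops. K \<le> I}. ?q v \<in> cone_of (proj_fan \<Delta> K) I}. weight \<Delta> I)"
    by (auto simp: deg_at_def w skel_proj[OF K] intro!: sum.cong)
  also have "\<dots> = (\<Sum>I \<in> {I \<in> tops. K \<le> I}. if ?q v \<in> cone_of (proj_fan \<Delta> K) I then weight \<Delta> I else 0)"
    by (rule sum.inter_filter[OF fin])
  also have "\<dots> = pos_count K v"
    unfolding pos_count_def
  proof (intro sum.cong refl)
    fix I assume I: "I \<in> {I \<in> tops. K \<le> I}"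
    have "(\<Prod>i\<in>verts I - verts K. if coord v I i > 0 then 1 else 0) =
      (if ?q v \<in> cone_of (proj_fan \<Delta> K) I then 1 else (0::int))"
      using mem[of I] I finite_verts by (auto simp: prod_zero_iff)
    then show "(if ?q v \<in> cone_of (proj_fan \<Delta> K) I then weight \<Delta> I else 0) =
        weight \<Delta> I * (\<Prod>i\<in>verts I - verts K. if coord v I i > 0 then 1 else 0)"
      by (simp only:) simp
  qed
  finally show ?thesis by simp
qed

text \<open>Constancy of the degree is used here for every projection, which is what completeness
  adds to pre-completeness.\<close>

lemma pos_count_const:
  assumes "K \<in> \<Sigma>" "generic_vec \<Delta> v" "generic_vec \<Delta> v'"
  shows "pos_count K v = pos_count K v'"
  using assms compl generic_proj
  unfolding complete_fan_def pre_complete_def by (simp add: pos_count_eq_deg)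

text \<open>For generic \<open>v\<close> the factor of \<open>i\<close> is \<open>\<plusminus>1\<close> or \<open>0\<close>, according to whether the sign of the
  \<open>i\<close>-th coordinate of \<open>v\<close> is negative exactly when \<open>i \<in> T\<close>: this is the degree at \<open>v\<close> of the
  multi-fan whose rays in \<open>T\<close> are replaced by their negatives.\<close>

definition flip_deg :: "'s set \<Rightarrow> 'a \<Rightarrow> int" where
  "flip_deg T v = (\<Sum>I\<in>tops. weight \<Delta> I * (\<Prod>i\<in>verts I.
     (if i \<in> T then -1 else 0) + (if coord v I i > 0 then 1 else 0)))"

text \<open>Expanding the product over the vertices of I selects a subset of them. By
  \<open>verts_bij\<close> the subsets are the faces K of I, and exchanging the sums collects, for
  each K, the degree of the projection along K.\<close>

lemma flip_deg_eq:
  "flip_deg T v = (\<Sum>K\<in>\<Sigma>. (\<Prod>i\<in>verts K. if i \<in> T then -1 else 0) * pos_count K v)"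
proof -
  let ?a = "\<lambda>S. \<Prod>i\<in>S. if i \<in> T then -1 else (0::int)"
  let ?g = "\<lambda>I S. \<Prod>i\<in>S. if coord v I i > 0 then 1 else (0::int)"
  have "flip_deg T v = (\<Sum>I\<in>tops. weight \<Delta> I * (\<Sum>S\<in>Pow (verts I). ?a S * ?g I (verts I - S)))"
    unfolding flip_deg_def by (simp add: prod_add finite_verts)
  also have "\<dots> = (\<Sum>I\<in>tops. weight \<Delta> I *
      (\<Sum>K\<in>{K \<in> \<Sigma>. K \<le> I}. ?a (verts K) * ?g I (verts I - verts K)))"
    by (intro sum.cong refl arg_cong2[where f="(*)"] sum.reindex_bij_betw[symmetric]
        verts_bij[OF tops_in])
  also have "\<dots> = (\<Sum>I\<in>tops. \<Sum>K\<in>\<Sigma>. if K \<le> I then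
      weight \<Delta> I * (?a (verts K) * ?g I (verts I - verts K)) else 0)"
    by (intro sum.cong refl) (simp add: sum_distrib_left sum.inter_filter[OF finite_\<Sigma>] if_distrib[of "(*) _"] cong: if_cong)
  also have "\<dots> = (\<Sum>K\<in>\<Sigma>. \<Sum>I\<in>tops. if K \<le> I then
      weight \<Delta> I * (?a (verts K) * ?g I (verts I - verts K)) else 0)"
    by (rule sum.swap)
  also have "\<dots> = (\<Sum>K\<in>\<Sigma>. ?a (verts K) * pos_count K v)"
    unfolding pos_count_def
    by (intro sum.cong refl)
      (simp add: sum_distrib_left sum.inter_filter[OF finite_tops] mult.left_commute if_distrib[of "(*) _"] cong: if_cong)
  finally show ?thesis .
qed

lemma flip_deg_const:
  assumes "generic_vec \<Delta> v" "generic_vec \<Delta> v'"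
  shows "flip_deg T v = flip_deg T v'"
  unfolding flip_deg_eq using pos_count_const[OF _ assms] by simp

section \<open>The Duistermaat-Heckman function in coordinates\<close>

text \<open>The Duistermaat-Heckman function with the sign of each vertex distributed over
  one-dimensional factors. The constants of the hyperplanes are an argument, so that shifted
  multi-polytopes need no separate treatment.\<close>

definition dhc :: "'a \<Rightarrow> ('s \<Rightarrow> real) \<Rightarrow> 'a \<Rightarrow> real" where
  "dhc v c u = (\<Sum>I\<in>tops. of_int (weight \<Delta> I) *
     (\<Prod>i\<in>verts I. side (coord v I i) (u \<bullet> \<nu> i - c i)))"

text \<open>For nonzero y and t, \<open>side y t\<close> is the difference [t < 0] - [y > 0]; the
  power of -1 collects the sign of the n factors. The set of reversed rays depends on u and c but
  not on v, which gives the independence of v.\<close>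

lemma dhc_flip:
  assumes v: "generic_vec \<Delta> v" and "\<And>I i. I \<in> tops \<Longrightarrow> i \<in> verts I \<Longrightarrow> u \<bullet> \<nu> i \<noteq> c i"
  shows "dhc v c u = (-1) ^ rank \<Delta> * of_int (flip_deg {i. u \<bullet> \<nu> i < c i} v)"
proof -
  let ?T = "{i. u \<bullet> \<nu> i < c i}"
  have "(\<Prod>i\<in>verts I. side (coord v I i) (u \<bullet> \<nu> i - c i)) =
    (-1) ^ rank \<Delta> * of_int (\<Prod>i\<in>verts I.
     (if i \<in> ?T then -1 else 0) + (if coord v I i > 0 then 1 else 0))"
    if I: "I \<in> tops" for I
  proof -
    have "(\<Prod>i\<in>verts I. side (coord v I i) (u \<bullet> \<nu> i - c i)) =
      (\<Prod>i\<in>verts I. - of_int ((if i \<in> ?T then -1 else 0) + (if coord v I i > 0 then 1 else 0)))"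
    proof (intro prod.cong refl)
      fix i assume i: "i \<in> verts I"
      have "coord v I i \<noteq> 0" "u \<bullet> \<nu> i \<noteq> c i" using assms(2)[OF I i] generic_coord[OF v I i] by auto
      then show "side (coord v I i) (u \<bullet> \<nu> i - c i) =
          - of_int ((if i \<in> ?T then -1 else 0) + (if coord v I i > 0 then 1 else 0))"
        by (simp add: side_def)
    qed
    also have "\<dots> = (\<Prod>i\<in>verts I. - 1 *
        of_int ((if i \<in> ?T then -1 else 0) + (if coord v I i > 0 then 1 else 0)))"
      by simp
    also have "\<dots> = (-1) ^ rank \<Delta> * of_int (\<Prod>i\<in>verts I.
     (if i \<in> ?T then -1 else 0) + (if coord v I i > 0 then 1 else 0))"
      unfolding prod.distrib prod_constant card_verts_top[OF I] of_int_prod by simp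
    finally show ?thesis .
  qed
  then show ?thesis
    unfolding dhc_def flip_deg_def of_int_sum sum_distrib_left
    by (intro sum.cong refl) (simp add: mult.left_commute)
qed

lemma dhc_indep:
  assumes "generic_vec \<Delta> v" "generic_vec \<Delta> v'"
    and "\<And>I i. I \<in> tops \<Longrightarrow> i \<in> verts I \<Longrightarrow> u \<bullet> \<nu> i \<noteq> c i"
  shows "dhc v c u = dhc v' c u"
  using dhc_flip[OF assms(1,3)] dhc_flip[OF assms(2,3)] flip_deg_const[OF assms(1,2)] by simp

text \<open>The pairing of v with the vertex of I. It is linear in the constants c, whence the
  polynomial dependence of the volume on the shifts.\<close>

definition lam :: "'a \<Rightarrow> ('s \<Rightarrow> real) \<Rightarrow> 's \<Rightarrow> real" where
  "lam v c I = (\<Sum>i\<in>verts I. c i * (coord v I i))"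

text \<open>If \<open>side y t\<close> is nonzero then t and y have a nonnegative product, so on the
  cone at a vertex the pairing with v is least at the vertex.\<close>

lemma dhc_lower:
  assumes v: "generic_vec \<Delta> v" and u: "u \<in> span N" and "dhc v c u \<noteq> 0"
  shows "\<exists>I\<in>tops. lam v c I \<le> u \<bullet> v"
proof -
  obtain I where I: "I \<in> tops" "(\<Prod>i\<in>verts I. side (coord v I i) (u \<bullet> \<nu> i - c i)) \<noteq> 0"
    using assms(3) unfolding dhc_def by (metis (no_types, lifting) mult_zero_right sum.neutral)
  interpret dual_bases "verts I" \<nu> "\<delta> I" "span N" by (rule top_dual_bases[OF I(1)])
  have "u \<bullet> v = u \<bullet> (\<Sum>i\<in>verts I. (coord v I i) *\<^sub>R \<nu> i)"
    using expand_b[OF generic_in_span[OF v]] by simp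
  also have "\<dots> = (\<Sum>i\<in>verts I. (u \<bullet> \<nu> i) * (coord v I i))"
    by (simp add: inner_sum_right mult.commute)
  also have "\<dots> \<ge> lam v c I"
    unfolding lam_def
  proof (rule sum_mono)
    fix i assume i: "i \<in> verts I"
    then have "side (coord v I i) (u \<bullet> \<nu> i - c i) \<noteq> 0" using I(2) finite_verts by auto
    then show "c i * (coord v I i) \<le> (u \<bullet> \<nu> i) * (coord v I i)"
      by (auto simp: side_def mult_right_mono mult_right_mono_neg split: if_splits)
  qed
  finally show ?thesis using I by auto
qed

lemma dhc_slab:
  assumes v: "generic_vec \<Delta> v" and u: "u \<in> span N" and "dhc v c u \<noteq> 0"
    and "\<And>I i. I \<in> tops \<Longrightarrow> i \<in> verts I \<Longrightarrow> u \<bullet> \<nu> i \<noteq> c i"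
  shows "\<bar>u \<bullet> v\<bar> \<le> (\<Sum>I\<in>tops. \<bar>lam v c I\<bar>)"
proof -
  have le: "\<bar>lam v c I\<bar> \<le> (\<Sum>I\<in>tops. \<bar>lam v c I\<bar>)" if "I \<in> tops" for I
    using that finite_tops by (intro member_le_sum) auto
  obtain I where I: "I \<in> tops" "lam v c I \<le> u \<bullet> v" using dhc_lower assms by blast
  have "dhc (- v) c u \<noteq> 0"
    using dhc_indep[OF v generic_uminus[OF v] assms(4)] assms(3) by simp
  then obtain J where J: "J \<in> tops" "lam (- v) c J \<le> u \<bullet> (- v)"
    using dhc_lower[OF generic_uminus[OF v] u] by blast
  have "lam (- v) c J = - lam v c J" by (simp add: lam_def sum_negf)
  then show ?thesis using I J le[OF I(1)] le[OF J(1)] by simp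
qed

end


no_notation Infinite_Sum.abs_summable_on (infixr \<open>abs'_summable'_on\<close> 46)

section \<open>The finite group of a lattice simplex\<close>

lemma finite_lattice_bounded:
  assumes N: "is_lattice N" and S: "bounded S"
  shows "finite (N \<inter> S)"
proof -
  obtain B d where d: "dual_bases B (\<lambda>x. x) d (span N)"
    and mem: "\<And>x. x \<in> N \<longleftrightarrow> x \<in> span N \<and> (\<forall>i\<in>B. x \<bullet> d i \<in> \<int>)"
    by (rule is_latticeE[OF N]) (rule that)
  interpret dual_bases B "\<lambda>x. x" d "span N" by (rule d)
  obtain R where R: "\<And>x. x \<in> S \<Longrightarrow> norm x \<le> R" using S bounded_iff by metis
  let ?f = "\<lambda>x. restrict (\<lambda>i. \<lfloor>x \<bullet> d i\<rfloor>) B"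
  have "?f ` (N \<inter> S) \<subseteq> (\<Pi>\<^sub>E i\<in>B. {\<lfloor>- (R * norm (d i))\<rfloor>..\<lfloor>R * norm (d i)\<rfloor>})"
  proof clarify
    fix x assume x: "x \<in> N" "x \<in> S"
    have "\<bar>x \<bullet> d i\<bar> \<le> R * norm (d i)" for i
      using Cauchy_Schwarz_ineq2[of x "d i"] mult_right_mono[OF R[OF x(2)], of "norm (d i)"] by simp
    then have "- (R * norm (d i)) \<le> x \<bullet> d i \<and> x \<bullet> d i \<le> R * norm (d i)" for i
      by (simp add: abs_le_iff minus_le_iff)
    then show "?f x \<in> (\<Pi>\<^sub>E i\<in>B. {\<lfloor>- (R * norm (d i))\<rfloor>..\<lfloor>R * norm (d i)\<rfloor>})"
      by (auto intro!: floor_mono)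
  qed
  then have "finite (?f ` (N \<inter> S))" by (rule finite_subset) (auto intro!: finite_PiE fin)
  moreover have "inj_on ?f (N \<inter> S)"
  proof (rule inj_onI)
    fix x y assume xy: "x \<in> N \<inter> S" "y \<in> N \<inter> S" "?f x = ?f y"
    have "x \<bullet> d i = y \<bullet> d i" if "i \<in> B" for i
    proof -
      have "x \<bullet> d i \<in> \<int>" "y \<bullet> d i \<in> \<int>" using xy mem that by auto
      moreover have "\<lfloor>x \<bullet> d i\<rfloor> = \<lfloor>y \<bullet> d i\<rfloor>" using xy(3) that by (metis restrict_apply')
      ultimately show ?thesis by (metis Ints_cases floor_of_int)
    qed
    then have "(\<Sum>i\<in>B. (x \<bullet> d i) *\<^sub>R i) = (\<Sum>i\<in>B. (y \<bullet> d i) *\<^sub>R i)" by (intro sum.cong) auto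
    moreover have "x \<in> span N" "y \<in> span N" using xy mem by auto
    ultimately show "x = y" using expand_b by simp
  qed
  ultimately show ?thesis using finite_imageD by blast
qed

lemma eq_if_diff_Ints:
  fixes x y :: real
  assumes "x - y \<in> \<int>" "0 \<le> x" "x < 1" "0 \<le> y" "y < 1"
  shows "x = y"
proof -
  obtain k :: int where k: "x - y = of_int k" using assms(1) by (rule Ints_cases)
  then have "\<bar>real_of_int k\<bar> < 1" using assms by linarith
  then have "k = 0" by linarith
  then show ?thesis using k by simp
qed

lemma prod_cis: "(\<Prod>i\<in>A. cis (f i)) = cis (\<Sum>i\<in>A. f i)"
  by (induction A rule: infinite_finite_induct) (auto simp: cis_mult)

lemma cis_2pi_eq_1_iff: "cis (2 * pi * x) = 1 \<longleftrightarrow> x \<in> \<int>"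
proof
  assume "cis (2 * pi * x) = 1"
  then have "cos (2 * pi * x) = 1" by (simp add: complex_eq_iff)
  then obtain n :: int where "2 * pi * x = of_int n * 2 * pi" using cos_one_2pi_int by blast
  then have "x = of_int n" by simp
  then show "x \<in> \<int>" by simp
qed (rule cis_multiple_2pi)

text \<open>The instances are the maximal cones with their primitive vectors. The \<open>b i\<close>
  generate a sublattice of finite index in N, and this index appears below as
  \<open>idx\<close>.\<close>

locale lattice_simplex = dual_bases I b d V
  for I :: "'s set" and b d :: "'s \<Rightarrow> 'a::euclidean_space" and V +
  fixes N :: "'a set"
  assumes N: "is_lattice N" and span_N: "span N = V" and b_N: "i \<in> I \<Longrightarrow> b i \<in> N"
begin

text \<open>The elements of \<open>G\<^sub>I\<close>, represented in the half-open unit cube.\<close>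

definition reps :: "('s \<Rightarrow> real) set" where
  "reps = {a. (\<forall>i. i \<notin> I \<longrightarrow> a i = 0) \<and> (\<forall>i\<in>I. 0 \<le> a i \<and> a i < 1) \<and> (\<Sum>i\<in>I. a i *\<^sub>R b i) \<in> N}"

abbreviation "idx \<equiv> card reps"

definition frac_rep :: "('s \<Rightarrow> real) \<Rightarrow> 's \<Rightarrow> real" where
  "frac_rep a i = (if i \<in> I then frac (a i) else 0)"

lemma frac_rep_in:
  assumes "(\<Sum>i\<in>I. a i *\<^sub>R b i) \<in> N"
  shows "frac_rep a \<in> reps"
proof -
  have "(\<Sum>i\<in>I. frac_rep a i *\<^sub>R b i) = (\<Sum>i\<in>I. a i *\<^sub>R b i) - (\<Sum>i\<in>I. of_int \<lfloor>a i\<rfloor> *\<^sub>R b i)"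
    unfolding sum_subtractf[symmetric]
    by (intro sum.cong refl) (simp add: frac_rep_def frac_def scaleR_diff_left)
  also have "\<dots> \<in> N"
    using b_N by (intro lattice_diff[OF N assms] lattice_sum[OF N] lattice_scale[OF N]) auto
  finally show ?thesis by (auto simp: reps_def frac_rep_def frac_lt_1)
qed

lemma finite_reps: "finite reps"
proof -
  let ?f = "\<lambda>a. \<Sum>i\<in>I. a i *\<^sub>R b i"
  have "?f ` reps \<subseteq> N \<inter> cball 0 (\<Sum>i\<in>I. norm (b i))"
  proof clarify
    fix a assume a: "a \<in> reps"
    have "norm (?f a) \<le> (\<Sum>i\<in>I. norm (a i *\<^sub>R b i))" by (rule norm_sum)
    also have "\<dots> \<le> (\<Sum>i\<in>I. norm (b i))"
      using a by (intro sum_mono) (auto simp: reps_def intro!: mult_left_le_one_le)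
    finally show "?f a \<in> N \<inter> cball 0 (\<Sum>i\<in>I. norm (b i))" using a by (simp add: reps_def)
  qed
  then have "finite (?f ` reps)" using finite_lattice_bounded[OF N bounded_cball] finite_subset by blast
  moreover have "inj_on ?f reps"
  proof (rule inj_onI)
    fix a a' assume a: "a \<in> reps" "a' \<in> reps" "?f a = ?f a'"
    then have "\<forall>i\<in>I. a i = a' i" by (simp add: comb_eq_iff)
    then show "a = a'" using a by (auto simp: reps_def fun_eq_iff)
  qed
  ultimately show ?thesis using finite_imageD by blast
qed

lemma zero_in_reps: "(\<lambda>_. 0) \<in> reps"
  by (simp add: reps_def lattice_zero[OF N])

lemma idx_pos: "idx > 0"
  using finite_reps zero_in_reps by (metis card_gt_0_iff empty_iff)

text \<open>The character attached to a of the lattice spanned by the \<open>d i\<close>, in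
  coordinates. The minus sign makes the geometric series below produce
  \<open>cis (2 * pi * a i)\<close>, the value \<rho>_i of the Todd operator, rather than its
  inverse.\<close>

definition chi :: "('s \<Rightarrow> real) \<Rightarrow> ('s \<Rightarrow> int) \<Rightarrow> complex" where
  "chi a t = (\<Prod>i\<in>I. cis (- (2 * pi * (a i * of_int (t i)))))"

lemma chi_eq: "chi a t = cis (2 * pi * (- (\<Sum>i\<in>I. a i * of_int (t i))))"
  unfolding chi_def prod_cis by (simp add: sum_negf sum_distrib_left)

lemma inner_comb: "(\<Sum>i\<in>I. x i *\<^sub>R b i) \<bullet> (\<Sum>i\<in>I. y i *\<^sub>R d i) = (\<Sum>i\<in>I. x i * y i)"
proof -
  have "(\<Sum>i\<in>I. x i *\<^sub>R b i) \<bullet> (\<Sum>i\<in>I. y i *\<^sub>R d i) = (\<Sum>i\<in>I. y i * ((\<Sum>i\<in>I. x i *\<^sub>R b i) \<bullet> d i))"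
    by (simp add: inner_sum_right)
  also have "\<dots> = (\<Sum>i\<in>I. x i * y i)" by (intro sum.cong refl) (simp add: comb_inner_d)
  finally show ?thesis .
qed

lemma chi_frac_rep: "chi (frac_rep a) t = chi a t"
proof -
  have "cis (- (2 * pi * (frac_rep a i * of_int (t i)))) = cis (- (2 * pi * (a i * of_int (t i))))"
    if "i \<in> I" for i
  proof -
    have "- (2 * pi * (a i * of_int (t i))) = - (2 * pi * (frac_rep a i * of_int (t i))) +
        2 * pi * of_int (- \<lfloor>a i\<rfloor> * t i)"
      using that by (simp add: frac_rep_def frac_def algebra_simps)
    then have "cis (- (2 * pi * (a i * of_int (t i)))) =
        cis (- (2 * pi * (frac_rep a i * of_int (t i)))) * cis (2 * pi * of_int (- \<lfloor>a i\<rfloor> * t i))"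
      by (metis cis_mult)
    then show ?thesis by (simp only: cis_multiple_2pi Ints_of_int) simp
  qed
  then show ?thesis unfolding chi_def by (intro prod.cong) auto
qed

lemma chi_add: "chi (\<lambda>i. a i + a' i) t = chi a t * chi a' t"
  unfolding chi_eq by (simp add: cis_mult algebra_simps sum.distrib)

text \<open>Orthogonality of characters. If the point is not in the dual lattice, some x in N has a
  non-integral pairing with it; adding the coordinates of x and reducing modulo 1 permutes
  \<open>reps\<close> and multiplies the sum by \<open>chi c t\<close>, which is not 1.\<close>

lemma sum_chi:
  "(\<Sum>a\<in>reps. chi a t) = (if (\<Sum>i\<in>I. of_int (t i) *\<^sub>R d i) \<in> dual_lattice N then of_nat idx else 0)"
proof (cases "(\<Sum>i\<in>I. of_int (t i) *\<^sub>R d i) \<in> dual_lattice N")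
  case True
  have "chi a t = 1" if a: "a \<in> reps" for a
  proof -
    have "(\<Sum>i\<in>I. a i *\<^sub>R b i) \<bullet> (\<Sum>i\<in>I. of_int (t i) *\<^sub>R d i) \<in> \<int>"
      using True a by (auto simp: dual_lattice_def reps_def inner_commute)
    then have "(\<Sum>i\<in>I. a i * of_int (t i)) \<in> \<int>" by (simp add: inner_comb)
    then show ?thesis unfolding chi_eq cis_2pi_eq_1_iff by simp
  qed
  then show ?thesis using True by simp
next
  case False
  moreover have "(\<Sum>i\<in>I. of_int (t i) *\<^sub>R d i) \<in> span N" using sum_d_in span_N by simp
  ultimately obtain x where x: "x \<in> N" "(\<Sum>i\<in>I. of_int (t i) *\<^sub>R d i) \<bullet> x \<notin> \<int>"
    by (auto simp: dual_lattice_def)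
  define c where "c = (\<lambda>i. x \<bullet> d i)"
  have xc: "(\<Sum>i\<in>I. c i *\<^sub>R b i) = x"
    unfolding c_def using x(1) span_N span_base by (intro expand_b) blast
  have "chi c t \<noteq> 1"
  proof
    assume "chi c t = 1"
    then have "(\<Sum>i\<in>I. c i * of_int (t i)) \<in> \<int>" unfolding chi_eq cis_2pi_eq_1_iff by simp
    then show False using x(2) by (simp add: inner_comb[symmetric] xc inner_commute)
  qed
  define \<sigma> where "\<sigma> = (\<lambda>a. frac_rep (\<lambda>i. a i + c i))"
  have "\<sigma> ` reps \<subseteq> reps"
    unfolding \<sigma>_def
  proof clarify
    fix a assume "a \<in> reps"
    then have "(\<Sum>i\<in>I. a i *\<^sub>R b i) + (\<Sum>i\<in>I. c i *\<^sub>R b i) \<in> N"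
      unfolding xc using x(1) by (intro lattice_add[OF N]) (auto simp: reps_def)
    then show "frac_rep (\<lambda>i. a i + c i) \<in> reps"
      by (intro frac_rep_in) (simp add: scaleR_left_distrib sum.distrib)
  qed
  moreover have "inj_on \<sigma> reps"
  proof (rule inj_onI)
    fix a a' assume a: "a \<in> reps" "a' \<in> reps" "\<sigma> a = \<sigma> a'"
    have "a i = a' i" for i
    proof (cases "i \<in> I")
      case True
      then have "frac (a i + c i) = frac (a' i + c i)"
        using fun_cong[OF a(3), of i] by (simp add: \<sigma>_def frac_rep_def)
      then have "(a i + c i) - (a' i + c i) \<in> \<int>" by (elim frac_eqE) simp
      then show ?thesis using a True by (intro eq_if_diff_Ints) (auto simp: reps_def)
    qed (use a in \<open>auto simp: reps_def\<close>)
    then show "a = a'" by blast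
  qed
  ultimately have "bij_betw \<sigma> reps reps"
    using finite_reps by (simp add: bij_betw_def endo_inj_surj)
  then have "(\<Sum>a\<in>reps. chi a t) = (\<Sum>a\<in>reps. chi (\<sigma> a) t)"
    using sum.reindex_bij_betw[of \<sigma> reps reps "\<lambda>a. chi a t"] by simp
  also have "\<dots> = (\<Sum>a\<in>reps. chi a t) * chi c t"
    by (simp add: \<sigma>_def chi_frac_rep chi_add sum_distrib_right)
  finally have "(\<Sum>a\<in>reps. chi a t) * (1 - chi c t) = 0" by (simp add: algebra_simps)
  then show ?thesis using \<open>chi c t \<noteq> 1\<close> False by simp
qed

section \<open>Sums over the dual lattice as averages of products\<close>

definition of_coords :: "('s \<Rightarrow> int) \<Rightarrow> 'a" where
  "of_coords t = (\<Sum>i\<in>I. of_int (t i) *\<^sub>R d i)"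

lemma of_coords_inner: "i \<in> I \<Longrightarrow> of_coords t \<bullet> b i = of_int (t i)"
  unfolding of_coords_def by (rule comb_inner_b)

lemma dual_lattice_inner: "u \<in> dual_lattice N \<Longrightarrow> i \<in> I \<Longrightarrow> u \<bullet> b i \<in> \<int>"
  using b_N by (auto simp: dual_lattice_def)

lemma dual_lattice_V: "u \<in> dual_lattice N \<Longrightarrow> u \<in> V"
  using span_N by (auto simp: dual_lattice_def)

lemma of_coords_bij:
  "bij_betw of_coords {t \<in> I \<rightarrow>\<^sub>E UNIV. of_coords t \<in> dual_lattice N}
     (dual_lattice N)"
proof (rule bij_betwI)
  show "of_coords \<in> {t \<in> I \<rightarrow>\<^sub>E UNIV. of_coords t \<in> dual_lattice N} \<rightarrow>
      (dual_lattice N)"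
    by (auto simp: of_coords_inner)
  let ?g = "\<lambda>u. restrict (\<lambda>i. \<lfloor>u \<bullet> b i\<rfloor>) I"
  have g: "of_coords (?g u) = u" if u: "u \<in> dual_lattice N" for u
  proof -
    have "of_coords (?g u) = (\<Sum>i\<in>I. (u \<bullet> b i) *\<^sub>R d i)"
      unfolding of_coords_def using dual_lattice_inner[OF u] by (intro sum.cong refl) auto
    then show ?thesis using expand_d[OF dual_lattice_V[OF u]] by simp
  qed
  then show "of_coords (?g u) = u" if "u \<in> (dual_lattice N)" for u
    using that by auto
  show "?g \<in> (dual_lattice N) \<rightarrow> {t \<in> I \<rightarrow>\<^sub>E UNIV. of_coords t \<in> dual_lattice N}"
    using g by auto
  show "?g (of_coords t) = t" if t: "t \<in> {t \<in> I \<rightarrow>\<^sub>E UNIV. of_coords t \<in> dual_lattice N}" for t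
  proof
    fix i
    have "t i = undefined" if "i \<notin> I" using t that by (metis (no_types, lifting) PiE_arb mem_Collect_eq)
    then show "?g (of_coords t) i = t i" by (cases "i \<in> I") (simp_all add: of_coords_inner)
  qed
qed

lemma indicator_dual_lattice:
  "(if of_coords t \<in> dual_lattice N then 1 else 0) = (\<Sum>a\<in>reps. chi a t) / of_nat idx"
  using sum_chi[of t] idx_pos by (simp add: of_coords_def)

text \<open>Averaging the characters detects the dual lattice among all integer coordinate vectors;
  for each character the sum over all of these splits into one-dimensional sums.\<close>

lemma lattice_sum_prod:
  fixes f :: "'s \<Rightarrow> int \<Rightarrow> complex"
  assumes f: "\<And>i. i \<in> I \<Longrightarrow> f i abs_summable_on UNIV"
  shows "(\<lambda>u. \<Prod>i\<in>I. f i \<lfloor>u \<bullet> b i\<rfloor>) abs_summable_on dual_lattice N"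
    and "infsetsum (\<lambda>u. \<Prod>i\<in>I. f i \<lfloor>u \<bullet> b i\<rfloor>) (dual_lattice N) =
      (\<Sum>a\<in>reps. \<Prod>i\<in>I. infsetsum (\<lambda>t. f i t * cis (- (2 * pi * (a i * of_int t)))) UNIV) / of_nat idx"
proof -
  let ?T = "I \<rightarrow>\<^sub>E (UNIV :: int set)"
  let ?T' = "{t \<in> I \<rightarrow>\<^sub>E (UNIV :: int set). of_coords t \<in> dual_lattice N}"
  have bij: "bij_betw of_coords ?T' (dual_lattice N)" using of_coords_bij .
  have s: "(\<lambda>t. \<Prod>i\<in>I. f i (t i)) abs_summable_on ?T"
    using f fin by (intro abs_summable_on_prod_PiE) auto
  have eq: "(\<Prod>i\<in>I. f i \<lfloor>of_coords t \<bullet> b i\<rfloor>) = (\<Prod>i\<in>I. f i (t i))" for t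
    by (intro prod.cong) (auto simp: of_coords_inner)
  show "(\<lambda>u. \<Prod>i\<in>I. f i \<lfloor>u \<bullet> b i\<rfloor>) abs_summable_on dual_lattice N"
    unfolding abs_summable_on_reindex_bij_betw[OF bij, symmetric] eq
    by (rule abs_summable_on_subset[OF s]) auto
  let ?h = "\<lambda>a i t. f i t * cis (- (2 * pi * (a i * of_int t)))"
  have h: "?h a i abs_summable_on UNIV" if "i \<in> I" for a :: "'s \<Rightarrow> real" and i
    using f[OF that] by (rule abs_summable_on_comparison_test) (simp add: norm_mult)
  have "infsetsum (\<lambda>u. \<Prod>i\<in>I. f i \<lfloor>u \<bullet> b i\<rfloor>) (dual_lattice N) = infsetsum (\<lambda>t. \<Prod>i\<in>I. f i (t i)) ?T'"
    unfolding infsetsum_reindex_bij_betw[OF bij, symmetric] eq ..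
  also have "\<dots> = infsetsum (\<lambda>t. (\<Prod>i\<in>I. f i (t i)) * (if of_coords t \<in> dual_lattice N then 1 else 0)) ?T"
    by (rule infsetsum_cong_neutral) auto
  also have "\<dots> = infsetsum (\<lambda>t. (\<Sum>a\<in>reps. \<Prod>i\<in>I. ?h a i (t i)) / of_nat idx) ?T"
    unfolding indicator_dual_lattice chi_def by (simp add: prod.distrib sum_distrib_left)
  also have "\<dots> = infsetsum (\<lambda>t. \<Sum>a\<in>reps. \<Prod>i\<in>I. ?h a i (t i)) ?T / of_nat idx"
    using h fin by (intro infsetsum_cdiv abs_summable_sum abs_summable_on_prod_PiE) auto
  also have "infsetsum (\<lambda>t. \<Sum>a\<in>reps. \<Prod>i\<in>I. ?h a i (t i)) ?T =
      (\<Sum>a\<in>reps. infsetsum (\<lambda>t. \<Prod>i\<in>I. ?h a i (t i)) ?T)"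
    using h fin by (intro sum_infsetsum[symmetric] abs_summable_on_prod_PiE) auto
  also have "\<dots> = (\<Sum>a\<in>reps. \<Prod>i\<in>I. infsetsum (?h a i) UNIV)"
    using h fin by (intro sum.cong refl infsetsum_prod_PiE) auto
  finally show "infsetsum (\<lambda>u. \<Prod>i\<in>I. f i \<lfloor>u \<bullet> b i\<rfloor>) (dual_lattice N) =
      (\<Sum>a\<in>reps. \<Prod>i\<in>I. infsetsum (?h a i) UNIV) / of_nat idx" .
qed

text \<open>The finite counterpart of \<open>lattice_sum_prod\<close>, with intervals of integers as
  factors; it serves to determine the density of the dual lattice.\<close>

lemma card_lattice_box:
  assumes "\<And>i. i \<in> I \<Longrightarrow> finite (A i)"
  shows "finite {u \<in> dual_lattice N. \<forall>i\<in>I. \<lfloor>u \<bullet> b i\<rfloor> \<in> A i}" (is "finite ?U")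
    and "of_nat (card {u \<in> dual_lattice N. \<forall>i\<in>I. \<lfloor>u \<bullet> b i\<rfloor> \<in> A i}) =
    (\<Sum>a\<in>reps. \<Prod>i\<in>I. \<Sum>t\<in>A i. cis (- (2 * pi * (a i * of_int t)))) / of_nat idx"
proof -
  have fT: "finite (Pi\<^sub>E I A)" using fin assms by (intro finite_PiE) auto
  let ?T' = "{t \<in> Pi\<^sub>E I A. of_coords t \<in> dual_lattice N}"
  have bij: "bij_betw of_coords ?T' ?U"
  proof (rule bij_betw_subset[OF of_coords_bij])
    show "?T' \<subseteq> {t \<in> I \<rightarrow>\<^sub>E UNIV. of_coords t \<in> dual_lattice N}" by (auto simp: PiE_def)
    show "of_coords ` ?T' = ?U"
    proof (intro equalityI subsetI)
      fix u assume u: "u \<in> ?U"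
      then have "u \<in> of_coords ` {t \<in> I \<rightarrow>\<^sub>E UNIV. of_coords t \<in> dual_lattice N}"
        using of_coords_bij unfolding bij_betw_def by simp
      then obtain t where t: "t \<in> I \<rightarrow>\<^sub>E UNIV" "of_coords t \<in> dual_lattice N" "u = of_coords t" by blast
      have "t i \<in> A i" if "i \<in> I" for i using u that unfolding t(3) by (simp add: of_coords_inner)
      then have "t \<in> ?T'" using t(1,2) by (simp add: PiE_iff)
      then show "u \<in> of_coords ` ?T'" using t(3) by simp
    next
      fix u assume "u \<in> of_coords ` ?T'"
      then obtain t where t: "t \<in> Pi\<^sub>E I A" "of_coords t \<in> dual_lattice N" "u = of_coords t" by blast
      have "\<lfloor>u \<bullet> b i\<rfloor> \<in> A i" if "i \<in> I" for i
        unfolding t(3) using that t(1) by (simp add: of_coords_inner PiE_mem)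
      then show "u \<in> ?U" using t by simp
    qed
  qed
  then show "finite ?U"
    using bij_betw_finite[OF bij] fT by simp
  from bij have "card ?U = card ?T'"
    by (rule bij_betw_same_card[symmetric])
  also have "(of_nat (card ?T') :: complex) = (\<Sum>t\<in>Pi\<^sub>E I A. if of_coords t \<in> dual_lattice N then 1 else 0)"
    using fT by (simp add: sum.inter_filter[symmetric])
  also have "\<dots> = (\<Sum>t\<in>Pi\<^sub>E I A. \<Sum>a\<in>reps. chi a t) / of_nat idx"
    unfolding indicator_dual_lattice by (simp add: sum_divide_distrib)
  also have "(\<Sum>t\<in>Pi\<^sub>E I A. \<Sum>a\<in>reps. chi a t) = (\<Sum>a\<in>reps. \<Sum>t\<in>Pi\<^sub>E I A. chi a t)"
    by (rule sum.swap)
  also have "\<dots> = (\<Sum>a\<in>reps. \<Prod>i\<in>I. \<Sum>t\<in>A i. cis (- (2 * pi * (a i * of_int t))))"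
    unfolding chi_def using fin assms by (intro sum.cong refl prod_sum_PiE[symmetric]) auto
  finally show "of_nat (card ?U) =
    (\<Sum>a\<in>reps. \<Prod>i\<in>I. \<Sum>t\<in>A i. cis (- (2 * pi * (a i * of_int t)))) / of_nat idx" .
qed

end



section \<open>Lattice points in large boxes\<close>

text \<open>A telescoping geometric sum. The point is that the bound does not depend on the number
  of terms.\<close>

lemma norm_sum_cis_le:
  assumes "cis \<theta> \<noteq> 1"
  shows "norm (\<Sum>t\<in>{p..<q::int}. cis (\<theta> * of_int t)) \<le> 2 / norm (1 - cis \<theta>)"
proof (cases "p \<le> q")
  case True
  have "(1 - cis \<theta>) * (\<Sum>t\<in>{p..<q}. cis (\<theta> * of_int t)) = cis (\<theta> * of_int p) - cis (\<theta> * of_int q)"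
    using True
  proof (induction q rule: int_ge_induct)
    case (step q)
    let ?s = "\<Sum>t\<in>{p..<q}. cis (\<theta> * of_int t)"
    have "{p..<q + 1} = insert q {p..<q}" using step by auto
    then have "(1 - cis \<theta>) * (\<Sum>t\<in>{p..<q + 1}. cis (\<theta> * of_int t)) =
        (1 - cis \<theta>) * cis (\<theta> * of_int q) + (1 - cis \<theta>) * ?s"
      by (simp add: distrib_left)
    also have "(1 - cis \<theta>) * cis (\<theta> * of_int q) = cis (\<theta> * of_int q) - cis (\<theta> * of_int (q + 1))"
      by (simp add: cis_mult algebra_simps)
    finally show ?case unfolding step.IH by simp
  qed simp
  then have "norm (1 - cis \<theta>) * norm (\<Sum>t\<in>{p..<q}. cis (\<theta> * of_int t)) \<le> 1 + 1"
    by (metis norm_cis norm_mult norm_triangle_ineq4)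
  then show ?thesis using assms by (simp add: field_simps)
qed simp

text \<open>For integral a all terms are 1 and the sum counts integers in an interval; otherwise the
  sums stay bounded and disappear after division by K.\<close>

lemma sum_cis_asymptotics:
  assumes "\<alpha> \<le> \<beta>"
  shows "(\<lambda>K. (\<Sum>t\<in>{\<lceil>real K * \<alpha> - s\<rceil>..<\<lceil>real K * \<beta> + s\<rceil>}. cis (- (2 * pi * (a * of_int t)))) / of_nat K)
    \<longlonglongrightarrow> (if a \<in> \<int> then of_real (\<beta> - \<alpha>) else 0)"
proof (cases "a \<in> \<int>")
  case True
  let ?T = "\<lambda>K. {\<lceil>real K * \<alpha> - s\<rceil>..<\<lceil>real K * \<beta> + s\<rceil>}"
  let ?z = "\<lambda>K. \<lceil>real K * \<beta> + s\<rceil> - \<lceil>real K * \<alpha> - s\<rceil>"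
  have "cis (- (2 * pi * (a * of_int t))) = 1" for t
  proof -
    have "- (a * of_int t) \<in> \<int>" using True by simp
    then have "cis (2 * pi * (- (a * of_int t))) = 1" unfolding cis_2pi_eq_1_iff .
    then show ?thesis by simp
  qed
  then have eq: "(\<Sum>t\<in>?T K. cis (- (2 * pi * (a * of_int t)))) / of_nat K
      = of_real (real (nat (?z K)) / real K)" for K
    by simp
  \<comment> \<open>The two ceilings err in the same direction by less than 1, so their difference
    errs by less than 1; the margins add 2 \<bar>s\<bar>. Truncation by \<open>nat\<close> cannot
    enlarge the error, because the interval to be approximated has nonnegative length.\<close>
  have bound: "norm (real (nat (?z K)) / real K - (\<beta> - \<alpha>)) \<le> (1 + 2 * \<bar>s\<bar>) / real K" if "K > 0" for K
  proof -
    have "real (nat (?z K)) = max 0 (real_of_int (?z K))" by simp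
    moreover have "\<bar>real_of_int (?z K) - real K * (\<beta> - \<alpha>)\<bar> \<le> 1 + 2 * \<bar>s\<bar>"
      using ceiling_correct[of "real K * \<beta> + s"] ceiling_correct[of "real K * \<alpha> - s"]
      by (simp add: algebra_simps abs_le_iff) linarith
    moreover have "real K * (\<beta> - \<alpha>) \<ge> 0" using assms by simp
    ultimately have "\<bar>real (nat (?z K)) - real K * (\<beta> - \<alpha>)\<bar> \<le> 1 + 2 * \<bar>s\<bar>" by linarith
    then have "\<bar>real (nat (?z K)) - real K * (\<beta> - \<alpha>)\<bar> / real K \<le> (1 + 2 * \<bar>s\<bar>) / real K"
      by (intro divide_right_mono) auto
    also have "\<bar>real (nat (?z K)) - real K * (\<beta> - \<alpha>)\<bar> / real K =
        \<bar>(real (nat (?z K)) - real K * (\<beta> - \<alpha>)) / real K\<bar>" by simp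
    also have "(real (nat (?z K)) - real K * (\<beta> - \<alpha>)) / real K = real (nat (?z K)) / real K - (\<beta> - \<alpha>)"
      using that by (simp add: diff_divide_distrib)
    finally show ?thesis by simp
  qed
  have "(\<lambda>K. real (nat (?z K)) / real K - (\<beta> - \<alpha>)) \<longlonglongrightarrow> 0"
  proof (rule Lim_null_comparison)
    show "\<forall>\<^sub>F K in sequentially. norm (real (nat (?z K)) / real K - (\<beta> - \<alpha>)) \<le> (1 + 2 * \<bar>s\<bar>) / real K"
      using eventually_gt_at_top[of 0] by eventually_elim (rule bound)
  qed (rule lim_const_over_n)
  then have "(\<lambda>K. real (nat (?z K)) / real K) \<longlonglongrightarrow> \<beta> - \<alpha>" by (simp add: LIM_zero_iff)
  then show ?thesis unfolding eq using True by (simp only: if_True tendsto_of_real)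
next
  case False
  let ?T = "\<lambda>K. {\<lceil>real K * \<alpha> - s\<rceil>..<\<lceil>real K * \<beta> + s\<rceil>}"
  let ?\<theta> = "- (2 * pi * a)"
  have "cis ?\<theta> \<noteq> 1"
    using False cis_2pi_eq_1_iff[of "- a"] by simp
  have "(\<lambda>K. (\<Sum>t\<in>?T K. cis (?\<theta> * of_int t)) / of_nat K) \<longlonglongrightarrow> 0"
  proof (rule Lim_null_comparison)
    show "\<forall>\<^sub>F K in sequentially. norm ((\<Sum>t\<in>?T K. cis (?\<theta> * of_int t)) / of_nat K)
        \<le> (2 / norm (1 - cis ?\<theta>)) / real K"
      unfolding norm_divide norm_of_nat
      by (intro always_eventually allI divide_right_mono norm_sum_cis_le[OF \<open>cis ?\<theta> \<noteq> 1\<close>]) simp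
  qed (rule lim_const_over_n)
  then show ?thesis using False by (simp add: mult.assoc)
qed

context lattice_simplex
begin

text \<open>The margin s is not scaled by K and hence does not affect the density. It is used with
  both signs, to enclose a box by unions of cubes from outside and from inside.\<close>

definition box_count :: "('s \<Rightarrow> real) \<Rightarrow> ('s \<Rightarrow> real) \<Rightarrow> real \<Rightarrow> nat \<Rightarrow> 'a set" where
  "box_count \<alpha> \<beta> s K =
    {u \<in> dual_lattice N. \<forall>i\<in>I. real K * \<alpha> i - s \<le> u \<bullet> b i \<and> u \<bullet> b i < real K * \<beta> i + s}"

lemma box_count_eq:
  "box_count \<alpha> \<beta> s K =
    {u \<in> dual_lattice N. \<forall>i\<in>I. \<lfloor>u \<bullet> b i\<rfloor> \<in> {\<lceil>real K * \<alpha> i - s\<rceil>..<\<lceil>real K * \<beta> i + s\<rceil>}}"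
proof -
  have "real K * \<alpha> i - s \<le> u \<bullet> b i \<and> u \<bullet> b i < real K * \<beta> i + s \<longleftrightarrow>
      \<lfloor>u \<bullet> b i\<rfloor> \<in> {\<lceil>real K * \<alpha> i - s\<rceil>..<\<lceil>real K * \<beta> i + s\<rceil>}"
    if "u \<in> dual_lattice N" "i \<in> I" for u i
  proof -
    have "u \<bullet> b i \<in> \<int>" using dual_lattice_inner that by blast
    then obtain z where "u \<bullet> b i = of_int z" by (rule Ints_cases)
    then show ?thesis by (auto simp: ceiling_le_iff less_ceiling_iff)
  qed
  then show ?thesis unfolding box_count_def by auto
qed

lemma finite_box_count: "finite (box_count \<alpha> \<beta> s K)"
  unfolding box_count_eq by (rule card_lattice_box) simp

text \<open>A nontrivial element of \<open>reps\<close> has a non-integral coordinate, so its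
  product tends to 0. Only the trivial character survives, and the dual lattice has density 1 /
  \<open>idx\<close> in these coordinates.\<close>

lemma box_count_asymptotics:
  assumes "\<And>i. i \<in> I \<Longrightarrow> \<alpha> i \<le> \<beta> i"
  shows "(\<lambda>K. real (card (box_count \<alpha> \<beta> s K)) / real K ^ card I) \<longlonglongrightarrow> (\<Prod>i\<in>I. \<beta> i - \<alpha> i) / real idx"
proof -
  let ?S = "\<lambda>a i K. \<Sum>t\<in>{\<lceil>real K * \<alpha> i - s\<rceil>..<\<lceil>real K * \<beta> i + s\<rceil>}. cis (- (2 * pi * (a i * of_int t)))"
  let ?c = "\<lambda>K. of_nat (card (box_count \<alpha> \<beta> s K)) / of_nat K ^ card I :: complex"
  have c: "?c K = (\<Sum>a\<in>reps. \<Prod>i\<in>I. ?S a i K / of_nat K) / of_nat idx" for K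
  proof -
    have "(\<Prod>i\<in>I. ?S a i K / of_nat K) = (\<Prod>i\<in>I. ?S a i K) / of_nat K ^ card I" for a
      unfolding prod_dividef by simp
    then show ?thesis
      unfolding box_count_eq by (subst card_lattice_box) (simp_all flip: sum_divide_distrib)
  qed
  have "?c \<longlonglongrightarrow> (\<Sum>a\<in>reps. \<Prod>i\<in>I. if a i \<in> \<int> then of_real (\<beta> i - \<alpha> i) else 0) / of_nat idx"
    unfolding c using assms idx_pos
    by (intro tendsto_divide tendsto_sum tendsto_prod sum_cis_asymptotics tendsto_const) auto
  also have "(\<Sum>a\<in>reps. \<Prod>i\<in>I. if a i \<in> \<int> then of_real (\<beta> i - \<alpha> i) else (0::complex)) =
      (\<Sum>a\<in>reps. if a = (\<lambda>_. 0) then \<Prod>i\<in>I. of_real (\<beta> i - \<alpha> i) else 0)"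
  proof (intro sum.cong refl)
    fix a assume a: "a \<in> reps"
    show "(\<Prod>i\<in>I. if a i \<in> \<int> then of_real (\<beta> i - \<alpha> i) else (0::complex)) =
      (if a = (\<lambda>_. 0) then \<Prod>i\<in>I. of_real (\<beta> i - \<alpha> i) else 0)"
    proof (cases "\<forall>i\<in>I. a i \<in> \<int>")
      case True
      have "a i = 0" for i
      proof (cases "i \<in> I")
        case i: True
        then show ?thesis using True a by (intro eq_if_diff_Ints) (auto simp: reps_def)
      qed (use a in \<open>auto simp: reps_def\<close>)
      then show ?thesis by auto
    next
      case False
      then have "a \<noteq> (\<lambda>_. 0)" by auto
      moreover have "(\<Prod>i\<in>I. if a i \<in> \<int> then of_real (\<beta> i - \<alpha> i) else (0::complex)) = 0"
        using False fin by (auto intro!: prod_zero)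
      ultimately show ?thesis by simp
    qed
  qed
  also have "\<dots> = of_real (\<Prod>i\<in>I. \<beta> i - \<alpha> i)"
    using finite_reps zero_in_reps by simp
  finally have "(\<lambda>K. of_real (real (card (box_count \<alpha> \<beta> s K)) / real K ^ card I) :: complex)
      \<longlonglongrightarrow> of_real ((\<Prod>i\<in>I. \<beta> i - \<alpha> i) / real idx)" by simp
  then show ?thesis by (simp only: tendsto_of_real_iff)
qed

end

section \<open>The normalised measure in the coordinates of a simplex\<close>

abbreviation lborel_PiM :: "'s set \<Rightarrow> ('s \<Rightarrow> real) measure" where
  "lborel_PiM A \<equiv> \<Pi>\<^sub>M i\<in>A. lborel"

abbreviation Ico_box :: "'s set \<Rightarrow> ('s \<Rightarrow> real) \<Rightarrow> ('s \<Rightarrow> real) \<Rightarrow> ('s \<Rightarrow> real) set" where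
  "Ico_box A \<alpha> \<beta> \<equiv> \<Pi>\<^sub>E i\<in>A. {\<alpha> i..<\<beta> i}"

lemma emeasure_PiM_Ico:
  fixes \<alpha> \<beta> :: "'s \<Rightarrow> real"
  assumes "finite A" "\<And>i. i \<in> A \<Longrightarrow> \<alpha> i \<le> \<beta> i"
  shows "emeasure (lborel_PiM A) (Ico_box A \<alpha> \<beta>) = ennreal (\<Prod>i\<in>A. \<beta> i - \<alpha> i)"
proof -
  interpret product_sigma_finite "\<lambda>_. lborel :: real measure" by standard
  show ?thesis using assms by (subst emeasure_PiM) (auto simp: prod_ennreal)
qed

text \<open>Half-open boxes are chosen because they are stable under intersection and can be tiled
  by half-open cubes without overlaps.\<close>

lemma measure_eqI_PiM_Ico:
  fixes P Q :: "('s \<Rightarrow> real) measure"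
  assumes "finite A" "sets P = sets (lborel_PiM A)"
    "sets Q = sets (lborel_PiM A)"
    and eq: "\<And>\<alpha> \<beta>. (\<And>i. i \<in> A \<Longrightarrow> \<alpha> i \<le> \<beta> i) \<Longrightarrow>
      emeasure P (Ico_box A \<alpha> \<beta>) = emeasure Q (Ico_box A \<alpha> \<beta>)"
    and fin: "\<And>\<alpha> \<beta>. emeasure P (Ico_box A \<alpha> \<beta>) \<noteq> \<infinity>"
  shows "P = Q"
proof -
  let ?E = "{Ico_box A \<alpha> \<beta> | \<alpha> \<beta>. True}"
  let ?\<Omega> = "\<Pi>\<^sub>E i\<in>A. (UNIV :: real set)"
  have gen: "sets (lborel_PiM A) = sigma_sets ?\<Omega> ?E"
  proof -
    let ?H = "range (\<lambda>(a, b). {a..<b::real})"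
    let ?P = "{{f \<in> (\<Pi>\<^sub>E i\<in>A. UNIV). \<forall>i\<in>j. f i \<in> S i} | S j. j \<in> {A} \<and> S \<in> Pi j (\<lambda>_. ?H)}"
    have b: "sigma UNIV ?H = borel" by (rule borel_eq_atLeastLessThan[symmetric])
    have "sets (\<Pi>\<^sub>M i\<in>A. sigma (UNIV :: real set) ?H) = sets (sigma ?\<Omega> ?P)"
    proof (rule sets_PiM_sigma)
      fix i assume "i \<in> A"
      have "(UNIV :: real set) = (\<Union>n::nat. {- real n..<real n})"
      proof (intro equalityI subsetI)
        fix x :: real
        obtain n where "\<bar>x\<bar> < real n" using reals_Archimedean2 by blast
        then have "x \<in> {- real n..<real n}" by auto
        then show "x \<in> (\<Union>n::nat. {- real n..<real n})" by blast
      qed auto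
      then show "\<exists>S\<subseteq>?H. countable S \<and> (UNIV :: real set) = \<Union>S"
        by (intro exI[of _ "range (\<lambda>n::nat. {- real n..<real n})"]) auto
    qed (use assms(1) in auto)
    also have "?P = ?E"
    proof (intro equalityI subsetI)
      fix X assume "X \<in> ?P"
      then obtain S where S: "X = {f \<in> (\<Pi>\<^sub>E i\<in>A. UNIV). \<forall>i\<in>A. f i \<in> S i}" "\<And>i. i \<in> A \<Longrightarrow> S i \<in> ?H"
        by auto
      then have "\<forall>i\<in>A. \<exists>p q. S i = {p..<q}" by fastforce
      then obtain \<alpha> \<beta> where "\<And>i. i \<in> A \<Longrightarrow> S i = {\<alpha> i..<\<beta> i}" by metis
      then have "Ico_box A \<alpha> \<beta> = Pi\<^sub>E A S" by (intro PiE_cong) simp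
      moreover have "X = Pi\<^sub>E A S" unfolding S(1) set_eq_iff mem_Collect_eq PiE_iff by blast
      ultimately have "X = Ico_box A \<alpha> \<beta>" by simp
      then show "X \<in> ?E" by blast
    next
      fix X assume "X \<in> ?E"
      then obtain \<alpha> \<beta> :: "'s \<Rightarrow> real" where X: "X = Ico_box A \<alpha> \<beta>" by auto
      have "X = {f \<in> (\<Pi>\<^sub>E i\<in>A. UNIV). \<forall>i\<in>A. f i \<in> {\<alpha> i..<\<beta> i}}"
        unfolding X set_eq_iff mem_Collect_eq PiE_iff by blast
      then show "X \<in> ?P"
        by (intro CollectI exI[of _ "\<lambda>i. {\<alpha> i..<\<beta> i}"] exI[of _ A]) auto
    qed
    finally show ?thesis unfolding b
      by (subst (asm) sets_measure_of) (auto cong: sets_PiM_cong)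
  qed
  show ?thesis
  proof (rule measure_eqI_generator_eq[where E = ?E and \<Omega> = ?\<Omega>
        and A = "\<lambda>n::nat. \<Pi>\<^sub>E i\<in>A. {- real n..<real n}"])
    show "Int_stable ?E"
    proof (rule Int_stableI)
      fix X Y assume "X \<in> ?E" "Y \<in> ?E"
      then obtain \<alpha> \<beta> \<alpha>' \<beta>' :: "'s \<Rightarrow> real" where "X = Ico_box A \<alpha> \<beta>" "Y = Ico_box A \<alpha>' \<beta>'" by auto
      then have "X \<inter> Y = (\<Pi>\<^sub>E i\<in>A. {max (\<alpha> i) (\<alpha>' i)..<min (\<beta> i) (\<beta>' i)})" by (simp add: PiE_Int)
      then show "X \<inter> Y \<in> ?E"
        by (intro CollectI exI[of _ "\<lambda>i. max (\<alpha> i) (\<alpha>' i)"] exI[of _ "\<lambda>i. min (\<beta> i) (\<beta>' i)"] conjI TrueI)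
    qed
    show "sets P = sigma_sets ?\<Omega> ?E" "sets Q = sigma_sets ?\<Omega> ?E" using assms gen by auto
    show "?E \<subseteq> Pow ?\<Omega>" by (auto simp: PiE_iff)
    show "range (\<lambda>n::nat. \<Pi>\<^sub>E i\<in>A. {- real n..<real n}) \<subseteq> ?E"
    proof (rule image_subsetI)
      fix n :: nat
      show "(\<Pi>\<^sub>E i\<in>A. {- real n..<real n}) \<in> ?E"
        by (intro CollectI exI[of _ "\<lambda>_. - real n"] exI[of _ "\<lambda>_. real n"] conjI TrueI refl)
    qed
    show "emeasure P (\<Pi>\<^sub>E i\<in>A. {- real n..<real n}) \<noteq> \<infinity>" for n :: nat by (rule fin)
    show "emeasure P X = emeasure Q X" if X: "X \<in> ?E" for X
    proof -
      obtain \<alpha> \<beta> :: "'s \<Rightarrow> real" where X: "X = Ico_box A \<alpha> \<beta>" using X by auto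
      show ?thesis
      proof (cases "\<forall>i\<in>A. \<alpha> i \<le> \<beta> i")
        case True
        then show ?thesis unfolding X by (intro eq) auto
      next
        case False
        then obtain i where "i \<in> A" "{\<alpha> i..<\<beta> i} = {}" by auto
        then have "X = {}" unfolding X by (auto simp: PiE_eq_empty_iff)
        then show ?thesis by simp
      qed
    qed
    show "(\<Union>n::nat. \<Pi>\<^sub>E i\<in>A. {- real n..<real n}) = ?\<Omega>"
    proof (intro equalityI subsetI)
      fix f assume f: "f \<in> ?\<Omega>"
      obtain n where n: "(\<Sum>i\<in>A. \<bar>f i\<bar>) < real n" using reals_Archimedean2 by blast
      have "f i \<in> {- real n..<real n}" if i: "i \<in> A" for i
      proof -
        have "\<bar>f i\<bar> \<le> (\<Sum>i\<in>A. \<bar>f i\<bar>)" using assms(1) i by (intro member_le_sum) auto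
        then show ?thesis using n by auto
      qed
      then have "f \<in> (\<Pi>\<^sub>E i\<in>A. {- real n..<real n})" using f by (auto simp: PiE_iff)
      then show "f \<in> (\<Union>n::nat. \<Pi>\<^sub>E i\<in>A. {- real n..<real n})" by blast
    qed (auto simp: PiE_iff)
  qed
qed



context lattice_simplex
begin

text \<open>The space is tiled by cubes of side \<open>1 / K\<close> with respect to a basis \<open>B\<close> of the dual lattice;
  a cube meeting the box has its corner in the box enlarged by a constant over \<open>K\<close>, and
  conversely. So the volume of the box is squeezed between numbers of lattice points.\<close>

lemma emeasure_box:
  assumes B: "dual_bases B (\<lambda>x. x) e V" "dual_lattice N = int_span B"
    and \<alpha>\<beta>: "\<And>i. i \<in> I \<Longrightarrow> \<alpha> i \<le> \<beta> i"
  shows "emeasure (lborel_PiM B)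
    {y \<in> B \<rightarrow>\<^sub>E UNIV. \<forall>i\<in>I. (\<Sum>x\<in>B. y x *\<^sub>R x) \<bullet> b i \<in> {\<alpha> i..<\<beta> i}} =
    ennreal ((\<Prod>i\<in>I. \<beta> i - \<alpha> i) / real idx)"
proof -
  interpret B: dual_bases B "\<lambda>x. x" e V by (rule B(1))
  let ?L = "lborel_PiM B"
  define \<psi> where "\<psi> = (\<lambda>y. \<Sum>x\<in>B. y x *\<^sub>R x :: 'a)"
  define E where "E = {y \<in> B \<rightarrow>\<^sub>E UNIV. \<forall>i\<in>I. \<psi> y \<bullet> b i \<in> {\<alpha> i..<\<beta> i}}"
  have sp: "space ?L = B \<rightarrow>\<^sub>E UNIV" by (simp add: space_PiM)
  have card_BI: "card B = card I" using B.dim_V dim_V by simp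
  have \<psi>_inner: "\<psi> y \<bullet> b i = (\<Sum>x\<in>B. y x * (x \<bullet> b i))" for y i
    by (simp add: \<psi>_def inner_sum_left)
  have E_meas: "E \<in> sets ?L"
  proof -
    have "E = {y \<in> space ?L. \<forall>i\<in>I. \<psi> y \<bullet> b i \<in> {\<alpha> i..<\<beta> i}}" by (simp add: E_def sp)
    also have "\<dots> \<in> sets ?L" unfolding \<psi>_inner using fin by measurable
    finally show ?thesis .
  qed
  define \<phi> where "\<phi> = (\<lambda>x. \<psi> (\<lambda>j. of_int (x j :: int)))"
  define X where "X = (\<lambda>s K. {x \<in> B \<rightarrow>\<^sub>E (UNIV :: int set). \<phi> x \<in> box_count \<alpha> \<beta> s K})"
  have bij: "bij_betw \<phi> (X s K) (box_count \<alpha> \<beta> s K)" for s K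
    unfolding bij_betw_def
  proof (intro conjI inj_onI equalityI subsetI)
    fix x x' assume x: "x \<in> X s K" "x' \<in> X s K" "\<phi> x = \<phi> x'"
    then have "\<forall>j\<in>B. x j = x' j" unfolding \<phi>_def \<psi>_def B.comb_eq_iff by simp
    then show "x = x'" using x(1,2) unfolding X_def by (auto intro: PiE_ext)
  next
    fix u assume u: "u \<in> box_count \<alpha> \<beta> s K"
    then have "u \<in> int_span ((\<lambda>x. x) ` B)" using B(2) by (simp add: box_count_def)
    then have uV: "u \<in> V" "\<forall>j\<in>B. u \<bullet> e j \<in> \<int>" unfolding B.mem_int_span_iff by auto
    define x where "x = restrict (\<lambda>j. \<lfloor>u \<bullet> e j\<rfloor>) B"
    have "\<phi> x = (\<Sum>j\<in>B. (u \<bullet> e j) *\<^sub>R j)"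
      unfolding \<phi>_def \<psi>_def x_def using uV(2) by (intro sum.cong) auto
    then have "\<phi> x = u" using B.expand_b[OF uV(1)] by simp
    then have "x \<in> X s K" "u = \<phi> x" using u by (auto simp: X_def x_def)
    then show "u \<in> \<phi> ` X s K" by blast
  qed (auto simp: X_def)
  have finX: "finite (X s K)" for s K using bij_betw_finite[OF bij] finite_box_count by simp
  have cardX: "card (X s K) = card (box_count \<alpha> \<beta> s K)" for s K by (rule bij_betw_same_card[OF bij])
  define Q where "Q = (\<lambda>(K::nat) x. \<Pi>\<^sub>E j\<in>B. {of_int (x j) / real K..<(of_int (x j) + 1) / real K})"
  have Q_meas: "Q K x \<in> sets ?L" for K x
    unfolding Q_def using B.fin by (intro sets_PiM_I_finite) auto
  have Q_emeasure: "emeasure ?L (Q K x) = ennreal (1 / real K ^ card I)" if "K > 0" for K x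
  proof -
    have "emeasure ?L (Q K x) = ennreal (\<Prod>j\<in>B. (of_int (x j) + 1) / real K - of_int (x j) / real K)"
      unfolding Q_def using B.fin by (intro emeasure_PiM_Ico) (auto intro: divide_right_mono)
    also have "(\<Prod>j\<in>B. (of_int (x j) + 1) / real K - of_int (x j) / real K) = (\<Prod>j\<in>B. 1 / real K)"
      by (intro prod.cong refl) (simp add: add_divide_distrib)
    finally show ?thesis by (simp add: card_BI power_one_over)
  qed
  have Q_floor: "\<lfloor>real K * y j\<rfloor> = x j" if "y \<in> Q K x" "K > 0" "j \<in> B" for K x y j
  proof -
    have "of_int (x j) / real K \<le> y j" "y j < (of_int (x j) + 1) / real K"
      using that by (auto simp: Q_def PiE_iff)
    then show ?thesis using that(2) by (intro floor_unique) (auto simp: field_simps)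
  qed
  have in_Q: "y \<in> Q K (restrict (\<lambda>j. \<lfloor>real K * y j\<rfloor>) B)" if "y \<in> B \<rightarrow>\<^sub>E UNIV" "K > 0" for K y
  proof -
    have "of_int \<lfloor>real K * y j\<rfloor> / real K \<le> y j" "y j < (of_int \<lfloor>real K * y j\<rfloor> + 1) / real K" for j
      using floor_correct[of "real K * y j"] that(2) by (simp_all add: field_simps)
    then show ?thesis using that(1) by (simp add: Q_def PiE_iff)
  qed
  have disj: "disjoint_family_on (Q K) (X s K)" if "K > 0" for s K
    unfolding disjoint_family_on_def
  proof (intro ballI impI equals0I)
    fix x x' y assume x: "x \<in> X s K" "x' \<in> X s K" "x \<noteq> x'" and "y \<in> Q K x \<inter> Q K x'"
    then have "\<And>j. j \<in> B \<Longrightarrow> x j = x' j" using Q_floor that by (metis IntD1 IntD2)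
    then have "x = x'" using x(1,2) unfolding X_def by (auto intro: PiE_ext)
    then show False using x by simp
  qed
  have union: "emeasure ?L (\<Union>x\<in>X s K. Q K x) = ennreal (real (card (box_count \<alpha> \<beta> s K)) / real K ^ card I)"
    if K: "K > 0" for s K
  proof -
    have "emeasure ?L (\<Union>x\<in>X s K. Q K x) = (\<Sum>x\<in>X s K. emeasure ?L (Q K x))"
      by (rule sum_emeasure[symmetric]) (use Q_meas finX disj[OF K] in auto)
    also have "\<dots> = ennreal (real (card (X s K)) * (1 / real K ^ card I))"
      unfolding sum.cong[OF refl Q_emeasure[OF K]] sum_constant
      by (subst ennreal_mult) (simp_all add: ennreal_of_nat_eq_real_of_nat)
    finally show ?thesis by (simp add: cardX)
  qed
  \<comment> \<open>After scaling by K, a point of a cube differs from its corner by fractional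
    parts in the coordinates with respect to \<open>B\<close>. M bounds the effect of this on the
    pairing with every \<open>b i\<close>, independently of K.\<close>
  define M where "M = (\<Sum>i\<in>I. \<Sum>x\<in>B. \<bar>x \<bullet> b i\<bar>)"
  have close: "real K * (\<psi> y \<bullet> b i) - M \<le> \<phi> x \<bullet> b i"
    "\<phi> x \<bullet> b i \<le> real K * (\<psi> y \<bullet> b i) + M"
    if "y \<in> Q K x" "K > 0" "i \<in> I" for K x y i
  proof -
    have "real K * (\<psi> y \<bullet> b i) - \<phi> x \<bullet> b i = (\<Sum>j\<in>B. frac (real K * y j) * (j \<bullet> b i))"
      unfolding \<phi>_def \<psi>_inner sum_distrib_left sum_subtractf[symmetric]
      using Q_floor[OF that(1,2)] by (intro sum.cong refl) (simp add: frac_def algebra_simps)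
    also have "\<bar>\<dots>\<bar> \<le> (\<Sum>j\<in>B. \<bar>frac (real K * y j) * (j \<bullet> b i)\<bar>)" by (rule sum_abs)
    also have "\<dots> \<le> (\<Sum>j\<in>B. \<bar>j \<bullet> b i\<bar>)"
      by (intro sum_mono) (auto simp: abs_mult intro!: mult_left_le_one_le less_imp_le[OF frac_lt_1])
    also have "\<dots> \<le> M"
      unfolding M_def using fin that(3) by (intro member_le_sum[of i I]) (auto intro: sum_nonneg)
    finally show "real K * (\<psi> y \<bullet> b i) - M \<le> \<phi> x \<bullet> b i"
      "\<phi> x \<bullet> b i \<le> real K * (\<psi> y \<bullet> b i) + M" by linarith+
  qed
  have \<phi>_lattice: "\<phi> x \<in> dual_lattice N" for x
  proof -
    have "\<phi> x \<in> int_span ((\<lambda>x. x) ` B)"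
      unfolding B.mem_int_span_iff \<phi>_def \<psi>_def by (auto simp: B.sum_b_in B.comb_inner_d)
    then show ?thesis using B(2) by simp
  qed
  have upper: "emeasure ?L E \<le> ennreal (real (card (box_count \<alpha> \<beta> M K)) / real K ^ card I)" if K: "K > 0" for K
  proof -
    have "E \<subseteq> (\<Union>x\<in>X M K. Q K x)"
    proof
      fix y assume y: "y \<in> E"
      define x where "x = restrict (\<lambda>j. \<lfloor>real K * y j\<rfloor>) B"
      have yQ: "y \<in> Q K x" using in_Q[OF _ K] y by (auto simp: x_def E_def)
      have "real K * \<alpha> i - M \<le> \<phi> x \<bullet> b i \<and>
          \<phi> x \<bullet> b i < real K * \<beta> i + M" if i: "i \<in> I" for i
      proof -
        have "\<alpha> i \<le> \<psi> y \<bullet> b i" "\<psi> y \<bullet> b i < \<beta> i" using y i by (auto simp: E_def)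
        then have "real K * \<alpha> i \<le> real K * (\<psi> y \<bullet> b i)" "real K * (\<psi> y \<bullet> b i) < real K * \<beta> i"
          using K by auto
        then show ?thesis using close[OF yQ K i] by linarith
      qed
      then have "x \<in> X M K" unfolding X_def box_count_def using \<phi>_lattice by (auto simp: x_def)
      then show "y \<in> (\<Union>x\<in>X M K. Q K x)" using yQ by blast
    qed
    moreover have "(\<Union>x\<in>X M K. Q K x) \<in> sets ?L" using finX Q_meas by blast
    ultimately show ?thesis using union[OF K] emeasure_mono by metis
  qed
  have lower: "ennreal (real (card (box_count \<alpha> \<beta> (- M) K)) / real K ^ card I) \<le> emeasure ?L E" if K: "K > 0" for K
  proof -
    have "(\<Union>x\<in>X (- M) K. Q K x) \<subseteq> E"
    proof
      fix y assume "y \<in> (\<Union>x\<in>X (- M) K. Q K x)"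
      then obtain x where x: "x \<in> X (- M) K" "y \<in> Q K x" by blast
      have "\<psi> y \<bullet> b i \<in> {\<alpha> i..<\<beta> i}" if i: "i \<in> I" for i
      proof -
        have "real K * \<alpha> i + M \<le> \<phi> x \<bullet> b i" "\<phi> x \<bullet> b i < real K * \<beta> i - M"
          using x(1) i by (auto simp: X_def box_count_def)
        then have "real K * \<alpha> i \<le> real K * (\<psi> y \<bullet> b i)" "real K * (\<psi> y \<bullet> b i) < real K * \<beta> i"
          using close[OF x(2) K i] by linarith+
        then show ?thesis using K by auto
      qed
      moreover have "y \<in> B \<rightarrow>\<^sub>E UNIV" using x(2) by (auto simp: Q_def PiE_iff)
      ultimately show "y \<in> E" by (simp add: E_def)
    qed
    then show ?thesis using union[OF K] emeasure_mono[OF _ E_meas] by metis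
  qed
  let ?r = "(\<Prod>i\<in>I. \<beta> i - \<alpha> i) / real idx"
  have lim: "(\<lambda>K. ennreal (real (card (box_count \<alpha> \<beta> s K)) / real K ^ card I)) \<longlonglongrightarrow> ennreal ?r" for s
    by (intro tendsto_ennrealI box_count_asymptotics \<alpha>\<beta>)
  have "emeasure ?L E \<le> ennreal ?r"
    by (rule tendsto_lowerbound[OF lim[of M]])
      (use upper in \<open>auto intro!: eventually_sequentiallyI[of 1]\<close>)
  moreover have "ennreal ?r \<le> emeasure ?L E"
    by (rule tendsto_upperbound[OF lim[of "- M"]])
      (use lower in \<open>auto intro!: eventually_sequentiallyI[of 1]\<close>)
  ultimately show ?thesis unfolding E_def \<psi>_def by (rule antisym)
qed

text \<open>The dual lattice has index \<open>idx\<close> in the lattice spanned by the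
  \<open>d i\<close>, so the unit cube of the \<open>d i\<close> has volume 1 / \<open>idx\<close>.
  Comparing on boxes removes the arbitrary basis chosen in \<open>dual_measure\<close>.\<close>

lemma dual_measure_eq:
  "dual_measure N = distr (density (lborel_PiM I) (\<lambda>_. ennreal (1 / real idx))) borel
     (\<lambda>t. \<Sum>i\<in>I. t i *\<^sub>R d i)"
proof -
  define B where "B = (SOME B. lattice_basis (dual_lattice N) B)"
  have B: "lattice_basis (dual_lattice N) B"
    unfolding B_def using dual_lattice_basis[OF N] by (metis someI_ex)
  obtain e where e: "dual_bases B (\<lambda>x. x) e V"
    using lattice_basis_dual_bases[OF B] span_dual_lattice[OF N] span_N by metis
  have Bs: "dual_lattice N = int_span B" using B by (simp add: lattice_basis_def)
  interpret B: dual_bases B "\<lambda>x. x" e V by (rule e)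
  let ?L = "lborel_PiM B" and ?R = "lborel_PiM I"
  define \<psi> where "\<psi> = (\<lambda>y. \<Sum>x\<in>B. y x *\<^sub>R x :: 'a)"
  define \<tau> where "\<tau> = (\<lambda>y. \<lambda>i\<in>I. \<psi> y \<bullet> b i)"
  have \<psi>_inner: "\<psi> y \<bullet> b i = (\<Sum>x\<in>B. y x * (x \<bullet> b i))" for y i
    by (simp add: \<psi>_def inner_sum_left)
  have \<tau>_meas: "\<tau> \<in> measurable ?L ?R"
    unfolding \<tau>_def \<psi>_inner by measurable
  have "distr ?L ?R \<tau> = density ?R (\<lambda>_. ennreal (1 / real idx))"
  proof (rule measure_eqI_PiM_Ico[OF fin])
    have em: "emeasure (distr ?L ?R \<tau>) (Ico_box I \<alpha> \<beta>) = ennreal ((\<Prod>i\<in>I. \<beta> i - \<alpha> i) / real idx)"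
      if "\<And>i. i \<in> I \<Longrightarrow> \<alpha> i \<le> \<beta> i" for \<alpha> \<beta>
    proof -
      have "emeasure (distr ?L ?R \<tau>) (Ico_box I \<alpha> \<beta>) =
          emeasure ?L (\<tau> -` (Ico_box I \<alpha> \<beta>) \<inter> space ?L)"
        using fin by (intro emeasure_distr[OF \<tau>_meas] sets_PiM_I_finite) auto
      also have "\<tau> -` (Ico_box I \<alpha> \<beta>) \<inter> space ?L =
          {y \<in> B \<rightarrow>\<^sub>E UNIV. \<forall>i\<in>I. (\<Sum>x\<in>B. y x *\<^sub>R x) \<bullet> b i \<in> {\<alpha> i..<\<beta> i}}"
      proof (rule set_eqI)
        fix y
        show "y \<in> \<tau> -` (Ico_box I \<alpha> \<beta>) \<inter> space ?L \<longleftrightarrow>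
            y \<in> {y \<in> B \<rightarrow>\<^sub>E UNIV. \<forall>i\<in>I. (\<Sum>x\<in>B. y x *\<^sub>R x) \<bullet> b i \<in> {\<alpha> i..<\<beta> i}}"
          by (simp add: \<tau>_def \<psi>_def space_PiM PiE_iff) (rule conj_commute)
      qed
      finally show ?thesis using emeasure_box[OF e Bs that] by simp
    qed
    show "emeasure (distr ?L ?R \<tau>) (Ico_box I \<alpha> \<beta>) \<noteq> \<infinity>" for \<alpha> \<beta>
    proof (cases "\<forall>i\<in>I. \<alpha> i \<le> \<beta> i")
      case True
      then show ?thesis using em by simp
    next
      case False
      then have "(Ico_box I \<alpha> \<beta>) = {}" by (force simp: PiE_eq_empty_iff)
      then show ?thesis by simp
    qed
    show "emeasure (distr ?L ?R \<tau>) (Ico_box I \<alpha> \<beta>) =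
        emeasure (density ?R (\<lambda>_. ennreal (1 / real idx))) (Ico_box I \<alpha> \<beta>)"
      if ab: "\<And>i. i \<in> I \<Longrightarrow> \<alpha> i \<le> \<beta> i" for \<alpha> \<beta>
    proof -
      have "emeasure (density ?R (\<lambda>_. ennreal (1 / real idx))) (Ico_box I \<alpha> \<beta>) =
          ennreal (1 / real idx) * ennreal (\<Prod>i\<in>I. \<beta> i - \<alpha> i)"
        using fin ab by (subst emeasure_density_const) (auto simp: emeasure_PiM_Ico intro!: sets_PiM_I_finite)
      also have "\<dots> = ennreal ((\<Prod>i\<in>I. \<beta> i - \<alpha> i) / real idx)"
        using ab by (subst ennreal_mult[symmetric]) (auto intro: prod_nonneg)
      finally show ?thesis using em[OF ab] by simp
    qed
  qed simp_all
  note distr = this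
  have "dual_measure N = distr ?L borel \<psi>"
    unfolding dual_measure_def B_def[symmetric] Let_def \<psi>_def ..
  also have "\<dots> = distr ?L borel ((\<lambda>t. \<Sum>i\<in>I. t i *\<^sub>R d i) \<circ> \<tau>)"
  proof (intro distr_cong refl)
    fix y
    have "\<psi> y \<in> V" unfolding \<psi>_def by (rule B.sum_b_in)
    then show "\<psi> y = ((\<lambda>t. \<Sum>i\<in>I. t i *\<^sub>R d i) \<circ> \<tau>) y"
      by (simp add: \<tau>_def expand_d)
  qed
  also have "\<dots> = distr (distr ?L ?R \<tau>) borel (\<lambda>t. \<Sum>i\<in>I. t i *\<^sub>R d i)"
    by (rule distr_distr[symmetric]) (use \<tau>_meas in auto)
  finally show ?thesis unfolding distr .
qed

lemma dual_measure_integral: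
  fixes F :: "'a \<Rightarrow> 'c::{banach, second_countable_topology}"
  assumes [measurable]: "F \<in> borel_measurable borel"
  shows "integral\<^sup>L (dual_measure N) F =
      (1 / real idx) *\<^sub>R integral\<^sup>L (lborel_PiM I) (\<lambda>t. F (\<Sum>i\<in>I. t i *\<^sub>R d i))"
    and "integrable (dual_measure N) F \<longleftrightarrow> integrable (lborel_PiM I) (\<lambda>t. F (\<Sum>i\<in>I. t i *\<^sub>R d i))"
proof -
  let ?f = "\<lambda>t. F (\<Sum>i\<in>I. t i *\<^sub>R d i)"
  have [measurable]: "?f \<in> borel_measurable (lborel_PiM I)" by measurable
  show "integral\<^sup>L (dual_measure N) F = (1 / real idx) *\<^sub>R integral\<^sup>L (lborel_PiM I) ?f"
    unfolding dual_measure_eq by (simp add: integral_distr integral_density)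
  have "integrable (dual_measure N) F \<longleftrightarrow> integrable (lborel_PiM I) (\<lambda>t. (1 / real idx) *\<^sub>R ?f t)"
    unfolding dual_measure_eq by (simp add: integrable_distr_eq integrable_density)
  also have "\<dots> \<longleftrightarrow> integrable (lborel_PiM I) ?f"
  proof
    assume "integrable (lborel_PiM I) (\<lambda>t. (1 / real idx) *\<^sub>R ?f t)"
    then have "integrable (lborel_PiM I) (\<lambda>t. real idx *\<^sub>R ((1 / real idx) *\<^sub>R ?f t))"
      by (rule integrable_scaleR_right)
    then show "integrable (lborel_PiM I) ?f" using idx_pos by simp
  qed (rule integrable_scaleR_right)
  finally show "integrable (dual_measure N) F \<longleftrightarrow> integrable (lborel_PiM I) ?f" .
qed

end



section \<open>One-dimensional Laplace transforms\<close>

lemma has_bochner_integral_exp_Ici: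
  fixes a c :: real
  assumes "a > 0"
  shows "has_bochner_integral lborel (\<lambda>t. exp (- a * t) * indicator {c..} t) (exp (- a * c) / a)"
proof (rule has_bochner_integral_nn_integral)
  have "(\<integral>\<^sup>+t. ennreal (exp (- a * t)) * indicator {c..} t \<partial>lborel) = ennreal (0 - (- exp (- a * c) / a))"
  proof (rule nn_integral_FTC_atLeast)
    show "((\<lambda>t. - exp (- a * t) / a) has_real_derivative exp (- a * t)) (at t)" for t
      using assms by (auto intro!: derivative_eq_intros)
    have "((\<lambda>t. - exp (- (a * t)) / a) \<longlongrightarrow> - 0 / a) at_top"
      by (intro tendsto_intros filterlim_compose[OF exp_at_bot] filterlim_compose[OF filterlim_uminus_at_bot_at_top]
          filterlim_tendsto_pos_mult_at_top[OF tendsto_const] filterlim_ident) (use assms in auto)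
    then show "((\<lambda>t. - exp (- a * t) / a) \<longlongrightarrow> 0) at_top" by simp
  qed auto
  then show "(\<integral>\<^sup>+t. ennreal (exp (- a * t) * indicator {c..} t) \<partial>lborel) = ennreal (exp (- a * c) / a)"
    by (simp add: ennreal_mult' ennreal_indicator)
qed (use assms in auto)

text \<open>Negative s makes both half-line integrals converge. The value -1 of \<open>side\<close>
  for positive y corrects the sign of s y, so one closed form covers both signs of y.\<close>

lemma side_laplace:
  fixes s y c :: real
  assumes "s < 0" "y \<noteq> 0"
  shows "has_bochner_integral lborel (\<lambda>t. side y (t - c) * exp (s * t * y)) (exp (s * c * y) / (s * y))"
proof (cases "y > 0")
  case True
  then have "has_bochner_integral lborel (\<lambda>t. - (exp (- (- (s * y)) * t) * indicator {c..} t))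
      (- (exp (- (- (s * y)) * c) / (- (s * y))))"
    using assms by (intro has_bochner_integral_minus has_bochner_integral_exp_Ici) (simp add: mult_neg_pos)
  moreover have "(\<lambda>t. - (exp (- (- (s * y)) * t) * indicator {c..} t)) = (\<lambda>t. side y (t - c) * exp (s * t * y))"
    using True by (auto simp: fun_eq_iff side_def indicator_def mult_ac)
  moreover have "- (exp (- (- (s * y)) * c) / (- (s * y))) = exp (s * c * y) / (s * y)"
    by (simp add: mult_ac)
  ultimately show ?thesis by metis
next
  case False
  then have "s * y > 0" using assms by (simp add: mult_neg_neg)
  then have "has_bochner_integral lborel (\<lambda>t. exp (- (s * y) * t) * indicator {- c..} t)
      (exp (- (s * y) * - c) / (s * y))"
    by (rule has_bochner_integral_exp_Ici)
  then have "has_bochner_integral lborel (\<lambda>t. exp (- (s * y) * (0 + -1 * t)) * indicator {- c..} (0 + -1 * t))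
      ((exp (- (s * y) * - c) / (s * y)) /\<^sub>R \<bar>-1\<bar>)"
    by (subst lborel_has_bochner_integral_real_affine_iff[symmetric]) auto
  moreover have "(\<lambda>t. exp (- (s * y) * (0 + -1 * t)) * indicator {- c..} (0 + -1 * t)) =
      (\<lambda>t. side y (t - c) * exp (s * t * y))"
    using False by (auto simp: fun_eq_iff side_def indicator_def mult_ac)
  moreover have "(exp (- (s * y) * - c) / (s * y)) /\<^sub>R \<bar>-1\<bar> = exp (s * c * y) / (s * y)"
    by (simp add: mult_ac)
  ultimately show ?thesis by metis
qed

text \<open>The map h enumerates a half-line of integers in either direction, one for each sign of
  y.\<close>

lemma infsetsum_geometric:
  fixes F :: "int \<Rightarrow> complex" and h :: "nat \<Rightarrow> int"
  assumes "inj h" "\<And>t. t \<notin> range h \<Longrightarrow> F t = 0" "\<And>k. F (h k) = A * r ^ k" "norm r < 1"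
  shows "F abs_summable_on UNIV" "infsetsum F UNIV = A / (1 - r)"
proof -
  have bij: "bij_betw h UNIV (range h)" using assms(1) by (simp add: bij_betw_def)
  have s: "(\<lambda>k. A * r ^ k) abs_summable_on UNIV"
    unfolding abs_summable_on_nat_iff' using assms(4)
    by (simp add: norm_mult norm_power summable_mult summable_geometric)
  have "F abs_summable_on UNIV \<longleftrightarrow> F abs_summable_on range h"
    using assms(2) by (intro abs_summable_on_cong_neutral) auto
  also have "\<dots> \<longleftrightarrow> (\<lambda>k. A * r ^ k) abs_summable_on UNIV"
    unfolding abs_summable_on_reindex_bij_betw[OF bij, symmetric] assms(3) ..
  finally show "F abs_summable_on UNIV" using s by simp
  have "infsetsum F UNIV = infsetsum F (range h)"
    using assms(2) by (intro infsetsum_cong_neutral) auto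
  also have "\<dots> = infsetsum (\<lambda>k. A * r ^ k) UNIV"
    unfolding infsetsum_reindex_bij_betw[OF bij, symmetric] assms(3) ..
  also have "\<dots> = (\<Sum>k. A * r ^ k)" by (rule infsetsum_nat'[OF s])
  also have "\<dots> = A / (1 - r)" using assms(4)
    by (subst suminf_mult) (auto simp: summable_geometric suminf_geometric)
  finally show "infsetsum F UNIV = A / (1 - r)" .
qed

text \<open>As c is an integer and 0 < \<epsilon> < 1, the half-lines are t \<ge> c + 1 for positive
  y and t \<le> c for negative y, whatever \<epsilon> is. With q the value of the exponential at t =
  1, both series have the same form because - q / (1 - q) = 1 / (1 - 1 / q).\<close>

lemma side_lattice_sum:
  fixes s y c a \<epsilon> :: real
  assumes "s < 0" "y \<noteq> 0" "c \<in> \<int>" "0 < \<epsilon>" "\<epsilon> < 1"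
  defines "F \<equiv> \<lambda>t::int. complex_of_real (side y (of_int t - (c + \<epsilon>)) * exp (s * of_int t * y)) *
    cis (- (2 * pi * (a * of_int t)))"
  shows "F abs_summable_on UNIV"
    and "infsetsum F UNIV = cis (- (2 * pi * (a * c))) * of_real (exp (s * c * y)) /
      (1 - cis (2 * pi * a) * exp (- (of_real s * of_real y)))"
proof -
  obtain z where z: "c = of_int z" using assms(3) by (auto elim: Ints_cases)
  define Q where "Q = (\<lambda>t::int. exp (of_int t * Complex (s * y) (- (2 * pi * a))))"
  define q where "q = Q 1"
  have Q_eq: "complex_of_real (exp (s * of_int t * y)) * cis (- (2 * pi * (a * of_int t))) = Q t" for t
  proof -
    have "complex_of_real (exp (s * of_int t * y)) * cis (- (2 * pi * (a * of_int t))) =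
        exp (of_real (s * of_int t * y) + \<i> * of_real (- (2 * pi * (a * of_int t))))"
      unfolding exp_add cis_conv_exp exp_of_real ..
    also have "of_real (s * of_int t * y) + \<i> * of_real (- (2 * pi * (a * of_int t))) =
        of_int t * Complex (s * y) (- (2 * pi * a))"
      by (simp add: complex_eq_iff mult_ac)
    finally show ?thesis by (simp add: Q_def)
  qed
  have Q_add: "Q (t + t') = Q t * Q t'" for t t' by (simp add: Q_def exp_add algebra_simps)
  have Q0: "Q t \<noteq> 0" for t by (simp add: Q_def)
  have Q_nat: "Q (int k) = q ^ k" for k
    by (induction k) (simp add: Q_def, simp add: Q_add q_def)
  have Q_neg: "Q (- t) = inverse (Q t)" for t
    by (simp add: Q_def exp_minus)
  have qn: "norm q = exp (s * y)" by (simp add: q_def Q_def norm_exp_eq_Re)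
  have q_inv: "inverse q = cis (2 * pi * a) * exp (- (of_real s * of_real y))"
    unfolding q_def Q_def exp_minus[symmetric]
    by (simp add: cis_conv_exp complex_eq_iff exp_add[symmetric] Complex_eq algebra_simps)
  have F_eq: "F t = side y (of_int t - (c + \<epsilon>)) * Q t" for t
    unfolding F_def Q_eq[symmetric] by simp
  have Qz: "Q z = cis (- (2 * pi * (a * c))) * of_real (exp (s * c * y))"
    unfolding Q_eq[symmetric] z by simp
  have "F abs_summable_on UNIV \<and> infsetsum F UNIV = Q z / (1 - inverse q)"
  proof (cases "y > 0")
    case True
    have r: "norm q < 1" unfolding qn using True assms by (simp add: mult_neg_pos)
    have ran: "range (\<lambda>k. z + 1 + int k) = {z + 1..}"
    proof (intro equalityI subsetI)
      fix t assume "t \<in> {z + 1..}"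
      then have "t = z + 1 + int (nat (t - z - 1))" by simp
      then show "t \<in> range (\<lambda>k. z + 1 + int k)" by blast
    qed auto
    have 1: "inj (\<lambda>k. z + 1 + int k)" by (rule injI) simp
    have 2: "F t = 0" if "t \<notin> range (\<lambda>k. z + 1 + int k)" for t
    proof -
      have "t \<le> z" using that unfolding ran by simp
      then have "real_of_int t < c + \<epsilon>" using assms(4) z by linarith
      then show ?thesis using True by (simp add: F_eq side_def)
    qed
    have 3: "F (z + 1 + int k) = - (Q z * q) * q ^ k" for k
      using True assms(5) by (simp add: F_eq side_def z Q_add Q_nat q_def)
    have "q \<noteq> 1" using r by auto
    then have "- (Q z * q) / (1 - q) = Q z / (1 - inverse q)"
      using Q0[of 1] by (simp add: q_def field_simps)
    then show ?thesis using infsetsum_geometric[OF 1 2 3 r] by simp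
  next
    case False
    have r: "norm (inverse q) < 1"
      unfolding norm_inverse qn using False assms by (simp add: exp_minus[symmetric] mult_neg_neg)
    have ran: "range (\<lambda>k. z - int k) = {..z}"
    proof (intro equalityI subsetI)
      fix t assume "t \<in> {..z}"
      then have "t = z - int (nat (z - t))" by simp
      then show "t \<in> range (\<lambda>k. z - int k)" by blast
    qed auto
    have 1: "inj (\<lambda>k. z - int k)" by (rule injI) simp
    have 2: "F t = 0" if "t \<notin> range (\<lambda>k. z - int k)" for t
    proof -
      have "z + 1 \<le> t" using that unfolding ran by simp
      then have "real_of_int t > c + \<epsilon>" using assms(5) z by linarith
      then show ?thesis using False by (simp add: F_eq side_def)
    qed
    have 3: "F (z - int k) = Q z * inverse q ^ k" for k
      using False assms(4) Q_add[of z "- int k"]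
      by (simp add: F_eq side_def z Q_neg Q_nat power_inverse)
    show ?thesis using infsetsum_geometric[OF 1 2 3 r] by simp
  qed
  then show "F abs_summable_on UNIV"
    "infsetsum F UNIV = cis (- (2 * pi * (a * c))) * of_real (exp (s * c * y)) /
      (1 - cis (2 * pi * a) * exp (- (of_real s * of_real y)))"
    by (simp_all add: q_inv Qz)
qed

section \<open>Passing to the limit\<close>

text \<open>Where f is nonzero, exp(- g) is at least exp(- M), so f inherits integrability; for the
  parameters 1 / (k + 1) \<le> 1 the constant exp M dominates the exponentials. The measure is left
  general in order to cover lattice sums as well.\<close>

lemma integral_exp_tendsto:
  fixes f g :: "'a \<Rightarrow> real"
  assumes [measurable]: "f \<in> borel_measurable \<mu>" "g \<in> borel_measurable \<mu>"
    and bound: "AE u in \<mu>. f u \<noteq> 0 \<longrightarrow> \<bar>g u\<bar> \<le> M"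
    and int: "integrable \<mu> (\<lambda>u. f u * exp (- 1 * g u))"
  shows "integrable \<mu> f"
    and "(\<lambda>k. \<integral>u. f u * exp (- (1 / real (Suc k)) * g u) \<partial>\<mu>) \<longlonglongrightarrow> (\<integral>u. f u \<partial>\<mu>)"
proof -
  have "integrable \<mu> (\<lambda>u. (f u * exp (- 1 * g u)) * exp M)" using int by simp
  then show f: "integrable \<mu> f"
  proof (rule Bochner_Integration.integrable_bound)
    show "AE u in \<mu>. norm (f u) \<le> norm (f u * exp (- 1 * g u) * exp M)"
      using bound
    proof eventually_elim
      case (elim u)
      show ?case
      proof (cases "f u = 0")
        case False
        then have "\<bar>f u\<bar> * 1 \<le> \<bar>f u\<bar> * (exp (- 1 * g u) * exp M)"
          using elim by (intro mult_left_mono) (auto simp: exp_add[symmetric])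
        then show ?thesis by (simp add: abs_mult mult.assoc)
      qed simp
    qed
  qed measurable
  show "(\<lambda>k. \<integral>u. f u * exp (- (1 / real (Suc k)) * g u) \<partial>\<mu>) \<longlonglongrightarrow> (\<integral>u. f u \<partial>\<mu>)"
  proof (rule integral_dominated_convergence[where w = "\<lambda>u. \<bar>f u\<bar> * exp M"])
    show "integrable \<mu> (\<lambda>u. \<bar>f u\<bar> * exp M)" using f by simp
    show "AE u in \<mu>. (\<lambda>k. f u * exp (- (1 / real (Suc k)) * g u)) \<longlonglongrightarrow> f u"
    proof (rule AE_I2)
      fix u
      have "(\<lambda>k. f u * exp (- (1 / real (Suc k)) * g u)) \<longlonglongrightarrow> f u * exp (- 0 * g u)"
        by (intro tendsto_intros LIMSEQ_Suc[OF lim_1_over_n])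
      then show "(\<lambda>k. f u * exp (- (1 / real (Suc k)) * g u)) \<longlonglongrightarrow> f u" by simp
    qed
    show "AE u in \<mu>. norm (f u * exp (- (1 / real (Suc k)) * g u)) \<le> \<bar>f u\<bar> * exp M" for k
      using bound
    proof eventually_elim
      case (elim u)
      have "- (1 / real (Suc k)) * g u \<le> M" if "\<bar>g u\<bar> \<le> M"
      proof -
        have "- (1 / real (Suc k)) * g u = (1 / real (Suc k)) * (- g u)" by simp
        also have "\<dots> \<le> (1 / real (Suc k)) * \<bar>g u\<bar>" by (intro mult_left_mono) auto
        also have "\<dots> \<le> 1 * \<bar>g u\<bar>" by (intro mult_right_mono) auto
        finally show ?thesis using that by simp
      qed
      then show ?case using elim by (cases "f u = 0") (auto simp: abs_mult)
    qed
  qed measurable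
qed

text \<open>Existence of the limit forces the lower coefficients to vanish: f(X k) tends to 0, hence
  f vanishes at 0, and one factor of the variable can be divided off. A single null sequence of
  nonzero points is enough.\<close>

lemma has_fps_expansion_coeff_limit:
  fixes f :: "'a::{banach, real_normed_field} \<Rightarrow> 'a"
  assumes "f has_fps_expansion F" "X \<longlonglongrightarrow> 0" "\<And>k. X k \<noteq> 0"
    and "(\<lambda>k::nat. f (X k) / X k ^ n) \<longlonglongrightarrow> L"
  shows "fps_nth F n = L"
  using assms(1,4)
proof (induction n arbitrary: f F)
  case 0
  have "isCont f 0" using has_fps_expansion_imp_continuous[OF 0(1)] by simp
  then have "(\<lambda>k. f (X k)) \<longlonglongrightarrow> f 0" using assms(2) isCont_tendsto_compose by blast
  moreover have "(\<lambda>k. f (X k)) \<longlonglongrightarrow> L" using 0(2) by simp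
  ultimately have "f 0 = L" by (rule LIMSEQ_unique)
  then show ?case using 0(1) by (auto simp: has_fps_expansion_def eval_fps_at_0 dest: eventually_nhds_x_imp_x)
next
  case (Suc n)
  have "isCont f 0" using has_fps_expansion_imp_continuous[OF Suc(2)] by simp
  then have "(\<lambda>k. f (X k)) \<longlonglongrightarrow> f 0" using assms(2) isCont_tendsto_compose by blast
  moreover have "(\<lambda>k. f (X k) / X k ^ Suc n * X k ^ Suc n) \<longlonglongrightarrow> L * 0 ^ Suc n"
    by (intro tendsto_mult Suc(3) tendsto_power assms(2))
  then have "(\<lambda>k. f (X k)) \<longlonglongrightarrow> 0" using assms(3) by simp
  ultimately have "f 0 = 0" by (rule LIMSEQ_unique)
  then have F0: "fps_nth F 0 = 0"
    using Suc(2) by (auto simp: has_fps_expansion_def eval_fps_at_0 dest: eventually_nhds_x_imp_x)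
  show ?case
  \<comment> \<open>The zero series has subdegree 0 by convention, so dividing by the variable needs
    the other case.\<close>
  proof (cases "F = 0")
    case True
    have "\<forall>\<^sub>F x in nhds 0. eval_fps F x = f x" using Suc(2) by (simp add: has_fps_expansion_def)
    then have "\<forall>\<^sub>F x in nhds 0. f x = 0" by eventually_elim (use True in simp)
    then have "\<forall>\<^sub>F k in sequentially. f (X k) = 0" using assms(2) by (rule eventually_compose_filterlim)
    then have "\<forall>\<^sub>F k in sequentially. f (X k) / X k ^ Suc n = 0" by eventually_elim simp
    then have "(\<lambda>k. f (X k) / X k ^ Suc n) \<longlonglongrightarrow> 0" by (rule tendsto_eventually)
    then show ?thesis using Suc(3) True LIMSEQ_unique by auto
  next
    case False
    then have "1 \<le> subdegree F" using F0 by (simp add: Suc_le_eq subdegree_eq_0_iff neq0_conv[symmetric])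
    then have "(\<lambda>x. if x = 0 then fps_nth F 1 else f x / x ^ 1) has_fps_expansion fps_shift 1 F"
      by (intro has_fps_expansion_shift Suc(2)) auto
    moreover have "(\<lambda>k. (if X k = 0 then fps_nth F 1 else f (X k) / X k ^ 1) / X k ^ n) \<longlonglongrightarrow> L"
      using Suc(3) assms(3) by (simp add: field_simps)
    ultimately have "fps_nth (fps_shift 1 F) n = L" by (rule Suc(1))
    then show ?thesis by simp
  qed
qed



section \<open>Volume and number of lattice points as power series coefficients\<close>

lemma AE_PiM_lborel_neq:
  fixes c :: real
  assumes "finite A" "i \<in> A"
  shows "AE t in (lborel_PiM A). t i \<noteq> c"
proof -
  interpret product_sigma_finite "\<lambda>_. lborel :: real measure" by standard
  let ?Z = "\<Pi>\<^sub>E j\<in>A. if j = i then {c} else UNIV"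
  have "emeasure (lborel_PiM A) ?Z = (\<Prod>j\<in>A. emeasure lborel (if j = i then {c} else UNIV))"
    using assms(1) by (intro emeasure_PiM) auto
  also have "\<dots> = 0" using assms by (intro prod_zero) (auto intro!: bexI[of _ i])
  finally have Z: "emeasure (lborel_PiM A) ?Z = 0" .
  show ?thesis
  proof (rule AE_I[OF _ Z])
    show "{t \<in> space (lborel_PiM A). \<not> t i \<noteq> c} \<subseteq> ?Z"
      by (rule subsetI) (simp add: space_PiM PiE_iff)
    show "?Z \<in> sets (lborel_PiM A)" using assms(1) by (intro sets_PiM_I_finite) auto
  qed
qed

lemma (in lattice_simplex) AE_dual_measure_iff:
  assumes "{u. P u} \<in> sets borel"
  shows "(AE u in dual_measure N. P u) \<longleftrightarrow> (AE t in (lborel_PiM I). P (\<Sum>i\<in>I. t i *\<^sub>R d i))"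
proof -
  have m: "(\<lambda>t. \<Sum>i\<in>I. t i *\<^sub>R d i) \<in> measurable (density (lborel_PiM I) (\<lambda>_. ennreal (1 / real idx))) borel"
    by measurable
  show ?thesis
    unfolding dual_measure_eq using assms idx_pos
    by (subst AE_distr_iff[OF m]) (auto simp: AE_density)
qed

lemma (in lattice_simplex) sets_dual_measure: "sets (dual_measure N) = sets borel"
  unfolding dual_measure_eq by simp

text \<open>The Todd series with y times the variable substituted. Defined by coefficients it makes
  sense at y = 0 too, the value taken at the rays outside a maximal cone.\<close>

definition scaled_todd :: "complex \<Rightarrow> complex \<Rightarrow> complex fps" where
  "scaled_todd \<rho> y = Abs_fps (\<lambda>k. y ^ k * fps_nth (todd_series \<rho>) k)"

text \<open>The denominator vanishes at 0 only for \<rho> = 1, and then to first order since y is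
  nonzero. Hence it divides the variable.\<close>

lemma todd_denominator:
  fixes \<rho> y :: complex
  assumes "y \<noteq> 0"
  shows "1 - fps_const \<rho> * fps_exp (- y) \<noteq> 0" "subdegree (1 - fps_const \<rho> * fps_exp (- y)) \<le> 1"
proof -
  let ?D = "1 - fps_const \<rho> * fps_exp (- y)"
  obtain k where k: "k \<le> 1" "fps_nth ?D k \<noteq> 0"
  proof (cases "\<rho> = 1")
    case True
    then show thesis using that[of 1] assms by simp
  next
    case False
    then show thesis using that[of 0] by simp
  qed
  then show "?D \<noteq> 0" by (metis fps_zero_nth)
  show "subdegree ?D \<le> 1" using subdegree_leI[OF k(2)] k(1) by simp
qed

lemma todd_series_mult: "todd_series \<rho> * (1 - fps_const \<rho> * fps_exp (- 1)) = fps_X"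
proof -
  have "1 - fps_const \<rho> * fps_exp (- 1) dvd fps_X"
    using todd_denominator[of 1 \<rho>] by (subst fps_dvd_iff) auto
  then show ?thesis unfolding todd_series_def by (rule dvd_div_mult_self)
qed

text \<open>The constant coefficient is all that remains at y = 0. It tests \<rho> = 1 and thereby
  makes the group elements outside G_I contribute nothing at I.\<close>

lemma todd_series_0: "fps_nth (todd_series \<rho>) 0 = (if \<rho> = 1 then 1 else 0)"
proof (cases "\<rho> = 1")
  case True
  let ?D = "1 - fps_const \<rho> * fps_exp (- 1) :: complex fps"
  have D: "fps_nth ?D 0 = 0" "fps_nth ?D 1 = 1" using True by simp_all
  have "todd_series \<rho> * ?D = fps_X"
    by (rule todd_series_mult)
  then have "fps_nth (todd_series \<rho> * ?D) 1 = 1" by simp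
  then have "fps_nth (todd_series \<rho>) 0 * fps_nth ?D 1 + fps_nth (todd_series \<rho>) 1 * fps_nth ?D 0 = 1"
    by (simp add: fps_mult_nth)
  then show ?thesis using D True by simp
next
  case False
  have "fps_nth (1 - fps_const \<rho> * fps_exp (- 1)) 0 \<noteq> 0" using False by simp
  then show ?thesis using False unfolding todd_series_def
    by (subst fps_divide_unit) auto
qed

lemma scaled_todd_mult:
  assumes "y \<noteq> 0"
  shows "scaled_todd \<rho> y * (1 - fps_const \<rho> * fps_exp (- y)) = fps_const y * fps_X"
proof -
  let ?D = "1 - fps_const \<rho> * fps_exp (- 1) :: complex fps"
  have T: "todd_series \<rho> * ?D = fps_X"
    by (rule todd_series_mult)
  let ?L = "fps_const y * fps_X :: complex fps"
  have comp: "fps_compose F ?L = Abs_fps (\<lambda>k. y ^ k * fps_nth F k)" for F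
    by (rule fps_compose_linear)
  have "scaled_todd \<rho> y = fps_compose (todd_series \<rho>) ?L" unfolding scaled_todd_def comp ..
  moreover have "1 - fps_const \<rho> * fps_exp (- y) = fps_compose ?D ?L"
    unfolding comp by (rule fps_ext) (simp add: fps_one_def power_mult_distrib[symmetric])
  moreover have "fps_compose (todd_series \<rho>) ?L * fps_compose ?D ?L = fps_compose fps_X ?L"
    using fps_compose_mult_distrib[of ?L "todd_series \<rho>" ?D] unfolding T by simp
  moreover have "fps_compose fps_X ?L = ?L"
    unfolding comp by (rule fps_ext) (simp add: fps_X_def)
  ultimately show ?thesis by (simp only:)
qed

text \<open>The function is evaluated only at nonzero points; its value at 0 is left to the
  expansion, which demands the removable one.\<close>

lemma scaled_todd_expansion:
  assumes "y \<noteq> 0"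
  shows "\<exists>f. f has_fps_expansion scaled_todd \<rho> y \<and>
    (\<forall>s. s \<noteq> 0 \<longrightarrow> f s = s * y / (1 - \<rho> * exp (- (s * y))))"
proof -
  let ?D = "1 - fps_const \<rho> * fps_exp (- y) :: complex fps"
  let ?L = "fps_const y * fps_X :: complex fps"
  note D = todd_denominator[OF assms, of \<rho>]
  have L: "subdegree ?L = 1" using assms by (intro subdegreeI) auto
  have "scaled_todd \<rho> y = ?L / ?D"
    using scaled_todd_mult[OF assms, of \<rho>] D(1) by (metis nonzero_mult_div_cancel_right)
  moreover have "(\<lambda>s. if s = 0 then fps_nth ?L (subdegree ?D) / fps_nth ?D (subdegree ?D)
      else (y * s) / (1 - \<rho> * exp (- y * s))) has_fps_expansion ?L / ?D"
    by (intro has_fps_expansion_divide fps_expansion_intros) (use D L in auto)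
  ultimately show ?thesis by (intro exI conjI) (auto simp: mult.commute)
qed

lemma fps_nth_eq_limit:
  fixes f :: "'b \<Rightarrow> 'b::{banach, real_normed_field}"
  assumes "f has_fps_expansion F"
    and "\<And>k. of_real (g k) = f (of_real (- (1 / real (Suc k)))) / of_real (- (1 / real (Suc k))) ^ n"
    and "g \<longlonglongrightarrow> L"
  shows "fps_nth F n = of_real L"
proof (rule has_fps_expansion_coeff_limit[OF assms(1)])
  let ?X = "\<lambda>k. - (1 / real (Suc k))"
  have "(\<lambda>k. of_real (?X k) :: 'b) \<longlonglongrightarrow> of_real (- 0)"
    by (intro tendsto_of_real tendsto_minus LIMSEQ_Suc[OF lim_1_over_n])
  then show "(\<lambda>k. of_real (?X k) :: 'b) \<longlonglongrightarrow> 0" by simp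
  show "of_real (?X k) \<noteq> (0 :: 'b)" for k by (simp only: of_real_eq_0_iff) simp
  show "(\<lambda>k. f (of_real (?X k)) / of_real (?X k) ^ n) \<longlonglongrightarrow> of_real L"
    unfolding assms(2)[symmetric] by (intro tendsto_of_real assms(3))
qed

context complete_simple_fan
begin

abbreviation "grp I \<equiv> lattice_simplex.reps (verts I) \<nu> N"

lemma top_simplex:
  assumes "I \<in> tops"
  shows "lattice_simplex (verts I) \<nu> (\<delta> I) (span N) N"
proof -
  interpret dual_bases "verts I" \<nu> "\<delta> I" "span N" by (rule top_dual_bases[OF assms])
  show ?thesis using N ray_vec_props(1) verts_in(1) by unfold_locales auto
qed

lemma tops_nonempty: "tops \<noteq> {}"
  using compl by (auto simp: complete_fan_def pre_complete_def)

text \<open>The factor shared by both transforms at the vertex of I. Splitting off the coordinates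
  of v leaves, in the lattice count, quotients of Todd type that are regular at 0.\<close>

definition kap :: "'a \<Rightarrow> 's \<Rightarrow> real" where
  "kap v I = of_int (weight \<Delta> I) / (real (card (grp I)) * (\<Prod>i\<in>verts I. coord v I i))"

abbreviation geom :: "'a \<Rightarrow> real \<Rightarrow> 's \<Rightarrow> ('s \<Rightarrow> real) \<Rightarrow> complex" where
  "geom v s I a \<equiv>
    \<Prod>i\<in>verts I. 1 / (1 - cis (2 * pi * a i) * exp (- (of_real s * of_real (coord v I i))))"

abbreviation todd_term :: "'a \<Rightarrow> ('s \<Rightarrow> real) \<Rightarrow> 's \<Rightarrow> ('s \<Rightarrow> real) \<Rightarrow> complex fps" where
  "todd_term v c I a \<equiv> fps_exp (of_real (lam v c I)) *
    (\<Prod>i\<in>verts I. scaled_todd (cis (2 * pi * a i)) (of_real (coord v I i)))"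

lemma prod_exp_lam:
  "(\<Prod>i\<in>verts I. exp (s * c i * (coord v I i))) = exp (s * lam v c I)"
  unfolding lam_def exp_sum[OF finite_verts, symmetric] by (simp add: sum_distrib_left mult.assoc)

text \<open>Each maximal cone expands v in its own rays, so the exponential is split differently in
  every summand, always into factors matching those of \<open>dhc\<close>.\<close>

lemma dhc_exp:
  assumes "v \<in> span N"
  shows "dhc v c u * exp (s * (u \<bullet> v)) = (\<Sum>I\<in>tops. of_int (weight \<Delta> I) *
    (\<Prod>i\<in>verts I. side (coord v I i) (u \<bullet> \<nu> i - c i) * exp (s * (u \<bullet> \<nu> i) * (coord v I i))))"
proof -
  have "exp (s * (u \<bullet> v)) = (\<Prod>i\<in>verts I. exp (s * (u \<bullet> \<nu> i) * (coord v I i)))" if "I \<in> tops" for I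
  proof -
    interpret dual_bases "verts I" \<nu> "\<delta> I" "span N" by (rule top_dual_bases[OF that])
    have "u \<bullet> v = u \<bullet> (\<Sum>i\<in>verts I. (coord v I i) *\<^sub>R \<nu> i)" using expand_b[OF assms] by simp
    also have "\<dots> = (\<Sum>i\<in>verts I. (u \<bullet> \<nu> i) * (coord v I i))"
      by (simp add: inner_sum_right mult.commute)
    finally show ?thesis by (simp add: exp_sum[OF finite_verts, symmetric] sum_distrib_left mult.assoc)
  qed
  then show ?thesis unfolding dhc_def sum_distrib_right
    by (intro sum.cong refl) (simp add: prod.distrib)
qed

lemma measurable_dhc [measurable]: "dhc v c \<in> borel_measurable borel"
  unfolding dhc_def side_def by measurable

lemma dhc_transform:
  assumes v: "generic_vec \<Delta> v" and s: "s < 0"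
  shows "integrable (dual_measure N) (\<lambda>u. dhc v c u * exp (s * (u \<bullet> v)))"
    and "(\<integral>u. dhc v c u * exp (s * (u \<bullet> v)) \<partial>dual_measure N) =
      (\<Sum>I\<in>tops. kap v I * exp (s * lam v c I)) / s ^ rank \<Delta>"
proof -
  let ?f = "\<lambda>I i t. side (coord v I i) (t - c i) * exp (s * t * (coord v I i))"
  let ?F = "\<lambda>I u. \<Prod>i\<in>verts I. ?f I i (u \<bullet> \<nu> i)"
  have F: "integrable (dual_measure N) (?F I) \<and>
      of_int (weight \<Delta> I) * integral\<^sup>L (dual_measure N) (?F I) = kap v I * exp (s * lam v c I) / s ^ rank \<Delta>"
    if I: "I \<in> tops" for I
  proof -
    interpret lattice_simplex "verts I" \<nu> "\<delta> I" "span N" N by (rule top_simplex[OF I])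
    interpret product_sigma_finite "\<lambda>_. lborel :: real measure" by standard
    have [measurable]: "?F I \<in> borel_measurable borel" unfolding side_def by measurable
    have eq: "?F I (\<Sum>i\<in>verts I. t i *\<^sub>R \<delta> I i) = (\<Prod>i\<in>verts I. ?f I i (t i))" for t
      by (intro prod.cong refl) (simp add: comb_inner_b)
    have hb: "has_bochner_integral lborel (?f I i)
        (exp (s * c i * (coord v I i)) / (s * (coord v I i)))" if "i \<in> verts I" for i
      by (rule side_laplace[OF s generic_coord[OF v I that]])
    have int1: "integrable lborel (?f I i)" if "i \<in> verts I" for i using hb[OF that] by (rule integrable.intros)
    have int: "integrable (dual_measure N) (?F I)"
      unfolding dual_measure_integral(2)[OF \<open>?F I \<in> _\<close>] eq
      by (rule product_integrable_prod[OF fin int1])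
    have "integral\<^sup>L (dual_measure N) (?F I) = (1 / real idx) * (\<Prod>i\<in>verts I. integral\<^sup>L lborel (?f I i))"
      unfolding dual_measure_integral(1)[OF \<open>?F I \<in> _\<close>] eq
      by (subst product_integral_prod[OF fin int1]) auto
    also have "(\<Prod>i\<in>verts I. integral\<^sup>L lborel (?f I i)) =
        (\<Prod>i\<in>verts I. exp (s * c i * (coord v I i)) / (s * (coord v I i)))"
      using hb by (intro prod.cong refl has_bochner_integral_integral_eq)
    also have "\<dots> = exp (s * lam v c I) / (s ^ rank \<Delta> * (\<Prod>i\<in>verts I. coord v I i))"
      unfolding prod_dividef prod_exp_lam prod.distrib prod_constant card_verts_top[OF I] ..
    finally show ?thesis using int unfolding kap_def by simp
  qed
  then have int: "integrable (dual_measure N) (\<lambda>u. of_int (weight \<Delta> I) * ?F I u)" if "I \<in> tops" for I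
    using that by simp
  show "integrable (dual_measure N) (\<lambda>u. dhc v c u * exp (s * (u \<bullet> v)))"
    unfolding dhc_exp[OF generic_in_span[OF v]] by (rule Bochner_Integration.integrable_sum[OF int])
  have "(\<integral>u. dhc v c u * exp (s * (u \<bullet> v)) \<partial>dual_measure N) =
      (\<Sum>I\<in>tops. \<integral>u. of_int (weight \<Delta> I) * ?F I u \<partial>dual_measure N)"
    unfolding dhc_exp[OF generic_in_span[OF v]] by (rule Bochner_Integration.integral_sum[OF int])
  also have "\<dots> = (\<Sum>I\<in>tops. kap v I * exp (s * lam v c I) / s ^ rank \<Delta>)"
    using F by (intro sum.cong refl) simp
  finally show "(\<integral>u. dhc v c u * exp (s * (u \<bullet> v)) \<partial>dual_measure N) =
      (\<Sum>I\<in>tops. kap v I * exp (s * lam v c I)) / s ^ rank \<Delta>"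
    by (simp add: sum_divide_distrib)
qed

text \<open>\<open>dual_measure\<close> is a measure on the ambient space but is carried by the span
  of N. Together with the hyperplanes being null sets this makes \<open>dhc_slab\<close> available
  almost everywhere.\<close>

lemma AE_generic_point:
  "AE u in dual_measure N. u \<in> span N \<and> (\<forall>I\<in>tops. \<forall>i\<in>verts I. u \<bullet> \<nu> i \<noteq> c i)"
proof -
  have "AE u in dual_measure N. u \<bullet> \<nu> i \<noteq> c i" if I: "I \<in> tops" "i \<in> verts I" for I i
  proof -
    interpret lattice_simplex "verts I" \<nu> "\<delta> I" "span N" N by (rule top_simplex[OF I(1)])
    have "(AE u in dual_measure N. u \<bullet> \<nu> i \<noteq> c i) \<longleftrightarrow>
        (AE t in (lborel_PiM (verts I)). (\<Sum>i\<in>verts I. t i *\<^sub>R \<delta> I i) \<bullet> \<nu> i \<noteq> c i)"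
      by (rule AE_dual_measure_iff) measurable
    also have "\<dots>" using AE_PiM_lborel_neq[OF fin I(2), of "c i"] by (simp add: comb_inner_b[OF I(2)])
    finally show ?thesis .
  qed
  then have 1: "AE u in dual_measure N. \<forall>I\<in>tops. \<forall>i\<in>verts I. u \<bullet> \<nu> i \<noteq> c i"
    by (intro AE_ball_countable[THEN iffD2] ballI) (auto intro: countable_finite finite_tops finite_verts)
  obtain I where I: "I \<in> tops" using tops_nonempty by auto
  interpret lattice_simplex "verts I" \<nu> "\<delta> I" "span N" N by (rule top_simplex[OF I])
  have "AE u in dual_measure N. u \<in> span N"
    by (subst AE_dual_measure_iff) (auto simp: sum_d_in intro: borel_closed closed_subspace)
  with 1 show ?thesis by eventually_elim auto
qed

lemma sets_dual_measure_N: "sets (dual_measure N) = sets borel"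
  using tops_nonempty lattice_simplex.sets_dual_measure[OF top_simplex] by auto

lemma integral_dhc:
  assumes v: "generic_vec \<Delta> v"
  shows "(\<integral>u. dhc v c u \<partial>dual_measure N) = (\<Sum>I\<in>tops. kap v I * lam v c I ^ rank \<Delta> / fact (rank \<Delta>))"
proof -
  note [measurable_cong] = sets_dual_measure_N
  have bound: "AE u in dual_measure N. dhc v c u \<noteq> 0 \<longrightarrow> \<bar>u \<bullet> v\<bar> \<le> (\<Sum>I\<in>tops. \<bar>lam v c I\<bar>)"
    using AE_generic_point[of c] by eventually_elim (use dhc_slab[OF v] in blast)
  have lim: "(\<lambda>k. \<integral>u. dhc v c u * exp (- (1 / real (Suc k)) * (u \<bullet> v)) \<partial>dual_measure N)
      \<longlonglongrightarrow> (\<integral>u. dhc v c u \<partial>dual_measure N)"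
    by (rule integral_exp_tendsto[OF _ _ bound]) (use dhc_transform(1)[OF v, of "-1"] in auto)
  have "(\<lambda>s. \<Sum>I\<in>tops. kap v I * exp (lam v c I * s)) has_fps_expansion
      (\<Sum>I\<in>tops. fps_const (kap v I) * fps_exp (lam v c I))"
    by (intro fps_expansion_intros)
  then have "fps_nth (\<Sum>I\<in>tops. fps_const (kap v I) * fps_exp (lam v c I)) (rank \<Delta>) =
      of_real (\<integral>u. dhc v c u \<partial>dual_measure N)"
    by (rule fps_nth_eq_limit[OF _ _ lim])
      (subst dhc_transform(2)[OF v], simp, simp add: mult.commute)
  then show ?thesis by (simp add: fps_sum_nth)
qed

text \<open>That the vertices lie in the dual lattice is used twice: the \<open>c i\<close> are
  integers, so \<open>side_lattice_sum\<close> applies and \<epsilon> drops out; and the characters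
  of the group are trivial on the vertex, so the factors
  \<open>cis (- (2 * pi * (a i * c i)))\<close> multiply to 1.\<close>

lemma lattice_transform:
  assumes v: "generic_vec \<Delta> v" and s: "s < 0" and \<epsilon>: "0 < \<epsilon>" "\<epsilon> < 1"
    and c: "\<And>I. I \<in> tops \<Longrightarrow> (\<Sum>i\<in>verts I. c i *\<^sub>R \<delta> I i) \<in> dual_lattice N"
  defines "F \<equiv> \<lambda>u. complex_of_real (dhc v (\<lambda>i. c i + \<epsilon>) u * exp (s * (u \<bullet> v)))"
  shows "F abs_summable_on dual_lattice N"
    and "infsetsum F (dual_lattice N) = (\<Sum>I\<in>tops. of_int (weight \<Delta> I) / of_nat (card (grp I)) *
      (\<Sum>a\<in>grp I. of_real (exp (s * lam v c I)) *
        geom v s I a))"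
proof -
  let ?y = "\<lambda>I i. coord v I i"
  let ?f = "\<lambda>I i t::int. complex_of_real (side (?y I i) (of_int t - (c i + \<epsilon>)) * exp (s * of_int t * ?y I i))"
  let ?F = "\<lambda>I u. \<Prod>i\<in>verts I. ?f I i \<lfloor>u \<bullet> \<nu> i\<rfloor>"
  have F_eq: "F u = (\<Sum>I\<in>tops. of_int (weight \<Delta> I) * ?F I u)" if u: "u \<in> dual_lattice N" for u
  proof -
    have "?F I u = of_real (\<Prod>i\<in>verts I. side (?y I i) (u \<bullet> \<nu> i - (c i + \<epsilon>)) * exp (s * (u \<bullet> \<nu> i) * ?y I i))"
      if I: "I \<in> tops" for I
    proof -
      interpret lattice_simplex "verts I" \<nu> "\<delta> I" "span N" N by (rule top_simplex[OF I])
      show ?thesis unfolding of_real_prod using dual_lattice_inner[OF u] by (intro prod.cong refl) simp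
    qed
    then show ?thesis unfolding F_def dhc_exp[OF generic_in_span[OF v]] by simp
  qed
  have FI: "?F I abs_summable_on dual_lattice N \<and> infsetsum (?F I) (dual_lattice N) =
      (\<Sum>a\<in>grp I. of_real (exp (s * lam v c I)) *
        geom v s I a) / of_nat (card (grp I))"
    if I: "I \<in> tops" for I
  proof -
    interpret lattice_simplex "verts I" \<nu> "\<delta> I" "span N" N by (rule top_simplex[OF I])
    have ci: "c i \<in> \<int>" if "i \<in> verts I" for i
      using dual_lattice_inner[OF c[OF I] that] comb_inner_b[OF that] by simp
    have sum1: "?f I i abs_summable_on UNIV" if "i \<in> verts I" for i
      using side_lattice_sum(1)[OF s generic_coord[OF v I that] ci[OF that] \<epsilon>, of 0] by simp
    have chi1: "(\<Prod>i\<in>verts I. cis (- (2 * pi * (a i * c i)))) = 1" if a: "a \<in> grp I" for a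
    proof -
      have "(\<Sum>i\<in>verts I. a i *\<^sub>R \<nu> i) \<bullet> (\<Sum>i\<in>verts I. c i *\<^sub>R \<delta> I i) \<in> \<int>"
        using a c[OF I] by (auto simp: dual_lattice_def reps_def inner_commute)
      then have "- (\<Sum>i\<in>verts I. a i * c i) \<in> \<int>" by (simp add: inner_comb)
      then have "cis (2 * pi * (- (\<Sum>i\<in>verts I. a i * c i))) = 1" unfolding cis_2pi_eq_1_iff .
      then show ?thesis unfolding prod_cis by (simp add: sum_negf sum_distrib_left)
    qed
    have "infsetsum (?F I) (dual_lattice N) =
        (\<Sum>a\<in>reps. \<Prod>i\<in>verts I. infsetsum (\<lambda>t. ?f I i t * cis (- (2 * pi * (a i * of_int t)))) UNIV) / of_nat idx"
      by (rule lattice_sum_prod(2)[OF sum1])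
    also have "(\<Sum>a\<in>reps. \<Prod>i\<in>verts I. infsetsum (\<lambda>t. ?f I i t * cis (- (2 * pi * (a i * of_int t)))) UNIV) =
      (\<Sum>a\<in>reps. \<Prod>i\<in>verts I. cis (- (2 * pi * (a i * c i))) * of_real (exp (s * c i * ?y I i)) *
        (1 / (1 - cis (2 * pi * a i) * exp (- (of_real s * of_real (?y I i))))))"
      using side_lattice_sum(2)[OF s generic_coord[OF v I] ci \<epsilon>] by (intro sum.cong prod.cong refl) simp
    also have "\<dots> = (\<Sum>a\<in>grp I. of_real (exp (s * lam v c I)) *
        geom v s I a)"
      unfolding prod.distrib of_real_prod[symmetric] prod_exp_lam
      by (intro sum.cong refl) (simp only: chi1 mult_1)
    finally show ?thesis using lattice_sum_prod(1)[OF sum1] by simp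
  qed
  have s': "(\<lambda>u. of_int (weight \<Delta> I) * ?F I u) abs_summable_on dual_lattice N" if "I \<in> tops" for I
    using FI[OF that] by (intro abs_summable_on_cmult_right) blast
  have "(\<lambda>u. \<Sum>I\<in>tops. of_int (weight \<Delta> I) * ?F I u) abs_summable_on dual_lattice N"
    by (rule abs_summable_sum[OF s'])
  then show "F abs_summable_on dual_lattice N"
    using F_eq by (subst abs_summable_on_cong[OF F_eq refl])
  have "infsetsum F (dual_lattice N) = infsetsum (\<lambda>u. \<Sum>I\<in>tops. of_int (weight \<Delta> I) * ?F I u) (dual_lattice N)"
    by (rule infsetsum_cong[OF F_eq refl])
  also have "\<dots> = (\<Sum>I\<in>tops. infsetsum (\<lambda>u. of_int (weight \<Delta> I) * ?F I u) (dual_lattice N))"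
    by (rule sum_infsetsum[OF s', symmetric])
  also have "\<dots> = (\<Sum>I\<in>tops. of_int (weight \<Delta> I) * infsetsum (?F I) (dual_lattice N))"
    using FI by (intro sum.cong refl infsetsum_cmult_right) blast
  finally show "infsetsum F (dual_lattice N) = (\<Sum>I\<in>tops. of_int (weight \<Delta> I) / of_nat (card (grp I)) *
      (\<Sum>a\<in>grp I. of_real (exp (s * lam v c I)) *
        geom v s I a))"
    using FI by simp
qed

text \<open>The sum is an integral over the counting measure, so the limit lemma for the volume
  applies again. No exceptional set arises here: with integral \<open>c i\<close> and \<epsilon>
  strictly between 0 and 1, no lattice point lies on a shifted hyperplane.\<close>

lemma lattice_count_dhc:
  assumes v: "generic_vec \<Delta> v" and \<epsilon>: "0 < \<epsilon>" "\<epsilon> < 1"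
    and c: "\<And>I. I \<in> tops \<Longrightarrow> (\<Sum>i\<in>verts I. c i *\<^sub>R \<delta> I i) \<in> dual_lattice N"
  shows "dhc v (\<lambda>i. c i + \<epsilon>) abs_summable_on dual_lattice N"
    and "of_real (infsetsum (dhc v (\<lambda>i. c i + \<epsilon>)) (dual_lattice N)) =
      (\<Sum>I\<in>tops. of_real (kap v I) * (\<Sum>a\<in>grp I. fps_nth (todd_term v c I a) (rank \<Delta>)))"
proof -
  let ?y = "\<lambda>I i. coord v I i"
  let ?c = "\<lambda>i. c i + \<epsilon>"
  let ?\<mu> = "count_space (dual_lattice N)"
  have off: "u \<bullet> \<nu> i \<noteq> ?c i" if "u \<in> dual_lattice N" "I \<in> tops" "i \<in> verts I" for u I i
  proof -
    interpret lattice_simplex "verts I" \<nu> "\<delta> I" "span N" N by (rule top_simplex[OF that(2)])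
    have "c i \<in> \<int>" "u \<bullet> \<nu> i \<in> \<int>"
      using dual_lattice_inner[OF c[OF that(2)] that(3)] comb_inner_b[OF that(3)]
        dual_lattice_inner[OF that(1,3)] by simp_all
    then have "u \<bullet> \<nu> i - c i \<in> \<int>" by simp
    then obtain z :: int where "u \<bullet> \<nu> i - c i = of_int z" by (auto elim: Ints_cases)
    then show ?thesis using \<epsilon> by (cases "z \<le> 0") linarith+
  qed
  have bound: "AE u in ?\<mu>. dhc v ?c u \<noteq> 0 \<longrightarrow> \<bar>u \<bullet> v\<bar> \<le> (\<Sum>I\<in>tops. \<bar>lam v ?c I\<bar>)"
  proof (rule AE_I2, rule impI)
    fix u assume u: "u \<in> space ?\<mu>" "dhc v ?c u \<noteq> 0"
    then have "u \<in> dual_lattice N" by simp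
    then show "\<bar>u \<bullet> v\<bar> \<le> (\<Sum>I\<in>tops. \<bar>lam v ?c I\<bar>)"
      using dhc_slab[OF v _ u(2)] off by (auto simp: dual_lattice_def)
  qed
  have summ: "(\<lambda>u. dhc v ?c u * exp (s * (u \<bullet> v))) abs_summable_on dual_lattice N" if "s < 0" for s
    using lattice_transform(1)[OF v that \<epsilon> c] unfolding abs_summable_complex_of_real .
  have int: "integrable ?\<mu> (\<lambda>u. dhc v ?c u * exp (- 1 * (u \<bullet> v)))"
    using summ[of "-1"] unfolding abs_summable_on_def by simp
  note lim = integral_exp_tendsto[OF _ _ bound int]
  show "dhc v ?c abs_summable_on dual_lattice N"
    unfolding abs_summable_on_def by (rule lim(1)) auto
  have "\<exists>f. f has_fps_expansion scaled_todd (cis (2 * pi * a i)) (of_real (?y I i)) \<and>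
      (\<forall>s. s \<noteq> 0 \<longrightarrow> f s = s * of_real (?y I i) / (1 - cis (2 * pi * a i) * exp (- (s * of_real (?y I i)))))"
    if "I \<in> tops" "i \<in> verts I" for I i and a :: "'s \<Rightarrow> real"
    using generic_coord[OF v that] by (intro scaled_todd_expansion) simp
  then obtain f where f: "\<And>I i a. I \<in> tops \<Longrightarrow> i \<in> verts I \<Longrightarrow>
      f I i a has_fps_expansion scaled_todd (cis (2 * pi * a i)) (of_real (?y I i)) \<and>
      (\<forall>s. s \<noteq> 0 \<longrightarrow> f I i a s = s * of_real (?y I i) / (1 - cis (2 * pi * a i) * exp (- (s * of_real (?y I i)))))"
    by metis
  let ?G = "\<lambda>s. \<Sum>I\<in>tops. of_real (kap v I) * (\<Sum>a\<in>grp I. exp (of_real (lam v c I) * s) * (\<Prod>i\<in>verts I. f I i a s))"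
  let ?H = "\<Sum>I\<in>tops. fps_const (of_real (kap v I)) * (\<Sum>a\<in>grp I. todd_term v c I a)"
  have exp: "?G has_fps_expansion ?H"
    by (intro fps_expansion_intros) (use f in blast)
  have G: "of_real (\<integral>u. dhc v ?c u * exp (s * (u \<bullet> v)) \<partial>?\<mu>) = ?G (of_real s) / of_real s ^ rank \<Delta>"
    if s: "s < 0" for s
  proof -
    have "complex_of_real (\<integral>u. dhc v ?c u * exp (s * (u \<bullet> v)) \<partial>?\<mu>) =
        infsetsum (\<lambda>u. complex_of_real (dhc v ?c u * exp (s * (u \<bullet> v)))) (dual_lattice N)"
      unfolding infsetsum_of_real by (simp add: infsetsum_def)
    also have "\<dots> = (\<Sum>I\<in>tops. of_int (weight \<Delta> I) / of_nat (card (grp I)) *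
      (\<Sum>a\<in>grp I. of_real (exp (s * lam v c I)) *
        geom v s I a))"
      by (rule lattice_transform(2)[OF v s \<epsilon> c])
    also have "\<dots> = (\<Sum>I\<in>tops. (of_real (kap v I) * (\<Sum>a\<in>grp I. exp (of_real (lam v c I) * of_real s) *
        (\<Prod>i\<in>verts I. f I i a (of_real s)))) / of_real s ^ rank \<Delta>)"
    proof (intro sum.cong refl)
      fix I assume I: "I \<in> tops"
      \<comment> \<open>Each of the n geometric factors is multiplied by s y_i to become regular at
        0. This is compensated by s^n and by the product of coordinates in the denominator of
        \<open>kap\<close>.\<close>
      let ?P = "\<Prod>i\<in>verts I. complex_of_real (?y I i)"
      have P0: "?P \<noteq> 0" using generic_coord[OF v I] finite_verts by simp
      have "geom v s I a =
          (\<Prod>i\<in>verts I. f I i a (of_real s)) / (of_real s ^ rank \<Delta> * ?P)" for a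
      proof -
        have "(\<Prod>i\<in>verts I. f I i a (of_real s)) = (\<Prod>i\<in>verts I. of_real s * (of_real (?y I i) *
            (1 / (1 - cis (2 * pi * a i) * exp (- (of_real s * of_real (?y I i)))))))"
          using f[OF I] s by (intro prod.cong refl) simp
        also have "\<dots> = of_real s ^ rank \<Delta> * (?P *
            geom v s I a)"
          unfolding prod.distrib prod_constant card_verts_top[OF I] ..
        finally show ?thesis using P0 s by simp
      qed
      then show "of_int (weight \<Delta> I) / of_nat (card (grp I)) *
        (\<Sum>a\<in>grp I. of_real (exp (s * lam v c I)) *
          geom v s I a) =
        (of_real (kap v I) * (\<Sum>a\<in>grp I. exp (of_real (lam v c I) * of_real s) *
          (\<Prod>i\<in>verts I. f I i a (of_real s)))) / of_real s ^ rank \<Delta>"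
        by (simp add: kap_def sum_distrib_left sum_divide_distrib exp_of_real[symmetric] mult_ac)
    qed
    finally show ?thesis by (simp add: sum_divide_distrib)
  qed
  have "fps_nth ?H (rank \<Delta>) = of_real (\<integral>u. dhc v ?c u \<partial>?\<mu>)"
    by (rule fps_nth_eq_limit[OF exp G lim(2)]) auto
  then show "of_real (infsetsum (dhc v ?c) (dual_lattice N)) =
      (\<Sum>I\<in>tops. of_real (kap v I) * (\<Sum>a\<in>grp I. fps_nth (todd_term v c I a) (rank \<Delta>)))"
    by (simp add: infsetsum_def fps_sum_nth)
qed

end



section \<open>The Todd operator on sums of powers of affine forms\<close>

text \<open>The multi-index records the degrees taken from the factors F, and E supplies the rest.
  Bounding every entry by n keeps the index set finite; the condition removes the multi-indices of
  total degree above n, for which natural subtraction would give 0.\<close>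

lemma fps_nth_mult_prod:
  fixes E :: "'b::comm_ring_1 fps"
  assumes "finite R"
  shows "fps_nth (E * (\<Prod>i\<in>R. F i)) n = (\<Sum>k\<in>R \<rightarrow>\<^sub>E {..n}. (\<Prod>i\<in>R. fps_nth (F i) (k i)) *
    (if sum k R \<le> n then fps_nth E (n - sum k R) else 0))"
  using assms
proof (induction R arbitrary: E rule: finite_induct)
  case empty
  then show ?case by simp
next
  case (insert r R)
  let ?e = "\<lambda>E s. if s \<le> n then fps_nth E (n - s) else 0"
  have "fps_nth (E * (\<Prod>i\<in>insert r R. F i)) n = fps_nth ((E * F r) * (\<Prod>i\<in>R. F i)) n"
    using insert by (simp add: mult.assoc)
  also have "\<dots> = (\<Sum>k\<in>R \<rightarrow>\<^sub>E {..n}. (\<Prod>i\<in>R. fps_nth (F i) (k i)) * ?e (E * F r) (sum k R))"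
    by (rule insert.IH)
  also have "\<dots> = (\<Sum>k\<in>R \<rightarrow>\<^sub>E {..n}. \<Sum>j\<in>{..n}. (\<Prod>i\<in>R. fps_nth (F i) (k i)) *
      (fps_nth (F r) j * ?e E (j + sum k R)))"
  proof (intro sum.cong refl)
    fix k
    have "?e (E * F r) s = (\<Sum>j\<in>{..n}. fps_nth (F r) j * ?e E (j + s))" for s
    proof (cases "s \<le> n")
      case True
      have "fps_nth (E * F r) (n - s) = (\<Sum>j=0..n - s. fps_nth (F r) j * fps_nth E (n - s - j))"
        unfolding mult.commute[of E] by (rule fps_mult_nth)
      also have "\<dots> = (\<Sum>j\<in>{..n}. fps_nth (F r) j * ?e E (j + s))"
        using True by (intro sum.mono_neutral_cong_left) (auto simp: add.commute)
      finally show ?thesis using True by simp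
    qed simp
    then show "(\<Prod>i\<in>R. fps_nth (F i) (k i)) * ?e (E * F r) (sum k R) =
      (\<Sum>j\<in>{..n}. (\<Prod>i\<in>R. fps_nth (F i) (k i)) * (fps_nth (F r) j * ?e E (j + sum k R)))"
      by (simp only: sum_distrib_left)
  qed
  also have "\<dots> = (\<Sum>(j, k)\<in>{..n} \<times> (R \<rightarrow>\<^sub>E {..n}). (\<Prod>i\<in>R. fps_nth (F i) (k i)) *
      (fps_nth (F r) j * ?e E (j + sum k R)))"
    by (subst sum.swap) (rule sum.cartesian_product)
  also have "\<dots> = (\<Sum>(j, k)\<in>{..n} \<times> (R \<rightarrow>\<^sub>E {..n}). (\<Prod>i\<in>insert r R. fps_nth (F i) ((k(r := j)) i)) *
      ?e E (sum (k(r := j)) (insert r R)))"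
  proof (intro sum.cong refl, clarify)
    fix j k
    have "(\<Prod>i\<in>R. fps_nth (F i) ((k(r := j)) i)) = (\<Prod>i\<in>R. fps_nth (F i) (k i))"
      "sum (k(r := j)) R = sum k R"
      using insert(2) by (auto intro!: prod.cong sum.cong)
    then show "(\<Prod>i\<in>R. fps_nth (F i) (k i)) * (fps_nth (F r) j * ?e E (j + sum k R)) =
      (\<Prod>i\<in>insert r R. fps_nth (F i) ((k(r := j)) i)) * ?e E (sum (k(r := j)) (insert r R))"
      using insert(1,2) by (simp add: mult_ac)
  qed
  also have "\<dots> = (\<Sum>k\<in>(\<lambda>(j, k). k(r := j)) ` ({..n} \<times> (R \<rightarrow>\<^sub>E {..n})).
      (\<Prod>i\<in>insert r R. fps_nth (F i) (k i)) * ?e E (sum k (insert r R)))"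
    by (subst sum.reindex[OF inj_combinator[OF insert(2)]]) (simp add: case_prod_unfold)
  also have "(\<lambda>(j, k). k(r := j)) ` ({..n} \<times> (R \<rightarrow>\<^sub>E {..n})) = insert r R \<rightarrow>\<^sub>E {..n}"
    by (simp add: PiE_insert_eq)
  finally show ?case .
qed

text \<open>The j-th derivative of x^n / n!. The condition is essential: for j > n, natural
  subtraction would yield 1 instead of 0.\<close>

definition pow_deriv :: "nat \<Rightarrow> nat \<Rightarrow> real \<Rightarrow> real" where
  "pow_deriv n j x = (if j \<le> n then x ^ (n - j) / fact (n - j) else 0)"

lemma has_derivative_pow_deriv:
  "(pow_deriv n j has_real_derivative pow_deriv n (Suc j) x) (at x)"
proof (cases "Suc j \<le> n")
  case True
  then obtain m where m: "n - j = Suc m" "n - Suc j = m" by (metis Suc_diff_Suc Suc_le_eq)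
  have "((\<lambda>x. x ^ Suc m / fact (Suc m)) has_real_derivative x ^ m / fact m) (at x)"
  proof -
    have "((\<lambda>x. x ^ Suc m / fact (Suc m)) has_real_derivative real (Suc m) * x ^ m / fact (Suc m)) (at x)"
      using DERIV_cdivide[OF DERIV_pow[of "Suc m" x UNIV], of "fact (Suc m)"]
      by (simp del: power_Suc fact_Suc of_nat_Suc)
    also have "real (Suc m) * x ^ m / fact (Suc m) = x ^ m / fact m"
      unfolding fact_Suc by (rule mult_divide_mult_cancel_left) simp
    finally show ?thesis .
  qed
  then show ?thesis using True m by (simp add: pow_deriv_def[abs_def])
next
  case False
  then have "pow_deriv n j = (\<lambda>_. if j = n then 1 else 0)" by (auto simp: pow_deriv_def fun_eq_iff)
  then show ?thesis using False by (simp add: pow_deriv_def)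
qed

locale affine_powers =
  fixes R :: "'s set" and T :: "'t set" and n :: nat and \<alpha> :: "'t \<Rightarrow> real" and \<beta> :: "'t \<Rightarrow> 's \<Rightarrow> real"
  assumes finite_R: "finite R"
begin

text \<open>Order j and weights q are parameters so that the family is closed under partial
  derivatives: each raises j and multiplies the weights by coefficients of the forms.\<close>

definition power_sum :: "nat \<Rightarrow> ('t \<Rightarrow> real) \<Rightarrow> ('s \<Rightarrow> real) \<Rightarrow> real" where
  "power_sum j q h = (\<Sum>I\<in>T. q I * pow_deriv n j (\<alpha> I + (\<Sum>i\<in>R. \<beta> I i * h i)))"

lemma partial_deriv_power_sum:
  assumes i: "i \<in> R"
  shows "partial_deriv i (power_sum j q) = power_sum (Suc j) (\<lambda>I. q I * \<beta> I i)"
proof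
  fix h
  have form: "\<alpha> I + (\<Sum>k\<in>R. \<beta> I k * (h(i := t)) k) = (\<alpha> I + (\<Sum>k\<in>R - {i}. \<beta> I k * h k)) + \<beta> I i * t" for I t
  proof -
    have "(\<Sum>k\<in>R. \<beta> I k * (h(i := t)) k) = \<beta> I i * t + (\<Sum>k\<in>R - {i}. \<beta> I k * (h(i := t)) k)"
      using i finite_R by (subst sum.remove[of _ i]) auto
    also have "(\<Sum>k\<in>R - {i}. \<beta> I k * (h(i := t)) k) = (\<Sum>k\<in>R - {i}. \<beta> I k * h k)"
      by (intro sum.cong) auto
    finally show ?thesis by simp
  qed
  have "((\<lambda>t. q I * pow_deriv n j (\<alpha> I + (\<Sum>k\<in>R. \<beta> I k * (h(i := t)) k))) has_real_derivative
      q I * \<beta> I i * pow_deriv n (Suc j) (\<alpha> I + (\<Sum>k\<in>R. \<beta> I k * h k))) (at (h i))" for I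
  proof -
    let ?g = "\<lambda>t. (\<alpha> I + (\<Sum>k\<in>R - {i}. \<beta> I k * h k)) + \<beta> I i * t"
    have "(?g has_real_derivative \<beta> I i) (at (h i))" by (auto intro!: derivative_eq_intros)
    then have "((\<lambda>t. pow_deriv n j (?g t)) has_real_derivative pow_deriv n (Suc j) (?g (h i)) * \<beta> I i) (at (h i))"
      by (rule DERIV_chain2[OF has_derivative_pow_deriv])
    then have "((\<lambda>t. q I * pow_deriv n j (?g t)) has_real_derivative
        q I * (pow_deriv n (Suc j) (?g (h i)) * \<beta> I i)) (at (h i))"
      by (rule DERIV_cmult)
    moreover have "?g (h i) = \<alpha> I + (\<Sum>k\<in>R. \<beta> I k * h k)" using form[of I "h i"] by simp
    ultimately show ?thesis unfolding form by (simp only: mult_ac)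
  qed
  then have "((\<lambda>t. power_sum j q (h(i := t))) has_real_derivative power_sum (Suc j) (\<lambda>I. q I * \<beta> I i) h) (at (h i))"
    unfolding power_sum_def by (intro DERIV_sum)
  then show "partial_deriv i (power_sum j q) h = power_sum (Suc j) (\<lambda>I. q I * \<beta> I i) h"
    unfolding partial_deriv_def by (rule DERIV_imp_deriv)
qed

lemma partial_deriv_pow_power_sum:
  assumes "i \<in> R"
  shows "(partial_deriv i ^^ k) (power_sum j q) = power_sum (j + k) (\<lambda>I. q I * \<beta> I i ^ k)"
  by (induction k) (simp_all add: partial_deriv_power_sum[OF assms] mult_ac)

lemma multi_deriv_power_sum:
  "multi_deriv R k (power_sum 0 q) = power_sum (sum k R) (\<lambda>I. q I * (\<Prod>i\<in>R. \<beta> I i ^ k i))"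
proof -
  have "foldr (\<lambda>i. partial_deriv i ^^ k i) xs (power_sum 0 q) =
      power_sum (sum k (set xs)) (\<lambda>I. q I * (\<Prod>i\<in>set xs. \<beta> I i ^ k i))"
    if "distinct xs" "set xs \<subseteq> R" for xs
    using that
    by (induction xs) (simp_all add: partial_deriv_pow_power_sum mult_ac add.commute)
  moreover have "distinct (SOME is. distinct is \<and> set is = R) \<and> set (SOME is. distinct is \<and> set is = R) = R"
    by (rule someI_ex) (use finite_distinct_list[OF finite_R] in blast)
  ultimately show ?thesis unfolding multi_deriv_def by simp
qed

text \<open>The s-th derivative of x^n / n! at \<alpha> is the coefficient of order n - s in the
  exponential series of \<alpha>. So applying the operator to one power amounts to taking a
  coefficient of a product, the coefficients of each affine form being absorbed into
  \<open>scaled_todd\<close>.\<close>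

lemma infsum_todd_power_sum:
  fixes \<tau> :: "'s \<Rightarrow> complex"
  shows "(\<Sum>\<^sub>\<infinity>k\<in>(R \<rightarrow>\<^sub>E UNIV). (\<Prod>i\<in>R. fps_nth (todd_series (\<tau> i)) (k i)) *
      of_real (multi_deriv R k (power_sum 0 q) (\<lambda>_. 0))) =
    (\<Sum>I\<in>T. of_real (q I) * fps_nth (fps_exp (of_real (\<alpha> I)) *
      (\<Prod>i\<in>R. scaled_todd (\<tau> i) (of_real (\<beta> I i)))) n)"
proof -
  let ?s = "\<lambda>k. (\<Prod>i\<in>R. fps_nth (todd_series (\<tau> i)) (k i)) *
      complex_of_real (multi_deriv R k (power_sum 0 q) (\<lambda>_. 0))"
  let ?e = "\<lambda>I s. if s \<le> n then fps_nth (fps_exp (complex_of_real (\<alpha> I))) (n - s) else 0"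
  have e: "complex_of_real (pow_deriv n s (\<alpha> I)) = ?e I s" for I s
    by (simp add: pow_deriv_def)
  have summand: "?s k =
    (\<Sum>I\<in>T. of_real (q I) * ((\<Prod>i\<in>R. fps_nth (scaled_todd (\<tau> i) (of_real (\<beta> I i))) (k i)) * ?e I (sum k R)))" for k
    unfolding multi_deriv_power_sum power_sum_def scaled_todd_def
    by (simp add: e sum_distrib_left prod.distrib mult_ac del: fps_exp_nth)
  have "(\<Sum>\<^sub>\<infinity>k\<in>(R \<rightarrow>\<^sub>E UNIV). ?s k) =
    (\<Sum>\<^sub>\<infinity>k\<in>(R \<rightarrow>\<^sub>E {..n}). ?s k)"
  proof (rule infsum_cong_neutral)
    fix k assume k: "k \<in> (R \<rightarrow>\<^sub>E UNIV) - (R \<rightarrow>\<^sub>E {..n})"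
    then obtain i where i: "i \<in> R" "\<not> k i \<le> n" by (auto simp: PiE_iff)
    have "k i \<le> sum k R" using i finite_R by (intro member_le_sum) auto
    then have "\<not> sum k R \<le> n" using i by simp
    then show "?s k = 0" unfolding summand by simp
  next
    fix k assume "k \<in> (R \<rightarrow>\<^sub>E {..n}) - (R \<rightarrow>\<^sub>E UNIV)"
    then show "?s k = 0" by (auto simp: PiE_iff)
  qed simp
  also have "\<dots> = (\<Sum>k\<in>R \<rightarrow>\<^sub>E {..n}. \<Sum>I\<in>T. of_real (q I) *
      ((\<Prod>i\<in>R. fps_nth (scaled_todd (\<tau> i) (of_real (\<beta> I i))) (k i)) * ?e I (sum k R)))"
    unfolding summand using finite_R by (intro infsum_finite finite_PiE) auto
  also have "\<dots> = (\<Sum>I\<in>T. of_real (q I) * (\<Sum>k\<in>R \<rightarrow>\<^sub>E {..n}.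
      (\<Prod>i\<in>R. fps_nth (scaled_todd (\<tau> i) (of_real (\<beta> I i))) (k i)) * ?e I (sum k R)))"
    by (subst sum.swap) (simp only: sum_distrib_left)
  also have "\<dots> = (\<Sum>I\<in>T. of_real (q I) * fps_nth (fps_exp (of_real (\<alpha> I)) *
      (\<Prod>i\<in>R. scaled_todd (\<tau> i) (of_real (\<beta> I i)))) n)"
    by (subst fps_nth_mult_prod[OF finite_R]) (rule refl)
  finally show ?thesis .
qed

end

lemma scaled_todd_zero: "scaled_todd \<rho> 0 = (if \<rho> = 1 then 1 else 0)"
  by (rule fps_ext) (simp add: scaled_todd_def todd_series_0 power_0_left)

section \<open>The group of the fan\<close>

context complete_simple_fan
begin

lemma rho_torus_class:
  assumes "i \<in> rays \<Delta>" "\<And>j. j \<notin> rays \<Delta> \<Longrightarrow> a j = 0"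
  shows "rho i (torus_class \<Delta> a) = cis (2 * pi * a i)"
proof -
  let ?f = "\<lambda>a. exp (2 * of_real pi * \<i> * of_real (a i))"
  have f: "?f b = cis (2 * pi * b i)" for b :: "'s \<Rightarrow> real"
    by (simp add: cis_conv_exp mult_ac)
  have "the_elem (?f ` torus_class \<Delta> a) = ?f a"
  proof (rule the_elem_image_unique)
    show "torus_class \<Delta> a \<noteq> {}" using assms(2) by (auto simp: torus_class_def intro!: exI[of _ a])
    fix b assume "b \<in> torus_class \<Delta> a"
    then have "b i - a i \<in> \<int>" using assms(1) by (simp add: torus_class_def)
    then have "cis (2 * pi * (b i - a i)) = 1" by (rule cis_multiple_2pi)
    then have "cis (2 * pi * (b i - a i)) * cis (2 * pi * a i) = cis (2 * pi * a i)" by simp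
    then show "?f b = ?f a" unfolding f by (simp add: cis_mult algebra_simps)
  qed
  then show ?thesis unfolding rho_def using f by simp
qed

text \<open>An element coming from another maximal cone whose characters are trivial at the rays
  outside I has integral coordinates there. Subtracting this integral combination of primitive
  vectors stays in N and leaves a vector supported on I.\<close>

lemma torus_class_bij:
  assumes I: "I \<in> tops"
  shows "bij_betw (torus_class \<Delta>) (grp I) {g \<in> G_fan \<Delta>. \<forall>i\<in>rays \<Delta> - verts I. rho i g = 1}"
  unfolding bij_betw_def
proof (intro conjI inj_onI equalityI subsetI)
  interpret lattice_simplex "verts I" \<nu> "\<delta> I" "span N" N by (rule top_simplex[OF I])
  have sub: "verts J \<subseteq> rays \<Delta>" for J using verts_in by blast
  have zero: "a j = 0" if "a \<in> reps" "j \<notin> verts I" for a j using that by (simp add: reps_def)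
  {
    fix a a' assume a: "a \<in> reps" "a' \<in> reps" "torus_class \<Delta> a = torus_class \<Delta> a'"
    have "a \<in> torus_class \<Delta> a" using zero[OF a(1)] sub by (auto simp: torus_class_def)
    then have "a \<in> torus_class \<Delta> a'" unfolding a(3) .
    then have *: "\<forall>i\<in>rays \<Delta>. a i - a' i \<in> \<int>" by (simp add: torus_class_def)
    have "a i = a' i" for i
    proof (cases "i \<in> verts I")
      case True
      then show ?thesis using a * sub by (intro eq_if_diff_Ints) (auto simp: reps_def)
    qed (simp add: zero[OF a(1)] zero[OF a(2)])
    then show "a = a'" by blast
  next
    fix g assume "g \<in> torus_class \<Delta> ` reps"
    then obtain a where a: "a \<in> reps" "g = torus_class \<Delta> a" by blast
    have z: "\<And>j. j \<notin> rays \<Delta> \<Longrightarrow> a j = 0" using zero[OF a(1)] sub by blast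
    have "(\<Sum>i\<in>rays \<Delta>. a i *\<^sub>R \<nu> i) = (\<Sum>i\<in>verts I. a i *\<^sub>R \<nu> i)"
      using zero[OF a(1)] sub finite_rays by (intro sum.mono_neutral_right) auto
    then have "g \<in> G_at \<Delta> I" unfolding G_at_def a(2) using a(1) zero[OF a(1)] by (auto simp: reps_def)
    then have "g \<in> G_fan \<Delta>" using I by (auto simp: G_fan_def)
    moreover have "rho i g = 1" if "i \<in> rays \<Delta> - verts I" for i
      unfolding a(2) using that zero[OF a(1), of i] z by (subst rho_torus_class) auto
    ultimately show "g \<in> {g \<in> G_fan \<Delta>. \<forall>i\<in>rays \<Delta> - verts I. rho i g = 1}" by simp
  next
    fix g assume g: "g \<in> {g \<in> G_fan \<Delta>. \<forall>i\<in>rays \<Delta> - verts I. rho i g = 1}"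
    then obtain J a where a: "g = torus_class \<Delta> a" "(\<Sum>i\<in>rays \<Delta>. a i *\<^sub>R \<nu> i) \<in> N"
      "\<And>j. j \<notin> verts J \<Longrightarrow> a j = 0"
      by (auto simp: G_fan_def G_at_def)
    have z: "\<And>j. j \<notin> rays \<Delta> \<Longrightarrow> a j = 0" using a(3) sub by blast
    have aZ: "a i \<in> \<int>" if "i \<in> rays \<Delta> - verts I" for i
    proof -
      have "rho i g = 1" using g that by blast
      then have "cis (2 * pi * a i) = 1" unfolding a(1) using that z by (subst (asm) rho_torus_class) auto
      then show ?thesis unfolding cis_2pi_eq_1_iff .
    qed
    have "(\<Sum>i\<in>verts I. a i *\<^sub>R \<nu> i) =
        (\<Sum>i\<in>rays \<Delta>. a i *\<^sub>R \<nu> i) - (\<Sum>i\<in>rays \<Delta> - verts I. a i *\<^sub>R \<nu> i)"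
      using sum.subset_diff[OF sub finite_rays, of "\<lambda>i. a i *\<^sub>R \<nu> i" I] by simp
    also have "\<dots> \<in> N"
      using aZ ray_vec_props(1) by (intro lattice_diff[OF N a(2)] lattice_sum[OF N] lattice_scale[OF N]) auto
    finally have r: "frac_rep a \<in> reps" by (rule frac_rep_in)
    have "a i - frac_rep a i \<in> \<int>" if "i \<in> rays \<Delta>" for i
      using aZ[of i] that by (auto simp: frac_rep_def frac_def)
    moreover from this have "frac_rep a i - a i \<in> \<int>" if "i \<in> rays \<Delta>" for i
      using Ints_minus[of "a i - frac_rep a i"] that by simp
    ultimately have "torus_class \<Delta> (frac_rep a) = torus_class \<Delta> a"
      unfolding torus_class_def
      by (auto intro: Ints_add[of "b - frac_rep a i" "frac_rep a i - a i" for b i, simplified]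
          Ints_add[of "b - a i" "a i - frac_rep a i" for b i, simplified])
    then show "g \<in> torus_class \<Delta> ` reps" using a(1) r by blast
  }
qed

text \<open>A sum over an infinite set is 0 by convention, so the outer sum of
  \<open>todd_op\<close> has its intended meaning only because of this.\<close>

lemma finite_G_fan: "finite (G_fan \<Delta>)"
proof -
  have "G_fan \<Delta> \<subseteq> (\<Union>I\<in>tops. torus_class \<Delta> ` grp I)"
  proof
    fix g assume g: "g \<in> G_fan \<Delta>"
    then obtain J a where J: "J \<in> tops" and a: "g = torus_class \<Delta> a" "\<And>j. j \<notin> verts J \<Longrightarrow> a j = 0"
      by (auto simp: G_fan_def G_at_def)
    have "rho i g = 1" if "i \<in> rays \<Delta> - verts J" for i
      unfolding a(1) using that a(2)[of i] a(2) verts_in(1) by (subst rho_torus_class) auto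
    then have "g \<in> torus_class \<Delta> ` grp J"
      using torus_class_bij[OF J] g unfolding bij_betw_def by blast
    then show "g \<in> (\<Union>I\<in>tops. torus_class \<Delta> ` grp I)" using J by blast
  qed
  moreover have "finite (\<Union>I\<in>tops. torus_class \<Delta> ` grp I)"
    using finite_tops lattice_simplex.finite_reps[OF top_simplex] by blast
  ultimately show ?thesis by (rule finite_subset)
qed

text \<open>At a ray outside I the second argument of \<open>scaled_todd\<close> is 0, and the
  factor becomes the test \<rho>_i(g) = 1. These tests cut the sum down to the classes matched with
  \<open>reps\<close> by \<open>torus_class_bij\<close>.\<close>

lemma sum_G_fan:
  assumes I: "I \<in> tops"
  shows "(\<Sum>g\<in>G_fan \<Delta>. fps_nth (E * (\<Prod>i\<in>rays \<Delta>. scaled_todd (rho i g) (if i \<in> verts I then y i else 0))) n) =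
    (\<Sum>a\<in>grp I. fps_nth (E * (\<Prod>i\<in>verts I. scaled_todd (cis (2 * pi * a i)) (y i))) n)"
proof -
  let ?S = "{g \<in> G_fan \<Delta>. \<forall>i\<in>rays \<Delta> - verts I. rho i g = 1}"
  have sub: "verts I \<subseteq> rays \<Delta>" using verts_in by blast
  have p: "(\<Prod>i\<in>rays \<Delta>. scaled_todd (rho i g) (if i \<in> verts I then y i else 0)) =
      (if \<forall>i\<in>rays \<Delta> - verts I. rho i g = 1 then \<Prod>i\<in>verts I. scaled_todd (rho i g) (y i) else 0)" for g
  proof -
    have "(\<Prod>i\<in>rays \<Delta>. scaled_todd (rho i g) (if i \<in> verts I then y i else 0)) =
      (\<Prod>i\<in>rays \<Delta> - verts I. if rho i g = 1 then 1 else 0) * (\<Prod>i\<in>verts I. scaled_todd (rho i g) (y i))"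
      unfolding prod.subset_diff[OF sub finite_rays]
      by (intro arg_cong2[where f="(*)"] prod.cong refl) (auto simp: scaled_todd_zero)
    moreover have "(\<Prod>i\<in>rays \<Delta> - verts I. if rho i g = 1 then 1 else 0) =
        (if \<forall>i\<in>rays \<Delta> - verts I. rho i g = 1 then 1 else (0 :: complex fps))"
      using finite_rays by (auto intro!: prod.neutral prod_zero)
    ultimately show ?thesis by simp
  qed
  have "(\<Sum>g\<in>G_fan \<Delta>. fps_nth (E * (\<Prod>i\<in>rays \<Delta>. scaled_todd (rho i g) (if i \<in> verts I then y i else 0))) n) =
      (\<Sum>g\<in>?S. fps_nth (E * (\<Prod>i\<in>verts I. scaled_todd (rho i g) (y i))) n)"
    unfolding p using finite_G_fan by (intro sum.mono_neutral_cong_right) auto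
  also have "\<dots> = (\<Sum>a\<in>grp I. fps_nth (E * (\<Prod>i\<in>verts I. scaled_todd (rho i (torus_class \<Delta> a)) (y i))) n)"
    by (rule sum.reindex_bij_betw[OF torus_class_bij[OF I], symmetric])
  also have "\<dots> = (\<Sum>a\<in>grp I. fps_nth (E * (\<Prod>i\<in>verts I. scaled_todd (cis (2 * pi * a i)) (y i))) n)"
  proof (intro sum.cong refl arg_cong2[where f=fps_nth] arg_cong2[where f="(*)"] prod.cong)
    interpret lattice_simplex "verts I" \<nu> "\<delta> I" "span N" N by (rule top_simplex[OF I])
    fix a i assume a: "a \<in> reps" and i: "i \<in> verts I"
    then have "rho i (torus_class \<Delta> a) = cis (2 * pi * a i)"
      using sub by (intro rho_torus_class) (auto simp: reps_def)
    then show "scaled_todd (rho i (torus_class \<Delta> a)) (y i) = scaled_todd (cis (2 * pi * a i)) (y i)" by simp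
  qed
  finally show ?thesis .
qed

end



section \<open>Multi-polytopes\<close>

context complete_simple_fan
begin

text \<open>A multi-polytope prescribes only that the vectors of the ray are constant on H. The
  resulting inclusion in a level set is an equality by dimension, since the level set is a proper
  affine subset of the span.\<close>

lemma hyperplane_form:
  assumes i: "i \<in> rays \<Delta>" and H: "affine H" "H \<subseteq> span N" "aff_dim H = int (rank \<Delta>) - 1"
    and c: "\<And>u. u \<in> H \<Longrightarrow> u \<bullet> \<nu> i = c"
  shows "H = {u \<in> span N. u \<bullet> \<nu> i = c}"
proof -
  let ?K = "{u \<in> span N. u \<bullet> \<nu> i = c}"
  have \<nu>: "\<nu> i \<in> span N" "\<nu> i \<bullet> \<nu> i > 0" using ray_vec_props(1,2)[OF i] by (auto simp: span_base)
  have rk: "int (rank \<Delta>) = aff_dim (span N)" by (simp add: rank_def aff_dim_subspace)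
  \<comment> \<open>The empty set has affine dimension -1 and would satisfy the dimension hypothesis
    in rank 0; the existence of a ray excludes that rank.\<close>
  have "\<nu> i \<in> span N - {0}" using \<nu> by auto
  then have "rank \<Delta> \<noteq> 0" unfolding rank_def using dim_span[of N] by (metis DiffD1 DiffD2 dim_eq_0 subsetD)
  then have "H \<noteq> {}" using H(3) by auto
  have K: "affine ?K"
  proof -
    have "?K = span N \<inter> {u. \<nu> i \<bullet> u = c}" by (auto simp: inner_commute)
    then show ?thesis by (simp add: affine_Int affine_hyperplane subspace_imp_affine)
  qed
  have HK: "H \<subseteq> ?K" using H(2) c by auto
  have "?K \<noteq> span N"
  proof
    assume K: "?K = span N"
    have "0 \<in> ?K" "\<nu> i \<in> ?K" unfolding K using \<nu> by (simp_all add: span_zero)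
    then show False using \<nu> by auto
  qed
  moreover have "aff_dim ?K \<le> aff_dim (span N)" by (rule aff_dim_subset) auto
  moreover have "?K = span N" if "aff_dim ?K = aff_dim (span N)"
    using HK \<open>H \<noteq> {}\<close> that by (intro affine_dim_equal K subspace_imp_affine subspace_span) auto
  ultimately have "aff_dim ?K < aff_dim (span N)" by linarith
  moreover have "aff_dim H \<le> aff_dim ?K" using HK by (rule aff_dim_subset)
  ultimately have "aff_dim H = aff_dim ?K" using H(3) rk by simp
  then show ?thesis using affine_dim_equal[OF H(1) K \<open>H \<noteq> {}\<close> HK] by simp
qed

text \<open>Both the given multi-polytope and all its shifts are instances of Q, with their own
  constants c.\<close>

context
  fixes Q :: "('s, 'a) multi_polytope" and c :: "'s \<Rightarrow> real"
  assumes fan_Q: "fan Q = \<Delta>"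
    and hyp_Q: "\<And>i. i \<in> rays \<Delta> \<Longrightarrow> hyp Q i = {u \<in> span N. u \<bullet> \<nu> i = c i}"
begin

lemma hyp_const_eq:
  assumes i: "i \<in> rays \<Delta>"
  shows "hyp_const Q i = c i"
  unfolding hyp_const_def fan_Q
proof (rule the_equality)
  show "hyp Q i = {u \<in> span N. u \<bullet> \<nu> i = c i}" by (rule hyp_Q[OF i])
  fix c' assume c': "hyp Q i = {u \<in> span N. u \<bullet> \<nu> i = c'}"
  have "\<nu> i \<in> span N" "\<nu> i \<bullet> \<nu> i \<noteq> 0" using ray_vec_props(1,2)[OF i] by (auto simp: span_base)
  then have "(c i / (\<nu> i \<bullet> \<nu> i)) *\<^sub>R \<nu> i \<in> hyp Q i" unfolding hyp_Q[OF i] by (simp add: span_scale)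
  then show "c' = c i" unfolding c' using \<open>\<nu> i \<bullet> \<nu> i \<noteq> 0\<close> by simp
qed

lemma vertex_eq:
  assumes I: "I \<in> tops"
  shows "vertex Q I = (\<Sum>i\<in>verts I. c i *\<^sub>R \<delta> I i)"
proof -
  interpret dual_bases "verts I" \<nu> "\<delta> I" "span N" by (rule top_dual_bases[OF I])
  let ?p = "\<Sum>i\<in>verts I. c i *\<^sub>R \<delta> I i"
  have "span N \<inter> (\<Inter>i\<in>verts I. hyp Q i) = {?p}"
  proof (intro equalityI subsetI)
    fix u assume "u \<in> span N \<inter> (\<Inter>i\<in>verts I. hyp Q i)"
    then have "u \<in> span N" "\<And>i. i \<in> verts I \<Longrightarrow> u \<bullet> \<nu> i = c i"
      using hyp_Q verts_in(1) by auto
    then have "u = ?p" using sum_d_in comb_inner_b by (intro eq_if_inner_b) auto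
    then show "u \<in> {?p}" by simp
  next
    fix u assume "u \<in> {?p}"
    then show "u \<in> span N \<inter> (\<Inter>i\<in>verts I. hyp Q i)"
      using sum_d_in comb_inner_b hyp_Q verts_in(1) by auto
  qed
  then show ?thesis unfolding vertex_def fan_Q by simp
qed

lemma mem_vertex_cone_iff:
  assumes I: "I \<in> tops" and v: "generic_vec \<Delta> v"
  shows "u \<in> vertex_cone Q v I \<longleftrightarrow>
    u \<in> span N \<and> (\<forall>i\<in>verts I. side (coord v I i) (u \<bullet> \<nu> i - c i) \<noteq> 0)"
proof -
  interpret dual_bases "verts I" \<nu> "\<delta> I" "span N" by (rule top_dual_bases[OF I])
  let ?y = "\<lambda>i. coord v I i"
  \<comment> \<open>Changing the sign of a vector of a basis changes that of its dual vector, so the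
    generators of the cone are dual to the \<open>\<sigma> i *\<^sub>R \<nu> i\<close>, and
    membership becomes a sign condition on the coordinates.\<close>
  define \<sigma> where "\<sigma> = (\<lambda>i. if ?y i > 0 then 1 else -1 :: real)"
  have \<sigma>2: "\<sigma> i * \<sigma> i = 1" for i by (simp add: \<sigma>_def)
  have pos: "dual_vec_pos \<Delta> v I i = \<sigma> i *\<^sub>R \<delta> I i" for i
    by (simp add: dual_vec_pos_def \<sigma>_def inner_commute)
  interpret P: dual_bases "verts I" "dual_vec_pos \<Delta> v I" "\<lambda>i. \<sigma> i *\<^sub>R \<nu> i" "span N"
  proof
    show "finite (verts I)" by (rule fin)
    show "span (dual_vec_pos \<Delta> v I ` verts I) = span N"
    proof (intro antisym span_minimal subspace_span)
      show "dual_vec_pos \<Delta> v I ` verts I \<subseteq> span N" using d_in by (auto simp: pos span_scale)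
      show "N \<subseteq> span (dual_vec_pos \<Delta> v I ` verts I)"
      proof
        fix x assume "x \<in> N"
        then have "x = (\<Sum>i\<in>verts I. (x \<bullet> \<nu> i) *\<^sub>R \<delta> I i)" by (simp add: expand_d span_base)
        also have "\<dots> = (\<Sum>i\<in>verts I. (x \<bullet> \<nu> i * \<sigma> i) *\<^sub>R dual_vec_pos \<Delta> v I i)"
          by (simp add: pos mult.assoc \<sigma>2)
        also have "\<dots> \<in> span (dual_vec_pos \<Delta> v I ` verts I)"
          by (intro span_sum span_scale span_base imageI)
        finally show "x \<in> span (dual_vec_pos \<Delta> v I ` verts I)" .
      qed
    qed
    show "\<sigma> i *\<^sub>R \<nu> i \<in> span N" if "i \<in> verts I" for i using b_in that by (simp add: span_scale)
    show "(\<sigma> i *\<^sub>R \<nu> i) \<bullet> dual_vec_pos \<Delta> v I j = (if i = j then 1 else 0)"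
      if "i \<in> verts I" "j \<in> verts I" for i j
      using dual[OF that(2,1)] by (auto simp: pos \<sigma>2 inner_commute)
  qed
  let ?p = "\<Sum>i\<in>verts I. c i *\<^sub>R \<delta> I i"
  have p: "?p \<in> span N" by (rule sum_d_in)
  have "u \<in> vertex_cone Q v I \<longleftrightarrow> u - ?p \<in> convex_cone hull (dual_vec_pos \<Delta> v I ` verts I)"
    unfolding vertex_cone_def fan_Q vertex_eq[OF I]
    by (metis (no_types, lifting) add_diff_cancel_left' diff_add_cancel add.commute image_iff)
  also have "\<dots> \<longleftrightarrow> u - ?p \<in> span N \<and> (\<forall>i\<in>verts I. 0 \<le> (u - ?p) \<bullet> (\<sigma> i *\<^sub>R \<nu> i))"
    using P.mem_cone_hull_iff[of "verts I"] by simp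
  also have "u - ?p \<in> span N \<longleftrightarrow> u \<in> span N"
    using p span_add[of "u - ?p" N ?p] span_diff[of u N ?p] by auto
  also have "(\<forall>i\<in>verts I. 0 \<le> (u - ?p) \<bullet> (\<sigma> i *\<^sub>R \<nu> i)) \<longleftrightarrow>
      (\<forall>i\<in>verts I. side (?y i) (u \<bullet> \<nu> i - c i) \<noteq> 0)"
    using comb_inner_b by (intro ball_cong refl) (simp add: inner_diff_left side_def \<sigma>_def)
  finally show ?thesis .
qed

text \<open>\<open>dhc\<close> sees only the pairings of u with vectors of the span, hence not the
  component of u orthogonal to it; the vertex cones lie in the span, so membership has to be tested
  separately.\<close>

lemma DH_eq:
  assumes v: "generic_vec \<Delta> v"
  shows "DH v Q u = (if u \<in> span N then dhc v c u else 0)"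
proof -
  have "dual_sign \<Delta> v I * of_int (weight \<Delta> I) * indicator (vertex_cone Q v I) u =
      (if u \<in> span N then of_int (weight \<Delta> I) * (\<Prod>i\<in>verts I. side (coord v I i) (u \<bullet> \<nu> i - c i)) else 0)"
    if I: "I \<in> tops" for I
  proof (cases "u \<in> vertex_cone Q v I")
    case True
    then have u: "u \<in> span N" "\<And>i. i \<in> verts I \<Longrightarrow> side (coord v I i) (u \<bullet> \<nu> i - c i) \<noteq> 0"
      using mem_vertex_cone_iff[OF I v] by auto
    have "(\<Prod>i\<in>verts I. side (coord v I i) (u \<bullet> \<nu> i - c i)) =
        (\<Prod>i\<in>verts I. if \<delta> I i \<bullet> v > 0 then -1 else 1)"
    proof (intro prod.cong refl)
      fix i assume "i \<in> verts I"
      from u(2)[OF this] show "side (coord v I i) (u \<bullet> \<nu> i - c i) =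
          (if \<delta> I i \<bullet> v > 0 then -1 else 1)"
        unfolding inner_commute[of "\<delta> I i"] by (simp add: side_def split: if_splits)
    qed
    also have "\<dots> = dual_sign \<Delta> v I"
      unfolding dual_sign_def using finite_verts by (simp add: prod.If_cases Int_def)
    finally show ?thesis using True u(1) by simp
  next
    case False
    then have "u \<notin> span N \<or> (\<exists>i\<in>verts I. side (coord v I i) (u \<bullet> \<nu> i - c i) = 0)"
      using mem_vertex_cone_iff[OF I v] by blast
    then show ?thesis using False finite_verts by (auto simp: prod_zero_iff)
  qed
  then show ?thesis unfolding DH_def fan_Q dhc_def by (simp add: sum.neutral)
qed

lemma vol_eq:
  assumes v: "generic_vec \<Delta> v"
  shows "vol v Q = (\<Sum>I\<in>tops. kap v I * lam v c I ^ rank \<Delta> / fact (rank \<Delta>))"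
proof -
  note [measurable_cong] = sets_dual_measure_N
  have "closed (span N)" by (rule closed_subspace) simp
  then have [measurable]: "span N \<in> sets borel" by (rule borel_closed)
  have "vol v Q = (\<integral>u. (if u \<in> span N then dhc v c u else 0) \<partial>dual_measure N)"
    unfolding vol_def fan_Q DH_eq[OF v] ..
  also have "\<dots> = (\<integral>u. dhc v c u \<partial>dual_measure N)"
    by (rule integral_cong_AE) (measurable, use AE_generic_point[of c] in eventually_elim, auto)
  finally show ?thesis using integral_dhc[OF v] by simp
qed

end

end

theorem theorem8p7:
  fixes P :: "('s::order, 'a::euclidean_space) multi_polytope"
    and v :: 'a
  assumes "simple_polytope P"
    and "lattice_polytope P"
    and "generic_vec (fan P) v"
  shows "todd_op (fan P) (\<lambda>h. vol v (shift P h)) (\<lambda>_. 0) = of_real (sharp v P)"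
proof -
  interpret complete_simple_fan "fan P"
    using assms(1) by unfold_locales (auto simp: simple_polytope_def multi_polytope_def)
  note v = assms(3)
  have "\<exists>c. hyp P i = {u \<in> span N. u \<bullet> \<nu> i = c}" if i: "i \<in> rays (fan P)" for i
  proof -
    have H: "affine (hyp P i)" "hyp P i \<subseteq> span N" "aff_dim (hyp P i) = int (rank (fan P)) - 1"
      "\<And>x. x \<in> C i \<Longrightarrow> \<exists>c. \<forall>u\<in>hyp P i. u \<bullet> x = c"
      using assms(1) i by (auto simp: simple_polytope_def multi_polytope_def)
    have "\<nu> i \<in> C i" using ray_vec_props(3)[OF i] by (simp add: hull_inc)
    then obtain c where "\<forall>u\<in>hyp P i. u \<bullet> \<nu> i = c" using H(4) by blast
    then show ?thesis using hyperplane_form[OF i H(1-3)] by blast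
  qed
  then obtain c where c: "\<And>i. i \<in> rays (fan P) \<Longrightarrow> hyp P i = {u \<in> span N. u \<bullet> \<nu> i = c i}" by metis
  note hyp_const_P = hyp_const_eq[OF refl c] and vertex_P = vertex_eq[OF refl c]
  have vert: "(\<Sum>i\<in>verts I. c i *\<^sub>R \<delta> I i) \<in> dual_lattice N" if "I \<in> tops" for I
  proof -
    have "vertex P I \<in> dual_lattice N" using assms(2) that by (simp add: lattice_polytope_def)
    then show ?thesis using vertex_P[OF _ that] by simp
  qed
  have fan_shift: "fan (shift P h) = fan P" for h by (simp add: shift_def)
  have hyp_shift: "hyp (shift P h) i = {u \<in> span N. u \<bullet> \<nu> i = c i + h i}" if "i \<in> rays (fan P)" for h i
    using hyp_const_P[OF _ that] by (simp add: shift_def)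
  let ?n = "rank (fan P)" and ?y = "\<lambda>I i. coord v I i"
  \<comment> \<open>Moving a hyperplane that does not belong to I leaves the vertex of I in place,
    so its ray has coefficient 0 in the affine form of I.\<close>
  let ?\<beta> = "\<lambda>I i. if i \<in> verts I then ?y I i else 0"
  interpret affine_powers "rays (fan P)" tops ?n "lam v c" ?\<beta>
    by unfold_locales (rule finite_rays)
  have "vol v (shift P h) = power_sum 0 (kap v) h" for h
  proof -
    have "lam v (\<lambda>i. c i + h i) I = lam v c I + (\<Sum>i\<in>rays (fan P). ?\<beta> I i * h i)" for I
    proof -
      have "(\<Sum>i\<in>rays (fan P). ?\<beta> I i * h i) = (\<Sum>i\<in>verts I. h i * ?y I i)"
        using verts_in(1) finite_rays by (intro sum.mono_neutral_cong_right) auto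
      then show ?thesis by (simp add: lam_def distrib_right sum.distrib)
    qed
    moreover have "vol v (shift P h) =
        (\<Sum>I\<in>tops. kap v I * lam v (\<lambda>i. c i + h i) I ^ ?n / fact ?n)"
      by (rule vol_eq[OF fan_shift _ v]) (rule hyp_shift)
    ultimately show ?thesis unfolding power_sum_def pow_deriv_def by simp
  qed
  then have vol: "(\<lambda>h. vol v (shift P h)) = power_sum 0 (kap v)" by blast
  let ?A = "\<Sum>I\<in>tops. of_real (kap v I) * (\<Sum>a\<in>grp I. fps_nth (todd_term v c I a) ?n)"
  have "todd_op (fan P) (\<lambda>h. vol v (shift P h)) (\<lambda>_. 0) =
      (\<Sum>g\<in>G_fan (fan P). \<Sum>I\<in>tops. of_real (kap v I) * fps_nth (fps_exp (of_real (lam v c I)) *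
        (\<Prod>i\<in>rays (fan P). scaled_todd (rho i g) (of_real (?\<beta> I i)))) ?n)"
    unfolding vol todd_op_def by (intro sum.cong refl infsum_todd_power_sum)
  also have "\<dots> = (\<Sum>I\<in>tops. of_real (kap v I) * (\<Sum>g\<in>G_fan (fan P). fps_nth (fps_exp (of_real (lam v c I)) *
        (\<Prod>i\<in>rays (fan P). scaled_todd (rho i g) (if i \<in> verts I then of_real (?y I i) else 0))) ?n))"
    by (subst sum.swap) (simp only: sum_distrib_left if_distrib[of of_real] of_real_0)
  also have "\<dots> = ?A"
    by (intro sum.cong refl arg_cong2[where f="(*)"] sum_G_fan)
  finally have todd: "todd_op (fan P) (\<lambda>h. vol v (shift P h)) (\<lambda>_. 0) = ?A" .
  have lattice_count: "of_real (infsetsum (dhc v (\<lambda>i. c i + \<epsilon>)) (dual_lattice N)) = ?A" if "0 < \<epsilon>" "\<epsilon> < 1" for \<epsilon>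
    by (rule lattice_count_dhc(2)[OF v that]) (rule vert)
  \<comment> \<open>The value is the same for every \<epsilon> between 0 and 1, so this interval is
    small enough for the eventual value in \<open>sharp\<close>.\<close>
  have count: "(\<Sum>\<^sub>\<infinity>u\<in>dual_lattice N. DH v (shift P (\<lambda>_. \<epsilon>)) u) = Re ?A" if \<epsilon>: "0 < \<epsilon>" "\<epsilon> < 1" for \<epsilon>
  proof -
    have "DH v (shift P (\<lambda>_. \<epsilon>)) u = (if u \<in> span N then dhc v (\<lambda>i. c i + \<epsilon>) u else 0)" for u
      by (rule DH_eq[OF fan_shift _ v]) (rule hyp_shift)
    then have "(\<Sum>\<^sub>\<infinity>u\<in>dual_lattice N. DH v (shift P (\<lambda>_. \<epsilon>)) u) =
        (\<Sum>\<^sub>\<infinity>u\<in>dual_lattice N. dhc v (\<lambda>i. c i + \<epsilon>) u)"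
      by (intro infsum_cong) (simp add: dual_lattice_def)
    also have "\<dots> = infsetsum (dhc v (\<lambda>i. c i + \<epsilon>)) (dual_lattice N)"
      by (rule infsetsum_infsum[symmetric]) (rule lattice_count_dhc(1)[OF v \<epsilon>], rule vert)
    also have "\<dots> = Re ?A"
      unfolding lattice_count[OF \<epsilon>, symmetric] by simp
    finally show ?thesis .
  qed
  \<comment> \<open>A sum of complex Todd coefficients is real because it equals a lattice count; 1
    / 2 is just one admissible shift.\<close>
  have A: "of_real (Re ?A) = ?A"
  proof -
    have "of_real (infsetsum (dhc v (\<lambda>i. c i + 1 / 2)) (dual_lattice N)) = ?A"
      by (rule lattice_count) simp_all
    from this[symmetric] show ?thesis by (simp only: Re_complex_of_real)
  qed
  have ev: "\<forall>\<^sub>F \<epsilon> in at_right 0. (\<Sum>\<^sub>\<infinity>u\<in>dual_lattice N. DH v (shift P (\<lambda>_. \<epsilon>)) u) = Re ?A"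
    using eventually_at_right_real[of 0 "1::real"] by (rule eventually_mono) (simp_all only: zero_less_one greaterThanLessThan_iff count)
  have "sharp v P = Re ?A"
    unfolding sharp_def
  proof (rule the_equality)
    show "\<forall>\<^sub>F \<epsilon> in at_right 0. (\<Sum>\<^sub>\<infinity>u\<in>dual_lattice N. DH v (shift P (\<lambda>_. \<epsilon>)) u) = Re ?A" by (rule ev)
    fix s assume "\<forall>\<^sub>F \<epsilon> in at_right 0. (\<Sum>\<^sub>\<infinity>u\<in>dual_lattice N. DH v (shift P (\<lambda>_. \<epsilon>)) u) = s"
    with ev have "\<forall>\<^sub>F \<epsilon> in at_right (0::real). s = Re ?A" by eventually_elim simp
    then show "s = Re ?A" by simp
  qed
  then show ?thesis using todd A by simp
qed

end
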